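(* Let $E$ and $F$ be real Banach lattices such that $E^*$ and $F^*$ are lattice isomorphic and at least one of $E^*$, $F^*$ has order continuous norm. Then for every $n\in\mathbb{N}$ and every Banach lattice $G$, $\mathcal{P}^r_o(^nE;G^* )$ and $\mathcal{P}^r_o(^nF;G^* )$ are lattice isomorphic.
   Context: For Banach lattices $E,H$ with $H$ Dedekind complete, $\mathcal{P}^r(^nE;H)$ is the Banach lattice of regular $n$-homogeneous polynomials (differences of positive ones, where $P$ is positive if its symmetric $n$-linear map $T_P$ is positive) with the regular norm $\|P\|_r=\||P|\|$. A regular polynomial $P$ is orthogonally additive if $P(x+y)=P(x)+P(y)$ whenever $|x|\wedge|y|=0$ (equivalently, $T_P$ vanishes whenever two of its arguments are disjoint). $\mathcal{P}^r_o(^nE;H)$ denotes the Banach lattice of all $P\in\mathcal{P}^r(^nE;H)$ such that $|P|$ is orthogonally additive. *)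

theory Defs
  imports "HOL-Analysis.Analysis"
begin

section \<open>Real Banach lattices\<close>

text \<open>A real Banach lattice: a Banach space which is a vector lattice (translation
  invariant, positively homogeneous lattice order) with a lattice norm
  (|x| \<le> |y| implies norm x \<le> norm y, where |x| = x \<squnion> -x).\<close>

class banach_lattice = banach + lattice + ordered_real_vector +
  assumes norm_lattice: "sup x (- x) \<le> sup y (- y) \<Longrightarrow> norm x \<le> norm y"

section \<open>Generic order-theoretic notions on a carrier with an order relation\<close>

definition is_sup_in :: "'v set \<Rightarrow> ('v \<Rightarrow> 'v \<Rightarrow> bool) \<Rightarrow> 'v \<Rightarrow> 'v \<Rightarrow> 'v \<Rightarrow> bool" where
  "is_sup_in C le a b s \<longleftrightarrow> s \<in> C \<and> le a s \<and> le b s \<and> (\<forall>u\<in>C. le a u \<and> le b u \<longrightarrow> le s u)"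

definition is_inf_set_in :: "'v set \<Rightarrow> ('v \<Rightarrow> 'v \<Rightarrow> bool) \<Rightarrow> 'v set \<Rightarrow> 'v \<Rightarrow> bool" where
  "is_inf_set_in C le D s \<longleftrightarrow> s \<in> C \<and> (\<forall>d\<in>D. le s d) \<and> (\<forall>u\<in>C. (\<forall>d\<in>D. le u d) \<longrightarrow> le u s)"

text \<open>Lattice isomorphism of two normed vector lattices (given by carrier, addition,
  scalar multiplication, order and norm): a linear bijection which preserves
  (and reflects) binary suprema, bounded with bounded inverse.\<close>

definition lattice_isomorphic ::
  "'v set \<Rightarrow> ('v \<Rightarrow> 'v \<Rightarrow> 'v) \<Rightarrow> (real \<Rightarrow> 'v \<Rightarrow> 'v) \<Rightarrow> ('v \<Rightarrow> 'v \<Rightarrow> bool) \<Rightarrow> ('v \<Rightarrow> real) \<Rightarrow>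
   'w set \<Rightarrow> ('w \<Rightarrow> 'w \<Rightarrow> 'w) \<Rightarrow> (real \<Rightarrow> 'w \<Rightarrow> 'w) \<Rightarrow> ('w \<Rightarrow> 'w \<Rightarrow> bool) \<Rightarrow> ('w \<Rightarrow> real) \<Rightarrow> bool" where
  "lattice_isomorphic C1 add1 sc1 le1 N1 C2 add2 sc2 le2 N2 \<longleftrightarrow>
     (\<exists>\<Phi>. bij_betw \<Phi> C1 C2
        \<and> (\<forall>x\<in>C1. \<forall>y\<in>C1. \<Phi> (add1 x y) = add2 (\<Phi> x) (\<Phi> y))
        \<and> (\<forall>a. \<forall>x\<in>C1. \<Phi> (sc1 a x) = sc2 a (\<Phi> x))
        \<and> (\<forall>x\<in>C1. \<forall>y\<in>C1. \<forall>s\<in>C1. is_sup_in C1 le1 x y s \<longleftrightarrow> is_sup_in C2 le2 (\<Phi> x) (\<Phi> y) (\<Phi> s))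
        \<and> (\<exists>K. \<forall>x\<in>C1. N2 (\<Phi> x) \<le> K * N1 x)
        \<and> (\<exists>K. \<forall>x\<in>C1. N1 x \<le> K * N2 (\<Phi> x)))"

text \<open>Order continuous norm: whenever a downward directed set D decreases to 0
  (i.e. 0 is its infimum), inf of the norms over D is 0 (equivalently for nets x_a \<down> 0,
  norm x_a \<rightarrow> 0).\<close>

definition order_continuous_norm :: "'v set \<Rightarrow> ('v \<Rightarrow> 'v \<Rightarrow> bool) \<Rightarrow> ('v \<Rightarrow> real) \<Rightarrow> 'v \<Rightarrow> bool" where
  "order_continuous_norm C le N z \<longleftrightarrow>
     (\<forall>D. D \<subseteq> C \<and> D \<noteq> {} \<and> (\<forall>a\<in>D. \<forall>b\<in>D. \<exists>c\<in>D. le c a \<and> le c b) \<and> is_inf_set_in C le D z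
          \<longrightarrow> (\<forall>\<epsilon>>0. \<exists>d\<in>D. N d < \<epsilon>))"

section \<open>Dual Banach lattice\<close>

text \<open>The dual E* is the type of bounded linear functionals with the dual order: f \<le> g iff f x \<le> g x for all x \<ge> 0.\<close>

definition dual_le :: "('a::banach_lattice \<Rightarrow>\<^sub>L real) \<Rightarrow> ('a \<Rightarrow>\<^sub>L real) \<Rightarrow> bool" where
  "dual_le f g \<longleftrightarrow> (\<forall>x. 0 \<le> x \<longrightarrow> blinfun_apply f x \<le> blinfun_apply g x)"

definition dual_lattice_isomorphic ::
  "('a::banach_lattice \<Rightarrow>\<^sub>L real) set \<Rightarrow> ('b::banach_lattice \<Rightarrow>\<^sub>L real) set \<Rightarrow> bool" where
  "dual_lattice_isomorphic A B \<longleftrightarrow>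
     lattice_isomorphic A (+) (*\<^sub>R) dual_le norm B (+) (*\<^sub>R) dual_le norm"

definition dual_order_continuous_norm :: "('a::banach_lattice \<Rightarrow>\<^sub>L real) set \<Rightarrow> bool" where
  "dual_order_continuous_norm A \<longleftrightarrow> order_continuous_norm A dual_le norm 0"

section \<open>Regular homogeneous polynomials with values in a dual G*\<close>

text \<open>n-linear maps E^n \<rightarrow> G* are represented as functions on lists, only their values on
  lists of length n matter.\<close>

definition multilinear :: "nat \<Rightarrow> ('a::real_vector list \<Rightarrow> 'h::real_vector) \<Rightarrow> bool" where
  "multilinear n T \<longleftrightarrow>
     (\<forall>xs i u v a b. length xs = n \<and> i < n \<longrightarrow>
        T (xs[i := a *\<^sub>R u + b *\<^sub>R v]) = a *\<^sub>R T (xs[i := u]) + b *\<^sub>R T (xs[i := v]))"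

definition symmetric_ml :: "nat \<Rightarrow> ('a list \<Rightarrow> 'h) \<Rightarrow> bool" where
  "symmetric_ml n T \<longleftrightarrow> (\<forall>xs ys. length xs = n \<and> mset xs = mset ys \<longrightarrow> T xs = T ys)"

definition positive_ml :: "nat \<Rightarrow> ('a::banach_lattice list \<Rightarrow> ('g::banach_lattice \<Rightarrow>\<^sub>L real)) \<Rightarrow> bool" where
  "positive_ml n T \<longleftrightarrow> (\<forall>xs. length xs = n \<and> (\<forall>x\<in>set xs. 0 \<le> x) \<longrightarrow> dual_le 0 (T xs))"

definition poly_of :: "nat \<Rightarrow> ('a list \<Rightarrow> 'h) \<Rightarrow> 'a \<Rightarrow> 'h" where
  "poly_of n T = (\<lambda>x. T (replicate n x))"

text \<open>P is positive iff its symmetric n-linear map T_P is positive.\<close>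

definition positive_poly :: "nat \<Rightarrow> ('a::banach_lattice \<Rightarrow> ('g::banach_lattice \<Rightarrow>\<^sub>L real)) \<Rightarrow> bool" where
  "positive_poly n P \<longleftrightarrow>
     (\<exists>T. multilinear n T \<and> symmetric_ml n T \<and> positive_ml n T \<and> P = poly_of n T)"

definition regular_polys :: "nat \<Rightarrow> ('a::banach_lattice \<Rightarrow> ('g::banach_lattice \<Rightarrow>\<^sub>L real)) set" where
  "regular_polys n = {P. \<exists>P1 P2. positive_poly n P1 \<and> positive_poly n P2 \<and> P = (\<lambda>x. P1 x - P2 x)}"

definition poly_le :: "nat \<Rightarrow> ('a::banach_lattice \<Rightarrow> ('g::banach_lattice \<Rightarrow>\<^sub>L real)) \<Rightarrow> ('a \<Rightarrow> ('g \<Rightarrow>\<^sub>L real)) \<Rightarrow> bool" where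
  "poly_le n P Q \<longleftrightarrow> positive_poly n (\<lambda>x. Q x - P x)"

text \<open>Modulus |P| = P \<squnion> (-P) in the lattice P^r(^nE;G*).\<close>

definition poly_abs :: "nat \<Rightarrow> ('a::banach_lattice \<Rightarrow> ('g::banach_lattice \<Rightarrow>\<^sub>L real)) \<Rightarrow> ('a \<Rightarrow> ('g \<Rightarrow>\<^sub>L real))" where
  "poly_abs n P = (THE S. is_sup_in (regular_polys n) (poly_le n) P (\<lambda>x. - P x) S)"

definition orth_additive :: "('a::banach_lattice \<Rightarrow> 'h::real_vector) \<Rightarrow> bool" where
  "orth_additive P \<longleftrightarrow>
     (\<forall>x y. inf (sup x (- x)) (sup y (- y)) = 0 \<longrightarrow> P (x + y) = P x + P y)"

definition orth_regular_polys :: "nat \<Rightarrow> ('a::banach_lattice \<Rightarrow> ('g::banach_lattice \<Rightarrow>\<^sub>L real)) set" where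
  "orth_regular_polys n = {P \<in> regular_polys n. orth_additive (poly_abs n P)}"

definition poly_norm :: "('a::real_normed_vector \<Rightarrow> 'h::real_normed_vector) \<Rightarrow> real" where
  "poly_norm P = Sup ((\<lambda>x. norm (P x)) ` {x. norm x \<le> 1})"

text \<open>Regular norm ||P||_r = || |P| ||.\<close>

definition regular_norm :: "nat \<Rightarrow> ('a::banach_lattice \<Rightarrow> ('g::banach_lattice \<Rightarrow>\<^sub>L real)) \<Rightarrow> real" where
  "regular_norm n P = poly_norm (poly_abs n P)"

definition orth_poly_lattice_isomorphic ::
  "nat \<Rightarrow> ('a::banach_lattice \<Rightarrow> ('g::banach_lattice \<Rightarrow>\<^sub>L real)) set \<Rightarrow> ('b::banach_lattice \<Rightarrow> ('g \<Rightarrow>\<^sub>L real)) set \<Rightarrow> bool" where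
  "orth_poly_lattice_isomorphic n A B \<longleftrightarrow>
     lattice_isomorphic
       A (\<lambda>P Q x. P x + Q x) (\<lambda>a P x. a *\<^sub>R P x) (poly_le n) (regular_norm n)
       B (\<lambda>P Q x. P x + Q x) (\<lambda>a P x. a *\<^sub>R P x) (poly_le n) (regular_norm n)"

end

(* Let s : E* -> F* be a lattice isomorphism. A symmetric n-linear form M on E is carried to F one
   variable at a time: with the other arguments fixed, M is an element of E* in the chosen variable,
   and s turns it into an element of F*. Carrying the variables back by the inverse of s recovers M,
   so all that matters is that the result is again symmetric, positive and orthosymmetric. Both
   symmetry and orthosymmetry concern two variables only, hence a positive orthosymmetric bilinear
   form B. Such a B is positive semidefinite, as B(x,x) = B(|x|,|x|), so every functional that is
   bounded for the seminorm sqrt B(x,x) is a norm limit of functionals B(e,.), by the minimising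
   argument behind the Riesz representation theorem. Therefore the two orders of exchanging the two
   variables agree, and disjointness in F is respected.

   Orthogonally additive positive polynomials correspond to orthosymmetric positive forms, and by a
   Riesz-Kantorovich formula for multilinear maps the modulus of a regular polynomial exists; thus
   the orthogonally regular polynomials are the differences of positive orthogonally additive ones,
   on which the exchange of variables acts as an order isomorphism. *)
theory Submission
  imports Defs "HOL-Library.Lattice_Algebras"
begin

section \<open>Vector lattices\<close>

\<comment> \<open>An isomorphism of the duals gives no map between E and F: a point y of F is
  visible only as the functional \<open>\<phi> \<mapsto> s \<phi> y\<close> on the dual of E, an
  element of the bidual. Exchanging all variables thus evaluates an iterated Arens extension of M at
  such bidual elements. For general bilinear forms the two Arens extensions may differ, and nothing
  forces them to respect disjointness in F. This is the obstacle. It is removed by Cauchy-Schwarz,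
  which makes every functional \<open>x \<mapsto> u (A x)\<close>, with \<open>A x = B x\<close> and
  \<open>u\<close> in the bidual, bounded for the seminorm. E need not be complete for that
  seminorm, so no exact representing element is available; the arguments carry an error
  \<open>\<delta>\<close> whose factors stay bounded as \<open>\<delta>\<close> tends to 0. Values
  in the dual of G are treated by fixing \<open>g \<ge> 0\<close>, working with scalar forms, and
  recovering linearity and continuity in \<open>g\<close> at the end. The constant
  \<open>n ^ n\<close> in the norm estimates arises because n vectors of the unit ball lie below one
  vector of norm at most n.\<close>
subclass (in banach_lattice) lattice_ab_group_add ..

abbreviation modulus :: "'a::banach_lattice \<Rightarrow> 'a" where
  "modulus x \<equiv> sup x (- x)"

abbreviation nonneg_list :: "'a::banach_lattice list \<Rightarrow> bool" where
  "nonneg_list xs \<equiv> \<forall>x\<in>set xs. 0 \<le> x"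

lemma modulus_nonneg [simp]: "0 \<le> modulus (x::'a::banach_lattice)"
proof -
  have "0 = x + - x" by simp
  also have "\<dots> \<le> modulus x + modulus x" by (intro add_mono) auto
  finally show ?thesis by simp
qed

lemma modulus_of_nonneg: "0 \<le> (x::'a::banach_lattice) \<Longrightarrow> modulus x = x"
  by (metis neg_le_0_iff_le order.trans sup.absorb1)

lemma norm_mono_lattice: "0 \<le> (x::'a::banach_lattice) \<Longrightarrow> x \<le> y \<Longrightarrow> norm x \<le> norm y"
  by (metis modulus_of_nonneg norm_lattice order.trans)

lemma norm_modulus [simp]: "norm (modulus (x::'a::banach_lattice)) = norm x"
  by (metis antisym modulus_nonneg modulus_of_nonneg norm_lattice order_refl)

lemma pprt_le_modulus: "pprt (x::'a::banach_lattice) \<le> modulus x"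
  unfolding pprt_def by simp

lemma norm_pprt_le: "norm (pprt (x::'a::banach_lattice)) \<le> norm x"
  by (metis norm_modulus norm_mono_lattice pprt_le_modulus zero_le_pprt)

lemma pprt_diff: "(x::'a::banach_lattice) = pprt x - pprt (- x)"
  by (metis diff_minus_eq_add minus_minus pprt_neg prts)

text \<open>As \<open>- inf x y = sup (- x) (- y)\<close>, the remainder \<open>x - inf x y\<close>
  is \<open>sup 0 (x - y)\<close>. The later splittings of an element into a part below a bound and
  an excess rest on this identity.\<close>

lemma inf_diff_eq_pprt: "(x::'a::banach_lattice) = inf x y + pprt (x - y)"
proof -
  have "x - inf x y = x + sup (- x) (- y)" by (rule diff_inf_eq_sup)
  also have "\<dots> = sup 0 (x - y)" by (simp only: add_sup_distrib_left) simp
  finally show ?thesis by (metis pprt_def sup_commute add.commute diff_add_cancel)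
qed

lemma modulus_eq_pprt: "modulus (x::'a::banach_lattice) = pprt x + pprt (- x)"
proof -
  have "sup x (- x) + x = sup (x + x) 0" by (simp add: add_sup_distrib_right)
  moreover have "sup (x + x) 0 = pprt x + pprt x"
  proof -
    \<comment> \<open>\<open>x\<close> is the midpoint of \<open>x + x\<close> and \<open>0\<close>;
      this absorbs the two mixed terms in the expansion of \<open>pprt x + pprt x\<close>.\<close>
    have le: "x \<le> sup (x + x) 0"
    proof -
      have "x + x \<le> sup (x + x) 0 + sup (x + x) 0"
        by (metis add.right_neutral add_mono sup.cobounded1 sup.cobounded2)
      then have "0 \<le> (sup (x + x) 0 - x) + (sup (x + x) 0 - x)" by (simp add: algebra_simps)
      then show ?thesis by simp
    qed
    have "pprt x + x = sup (x + x) x" by (simp add: pprt_def add_sup_distrib_right)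
    then have "pprt x + pprt x = sup (sup (x + x) x) (sup x 0)"
      by (metis add.right_neutral add_sup_distrib_left pprt_def)
    also have "\<dots> = sup (x + x) 0"
      by (rule antisym) (use le in \<open>auto intro: le_supI1 le_supI2\<close>)
    finally show ?thesis by simp
  qed
  moreover have "pprt x - x = pprt (- x)" using pprt_diff[of x] by (simp add: algebra_simps)
  ultimately show ?thesis by (metis add_diff_cancel_right' add_diff_eq)
qed

text \<open>For the elements \<open>pprt x\<close> and \<open>pprt (- x)\<close> the excess in
  \<open>inf_diff_eq_pprt\<close> is all of \<open>pprt x\<close>, so nothing is left for the
  infimum.\<close>

lemma inf_pprt_neg: "inf (pprt (x::'a::banach_lattice)) (pprt (- x)) = 0"
  using inf_diff_eq_pprt[of "pprt x" "pprt (- x)"] pprt_diff[of x] by simp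

lemma pprt_subadd: "pprt (x + y) \<le> pprt x + pprt (y::'a::banach_lattice)"
  by (simp add: pprt_def add_mono add_increasing2 )

section \<open>Disjoint elements\<close>

lemma disjoint_mono:
  fixes x y :: "'a::banach_lattice"
  assumes "inf x y = 0" "0 \<le> u" "u \<le> x" "0 \<le> v" "v \<le> y"
  shows "inf u v = 0"
proof (rule antisym)
  show "inf u v \<le> 0" using inf_mono[OF assms(3,5)] assms(1) by simp
  show "0 \<le> inf u v" using assms by simp
qed

text \<open>Raising \<open>x\<close> to \<open>x + z\<close> turns the infimum into
  \<open>z + inf x y = z\<close>; meeting with \<open>x\<close> once more leaves
  \<open>inf x z = 0\<close>.\<close>

lemma disjoint_add:
  fixes x y z :: "'a::banach_lattice"
  assumes "inf x y = 0" "inf x z = 0"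
  shows "inf x (y + z) = 0"
proof -
  have nn: "0 \<le> x" "0 \<le> y" "0 \<le> z"
    using assms by (metis inf.cobounded1, metis inf.cobounded2, metis assms(2) inf.cobounded2)
  have "inf x (y + z) \<le> inf (x + z) (y + z)" by (rule inf_mono) (use nn in auto)
  also have "\<dots> = z" by (simp add: add_inf_distrib_right[symmetric] assms)
  finally have "inf x (y + z) \<le> inf x z" by simp
  then show ?thesis using nn assms by (intro antisym) auto
qed

text \<open>Natural multiples follow from \<open>disjoint_add\<close>, and a real multiple lies
  below a natural one.\<close>

lemma disjoint_scale:
  fixes x y :: "'a::banach_lattice"
  assumes "inf x y = 0" "0 \<le> (t::real)"
  shows "inf x (t *\<^sub>R y) = 0"
proof -
  have nn: "0 \<le> x" "0 \<le> y"
    using assms by (metis inf.cobounded1, metis assms(1) inf.cobounded2)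
  have *: "inf x (real n *\<^sub>R y) = 0" for n
  proof (induction n)
    case 0 then show ?case using nn by (simp add: inf.absorb2)
  next
    case (Suc n)
    then show ?case using disjoint_add[OF assms(1) Suc] by (simp add: algebra_simps)
  qed
  obtain n where n: "t \<le> real n" using real_arch_simple by blast
  show ?thesis
    by (rule disjoint_mono[OF *[of n] nn(1) order_refl])
       (use scaleR_right_mono[OF n nn(2)] nn assms in \<open>auto intro: scaleR_nonneg_nonneg\<close>)
qed

lemma disjoint_pprt_diff: "inf (pprt (x - y)) (pprt (y - (x::'a::banach_lattice))) = 0"
  using inf_pprt_neg[of "x - y"] by simp

lemma scaleR_sup:
  fixes x y :: "'a::banach_lattice"
  assumes "0 \<le> (t::real)"
  shows "t *\<^sub>R sup x y = sup (t *\<^sub>R x) (t *\<^sub>R y)"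
proof (cases "t = 0")
  case False
  with assms have t: "t > 0" by simp
  show ?thesis
  proof (rule antisym)
    have "x \<le> inverse t *\<^sub>R sup (t *\<^sub>R x) (t *\<^sub>R y)"
      using scaleR_left_mono[of "t *\<^sub>R x" "sup (t *\<^sub>R x) (t *\<^sub>R y)" "inverse t"] t by simp
    moreover have "y \<le> inverse t *\<^sub>R sup (t *\<^sub>R x) (t *\<^sub>R y)"
      using scaleR_left_mono[of "t *\<^sub>R y" "sup (t *\<^sub>R x) (t *\<^sub>R y)" "inverse t"] t by simp
    ultimately have "sup x y \<le> inverse t *\<^sub>R sup (t *\<^sub>R x) (t *\<^sub>R y)" by simp
    from scaleR_left_mono[OF this, of t] t show "t *\<^sub>R sup x y \<le> sup (t *\<^sub>R x) (t *\<^sub>R y)" by simp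
  next
    show "sup (t *\<^sub>R x) (t *\<^sub>R y) \<le> t *\<^sub>R sup x y"
      using assms by (simp add: scaleR_left_mono)
  qed
qed simp

lemma pprt_scaleR: "0 \<le> (t::real) \<Longrightarrow> pprt (t *\<^sub>R x) = t *\<^sub>R pprt (x::'a::banach_lattice)"
  by (simp add: pprt_def scaleR_sup)

text \<open>The positive cone is closed, because \<open>pprt (- x) \<le> \<bar>X k - x\<bar>\<close> whenever \<open>X k \<ge> 0\<close>.\<close>

lemma nonneg_limit:
  fixes X :: "nat \<Rightarrow> 'a::banach_lattice"
  assumes "X \<longlonglongrightarrow> x" "\<And>k. 0 \<le> X k"
  shows "0 \<le> x"
proof -
  have "norm (pprt (- x)) \<le> norm (X k - x)" for k
  proof -
    have "- x \<le> X k - x" using assms(2)[of k] by simp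
    then have "pprt (- x) \<le> pprt (X k - x)" by (rule pprt_mono)
    then have "norm (pprt (- x)) \<le> norm (pprt (X k - x))" by (simp add: norm_mono_lattice)
    also have "\<dots> \<le> norm (X k - x)" by (rule norm_pprt_le)
    finally show ?thesis .
  qed
  moreover have "(\<lambda>k. norm (X k - x)) \<longlonglongrightarrow> 0" using assms(1) by (simp add: LIM_zero tendsto_norm_zero)
  ultimately have "norm (pprt (- x)) \<le> 0" by (meson LIMSEQ_le_const)
  then have "pprt (- x) = 0" by simp
  then show ?thesis using le_zero_iff_zero_pprt[of "- x"] by simp
qed

lemma le_suminf_nonneg:
  fixes X :: "nat \<Rightarrow> 'a::banach_lattice"
  assumes "summable X" "\<And>k. 0 \<le> X k"
  shows "X k \<le> suminf X"
proof -
  \<comment> \<open>The shift by \<open>Suc k\<close> makes every partial sum contain the term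
    \<open>X k\<close>.\<close>
  have "(\<lambda>n. (\<Sum>i<n + Suc k. X i) - X k) \<longlonglongrightarrow> suminf X - X k"
    by (intro tendsto_diff tendsto_const LIMSEQ_ignore_initial_segment summable_LIMSEQ assms)
  moreover have "0 \<le> (\<Sum>i<n + Suc k. X i) - X k" for n
    using sum_mono2[of "{..<n + Suc k}" "{k}" X] assms(2) by simp
  ultimately have "0 \<le> suminf X - X k" by (rule nonneg_limit)
  then show ?thesis by simp
qed

text \<open>If \<open>p\<close> were unbounded, a series \<open>\<Sum> 2\<^sup>-\<^sup>k u k\<close> of unit vectors with \<open>p (u k)\<close> growing fast
  would have infinite \<open>p\<close>-value.\<close>

lemma monotone_homogeneous_bounded:
  fixes p :: "'a::banach_lattice \<Rightarrow> real"
  assumes mono: "\<And>x y. 0 \<le> x \<Longrightarrow> x \<le> y \<Longrightarrow> p x \<le> p y"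
    and hom: "\<And>t x. 0 \<le> t \<Longrightarrow> 0 \<le> x \<Longrightarrow> p (t *\<^sub>R x) = t ^ n * p x"
    and n: "n \<ge> 1"
  shows "\<exists>c\<ge>0. \<forall>x\<ge>0. p x \<le> c * norm x ^ n"
proof (rule ccontr)
  assume neg: "\<not> ?thesis"
  have "\<exists>u\<ge>0. norm u \<le> 1 \<and> p u > c" if c: "c \<ge> 0" for c
  proof -
    from neg c obtain x where x: "x \<ge> 0" "p x > c * norm x ^ n" by (meson not_le)
    have p0: "p 0 = 0" using hom[of 0 0] n by (simp add: power_0_left)
    have "x \<noteq> 0" using x p0 n by (auto simp: power_0_left)
    then have nx: "norm x > 0" by simp
    have "p (inverse (norm x) *\<^sub>R x) = inverse (norm x) ^ n * p x" using x nx by (intro hom) auto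
    moreover have "inverse (norm x) ^ n * p x > inverse (norm x) ^ n * (c * norm x ^ n)"
      using x nx by (intro mult_strict_left_mono) auto
    moreover have "inverse (norm x) ^ n * (c * norm x ^ n) = c"
      using nx by (simp add: field_simps power_inverse)
    ultimately show ?thesis using x nx
      by (intro exI[of _ "inverse (norm x) *\<^sub>R x"]) (auto intro: scaleR_nonneg_nonneg)
  qed
  \<comment> \<open>The factor \<open>(2 ^ k) ^ n\<close> offsets the later scaling of
    \<open>u k\<close> by \<open>(1/2) ^ k\<close> in degree \<open>n\<close>, leaving a value above
    \<open>k\<close>.\<close>
  then have "\<exists>u\<ge>0. norm u \<le> 1 \<and> p u > real k * (2 ^ k) ^ n" for k by simp
  then obtain u where u: "\<And>k. u k \<ge> 0" "\<And>k. norm (u k) \<le> 1" "\<And>k. p (u k) > real k * (2 ^ k) ^ n"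
    by metis
  define v where "v k = (1/2) ^ k *\<^sub>R u k" for k
  have sv: "summable v"
  proof (rule summable_comparison_test)
    show "\<exists>N. \<forall>k\<ge>N. norm (v k) \<le> (1/2) ^ k"
      using u(2) by (auto simp: v_def mult_left_le)
  qed (simp add: summable_geometric)
  have v0: "0 \<le> v k" for k using u by (simp add: v_def scaleR_nonneg_nonneg)
  have "p (suminf v) > real k" for k
  proof -
    have pos: "0 < ((1/2::real) ^ k) ^ n" by simp
    have one: "((1/2) ^ k) ^ n * (2 ^ k) ^ n = (1::real)"
      by (simp flip: power_mult_distrib)
    have "real k = ((1/2) ^ k) ^ n * (real k * (2 ^ k) ^ n)"
      using one by (metis mult.left_commute mult.right_neutral)
    also have "\<dots> < ((1/2) ^ k) ^ n * p (u k)" by (intro mult_strict_left_mono u pos)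
    also have "\<dots> = p (v k)" unfolding v_def using u(1) by (intro hom[symmetric]) auto
    also have "\<dots> \<le> p (suminf v)" by (intro mono v0 le_suminf_nonneg sv)
    finally show ?thesis .
  qed
  moreover obtain k where "real k > p (suminf v)" using reals_Archimedean2 by blast
  ultimately show False by (meson less_asym)
qed

section \<open>Positive functionals\<close>

text \<open>Additivity gives natural multiples and positivity gives monotonicity. Squeezing
  \<open>t * n\<close> between consecutive integers bounds the defect by \<open>f x / n\<close> for
  every \<open>n\<close>, and the Archimedean property removes it.\<close>

lemma cone_additive_homogeneous:
  fixes f :: "'a::banach_lattice \<Rightarrow> real"
  assumes add: "\<And>x y. 0 \<le> x \<Longrightarrow> 0 \<le> y \<Longrightarrow> f (x + y) = f x + f y"
    and pos: "\<And>x. 0 \<le> x \<Longrightarrow> 0 \<le> f x"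
    and x: "0 \<le> x" and t: "0 \<le> t"
  shows "f (t *\<^sub>R x) = t * f x"
proof -
  have f0: "f 0 = 0" using add[of 0 0] by simp
  have mono: "f u \<le> f v" if "0 \<le> u" "u \<le> v" for u v
    using add[of u "v - u"] pos[of "v - u"] that by simp
  have nat: "f (real n *\<^sub>R y) = real n * f y" if "0 \<le> y" for n y
  proof (induction n)
    case (Suc n)
    have "f (real (Suc n) *\<^sub>R y) = f (y + real n *\<^sub>R y)" by (simp add: scaleR_add_left)
    also have "\<dots> = f y + real n * f y"
      using that Suc by (subst add) (auto intro: scaleR_nonneg_nonneg)
    finally show ?case by (simp add: algebra_simps)
  qed (simp add: f0)
  have est: "\<bar>f (t *\<^sub>R x) - t * f x\<bar> * real n \<le> f x" for n
  proof -
    define m where "m = nat \<lfloor>t * real n\<rfloor>"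
    have m: "real m \<le> t * real n" "t * real n \<le> real (Suc m)"
      using t by (simp_all add: m_def) linarith+
    have fn: "f ((t * real n) *\<^sub>R x) = real n * f (t *\<^sub>R x)"
      using nat[of "t *\<^sub>R x" n] t x by (simp add: scaleR_nonneg_nonneg mult.commute)
    have "real m * f x \<le> real n * f (t *\<^sub>R x)"
      using mono[OF _ scaleR_right_mono[OF m(1) x]] nat[OF x, of m] fn x
      by (simp add: scaleR_nonneg_nonneg)
    moreover have "real n * f (t *\<^sub>R x) \<le> real (Suc m) * f x"
      using mono[OF _ scaleR_right_mono[OF m(2) x]] nat[OF x, of "Suc m"] fn x t
      by (simp add: scaleR_nonneg_nonneg)
    moreover have "real m * f x \<le> (t * real n) * f x" "(t * real n) * f x \<le> real (Suc m) * f x"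
      using m pos[OF x] by (auto intro: mult_right_mono)
    ultimately have "\<bar>real n * f (t *\<^sub>R x) - t * real n * f x\<bar> \<le> f x"
      by (auto simp: abs_le_iff algebra_simps)
    moreover have "real n * f (t *\<^sub>R x) - t * real n * f x = (f (t *\<^sub>R x) - t * f x) * real n"
      by (simp add: algebra_simps)
    ultimately show ?thesis by (simp add: abs_mult)
  qed
  have "\<bar>f (t *\<^sub>R x) - t * f x\<bar> = 0"
  proof (rule ccontr)
    assume "\<bar>f (t *\<^sub>R x) - t * f x\<bar> \<noteq> 0"
    then have d: "\<bar>f (t *\<^sub>R x) - t * f x\<bar> > 0" by simp
    from reals_Archimedean3[OF d, rule_format, of "f x"] est show False
      by (metis leD mult.commute)
  qed
  then show ?thesis by simp
qed

lemma positive_linear_mono: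
  fixes f :: "'a::banach_lattice \<Rightarrow> real"
  assumes "linear f" "\<And>x. 0 \<le> x \<Longrightarrow> 0 \<le> f x" "x \<le> y"
  shows "f x \<le> f y"
  using assms(2)[of "y - x"] assms(3) by (simp add: linear_diff[OF assms(1)])

lemma positive_linear_abs_le:
  fixes f :: "'a::banach_lattice \<Rightarrow> real"
  assumes "linear f" "\<And>x. 0 \<le> x \<Longrightarrow> 0 \<le> f x"
  shows "\<bar>f x\<bar> \<le> f (modulus x)"
  using positive_linear_mono[OF assms, of x "modulus x"]
    positive_linear_mono[OF assms, of "- x" "modulus x"]
  by (simp add: linear_neg[OF assms(1)] abs_le_iff)

text \<open>Automatic continuity: degree 1 of \<open>monotone_homogeneous_bounded\<close> bounds
  \<open>f\<close> on the cone, and \<open>f (modulus x)\<close> dominates the absolute value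
  elsewhere.\<close>

lemma positive_linear_bounded:
  fixes f :: "'a::banach_lattice \<Rightarrow> real"
  assumes "linear f" "\<And>x. 0 \<le> x \<Longrightarrow> 0 \<le> f x"
  shows "bounded_linear f"
proof -
  obtain c where c: "\<And>x. 0 \<le> x \<Longrightarrow> f x \<le> c * norm x"
    using monotone_homogeneous_bounded[of f 1] positive_linear_mono[OF assms]
    by (auto simp: linear_scale[OF assms(1)])
  have "norm (f x) \<le> norm x * c" for x
    using positive_linear_abs_le[OF assms, of x] c[of "modulus x"] by (simp add: mult.commute)
  then show ?thesis
    by (intro bounded_linear_intro[of f c]) (auto simp: linear_add[OF assms(1)] linear_scale[OF assms(1)])
qed

text \<open>By additivity \<open>f a - f b\<close> depends only on \<open>a - b\<close>, so any
  convenient representation as a difference may be used for sums and multiples; for negative scalars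
  the two parts change places.\<close>

lemma cone_additive_extension:
  fixes f :: "'a::banach_lattice \<Rightarrow> real"
  assumes add: "\<And>x y. 0 \<le> x \<Longrightarrow> 0 \<le> y \<Longrightarrow> f (x + y) = f x + f y"
    and hom: "\<And>t x. 0 \<le> t \<Longrightarrow> 0 \<le> x \<Longrightarrow> f (t *\<^sub>R x) = t * f x"
  shows "linear (\<lambda>x. f (pprt x) - f (pprt (- x)))"
proof -
  let ?F = "\<lambda>x. f (pprt x) - f (pprt (- x))"
  have split: "?F x = f a - f b" if "x = a - b" "0 \<le> a" "0 \<le> b" for x a b
  proof -
    have "a + pprt (- x) = b + pprt x" using that(1) pprt_diff[of x] by (metis add.commute diff_add_cancel group_cancel.add2)
    then have "f a + f (pprt (- x)) = f b + f (pprt x)" using that by (metis add zero_le_pprt)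
    then show ?thesis by simp
  qed
  show ?thesis
  proof (rule linearI)
    fix x y :: 'a
    have "x + y = (pprt x - pprt (- x)) + (pprt y - pprt (- y))"
      by (simp only: pprt_diff[symmetric])
    then have "x + y = (pprt x + pprt y) - (pprt (- x) + pprt (- y))" by (simp add: algebra_simps)
    from split[OF this] show "?F (x + y) = ?F x + ?F y" by (simp add: add)
  next
    fix t :: real and x :: 'a
    show "?F (t *\<^sub>R x) = t *\<^sub>R ?F x"
    proof (cases "0 \<le> t")
      case True
      have "t *\<^sub>R x = t *\<^sub>R pprt x - t *\<^sub>R pprt (- x)"
        using pprt_diff[of x] by (metis scaleR_diff_right)
      from split[OF this] show ?thesis using True
        by (simp add: hom scaleR_nonneg_nonneg right_diff_distrib)
    next
      case False
      have "t *\<^sub>R x = (- t) *\<^sub>R pprt (- x) - (- t) *\<^sub>R pprt x"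
        using pprt_diff[of x] by (metis add.commute diff_minus_eq_add minus_diff_eq scaleR_diff_right scaleR_minus_left)
      then have "?F (t *\<^sub>R x) = f ((- t) *\<^sub>R pprt (- x)) - f ((- t) *\<^sub>R pprt x)"
        by (rule split) (use False in \<open>auto intro!: scaleR_nonneg_nonneg simp del: scaleR_minus_left\<close>)
      also have "\<dots> = (- t) * f (pprt (- x)) - (- t) * f (pprt x)"
        by (subst (1 2) hom) (use False in auto)
      finally show ?thesis by (simp add: algebra_simps)
    qed
  qed
qed

text \<open>Positivity supplies what additivity alone lacks: homogeneity on the cone and boundedness
  of the extension. Elements of a dual are constructed through this lemma.\<close>

lemma positive_extension:
  fixes f :: "'a::banach_lattice \<Rightarrow> real"
  assumes add: "\<And>x y. 0 \<le> x \<Longrightarrow> 0 \<le> y \<Longrightarrow> f (x + y) = f x + f y"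
    and pos: "\<And>x. 0 \<le> x \<Longrightarrow> 0 \<le> f x"
  obtains \<phi> :: "'a \<Rightarrow>\<^sub>L real" where "\<And>x. 0 \<le> x \<Longrightarrow> blinfun_apply \<phi> x = f x"
proof -
  define F where "F x = f (pprt x) - f (pprt (- x))" for x
  have f0: "f 0 = 0" using add[of 0 0] by simp
  have F: "F x = f x" if "0 \<le> x" for x using that by (simp add: F_def f0)
  have "linear F" unfolding F_def
    by (rule cone_additive_extension) (use add cone_additive_homogeneous[of f] pos in auto)
  then have "bounded_linear F" by (rule positive_linear_bounded) (simp add: F pos)
  then show ?thesis using F that[of "Blinfun F"] by (simp add: bounded_linear_Blinfun_apply)
qed

text \<open>The functional \<open>\<beta> z = inf\<^sub>m \<psi> ((z - m y)\<^sup>+)\<close> is the part of \<open>\<psi>\<close> living off \<open>y\<close>.\<close>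

lemma functional_split:
  fixes \<psi> :: "'a::banach_lattice \<Rightarrow>\<^sub>L real"
  assumes psi: "\<And>x. 0 \<le> x \<Longrightarrow> 0 \<le> blinfun_apply \<psi> x" and disj: "inf y z = 0"
  obtains \<beta> where "\<And>x. 0 \<le> x \<Longrightarrow> 0 \<le> blinfun_apply \<beta> x"
    "\<And>x. 0 \<le> x \<Longrightarrow> blinfun_apply \<beta> x \<le> blinfun_apply \<psi> x"
    "blinfun_apply \<beta> y = 0" "blinfun_apply \<beta> z = blinfun_apply \<psi> z"
proof -
  have y: "0 \<le> y" and z: "0 \<le> z" using disj by (metis inf.cobounded1, metis inf.cobounded2)
  have mono: "blinfun_apply \<psi> a \<le> blinfun_apply \<psi> b" if "a \<le> b" for a b
    using positive_linear_mono[of "blinfun_apply \<psi>" a b] psi that by (simp add: bounded_linear.linear blinfun.bounded_linear_right)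
  define g where "g x m = blinfun_apply \<psi> (pprt (x - real m *\<^sub>R y))" for x m
  have g0: "0 \<le> g x m" for x m by (simp add: g_def psi)
  have dec: "g x m \<le> g x k" if "k \<le> m" for x k m
    using that y by (auto simp: g_def intro!: mono pprt_mono scaleR_right_mono)
  define f where "f x = lim (g x)" for x
  have lim: "g x \<longlonglongrightarrow> f x" for x
  proof -
    have "decseq (g x)" using dec by (auto simp: decseq_def)
    then have "convergent (g x)" using decseq_convergent[of "g x" 0] g0 unfolding convergent_def by metis
    then show ?thesis by (simp add: f_def convergent_LIMSEQ_iff)
  qed
  have add: "f (a + b) = f a + f b" if a: "0 \<le> a" and b: "0 \<le> b" for a b
  proof (rule antisym)
    \<comment> \<open>Along even indices the subtracted multiple of \<open>y\<close> divides equally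
      between \<open>a\<close> and \<open>b\<close>, so that subadditivity of \<open>pprt\<close>
      applies.\<close>
    have "(\<lambda>m. g (a + b) (2 * m)) \<longlonglongrightarrow> f (a + b)"
      using LIMSEQ_subseq_LIMSEQ[OF lim[of "a + b"], of "\<lambda>m. 2 * m"] by (simp add: strict_mono_def o_def)
    moreover have "g (a + b) (2 * m) \<le> g a m + g b m" for m
    proof -
      have "a + b - real (2 * m) *\<^sub>R y = (a - real m *\<^sub>R y) + (b - real m *\<^sub>R y)"
        by (simp add: scaleR_add_left[symmetric] algebra_simps)
      then show ?thesis unfolding g_def
        by (metis (no_types) blinfun.add_right mono pprt_subadd)
    qed
    ultimately show "f (a + b) \<le> f a + f b"
      by (intro LIMSEQ_le[OF _ tendsto_add[OF lim lim]]) auto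
  next
    have "g a m + g b m \<le> g (a + b) m" for m
    proof -
      let ?w = "real m *\<^sub>R y"
      have w: "0 \<le> ?w" using y by (simp add: scaleR_nonneg_nonneg)
      \<comment> \<open>A sum of two suprema is a supremum of four terms; since \<open>a\<close>,
        \<open>b\<close> and \<open>?w\<close> are nonnegative, each term lies below
        \<open>pprt (a + b - ?w)\<close>.\<close>
      have "pprt (a - ?w) + pprt (b - ?w) = 
        sup (sup ((a - ?w) + (b - ?w)) (b - ?w)) (sup (a - ?w) 0)"
        by (simp add: pprt_def add_sup_distrib_left add_sup_distrib_right)
      also have "\<dots> \<le> pprt (a + b - ?w)"
      proof -
        have "(a - ?w) + (b - ?w) \<le> a + b - ?w" using w by (simp add: algebra_simps)
        moreover have "b - ?w \<le> a + b - ?w" "a - ?w \<le> a + b - ?w" using a b by (simp_all add: algebra_simps)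
        ultimately show ?thesis unfolding pprt_def
          by (intro sup.boundedI) (blast intro: le_supI1 sup_ge2)+
      qed
      finally show ?thesis unfolding g_def by (metis blinfun.add_right mono)
    qed
    then show "f a + f b \<le> f (a + b)"
      by (intro LIMSEQ_le[OF tendsto_add[OF lim lim] lim]) auto
  qed
  have f0: "0 \<le> f x" for x by (rule LIMSEQ_le_const[OF lim]) (use g0 in auto)
  obtain \<beta> :: "'a \<Rightarrow>\<^sub>L real" where \<beta>: "\<And>x. 0 \<le> x \<Longrightarrow> blinfun_apply \<beta> x = f x"
    using positive_extension[of f] add f0 by metis
  show ?thesis
  proof (rule that)
    show "0 \<le> blinfun_apply \<beta> x" if "0 \<le> x" for x using \<beta> f0 that by simp
    show "blinfun_apply \<beta> x \<le> blinfun_apply \<psi> x" if "0 \<le> x" for x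
    proof -
      have "g x m \<le> blinfun_apply \<psi> x" for m
        using dec[of 0 m x] that by (simp add: g_def)
      then have "f x \<le> blinfun_apply \<psi> x" by (intro LIMSEQ_le_const2[OF lim]) auto
      then show ?thesis using \<beta> that by simp
    qed
    have "g y m = 0" if "m \<ge> 1" for m
    proof -
      have "y \<le> real m *\<^sub>R y" using scaleR_right_mono[of 1 "real m" y] that y by simp
      then show ?thesis by (simp add: g_def)
    qed
    then have "g y \<longlonglongrightarrow> 0" by (intro tendsto_eventually) (auto simp: eventually_sequentially)
    then show "blinfun_apply \<beta> y = 0" using LIMSEQ_unique lim \<beta> y by metis
    have "g z m = blinfun_apply \<psi> z" for m
    proof -
      have "inf z (real m *\<^sub>R y) = 0"
        by (rule disjoint_scale) (use disj in \<open>auto simp: inf_commute\<close>)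
      then show ?thesis using inf_diff_eq_pprt[of z "real m *\<^sub>R y"] by (simp add: g_def)
    qed
    then have "g z \<longlonglongrightarrow> blinfun_apply \<psi> z" by (intro tendsto_eventually) simp
    then show "blinfun_apply \<beta> z = blinfun_apply \<psi> z" using LIMSEQ_unique lim \<beta> z by metis
  qed
qed

section \<open>Positive orthosymmetric bilinear forms\<close>

lemma quadratic_nonneg_discriminant:
  fixes a b c :: real
  assumes "\<And>t. 0 \<le> a + 2 * t * b + t\<^sup>2 * c" and "0 \<le> c"
  shows "b\<^sup>2 \<le> a * c"
proof (cases "c = 0")
  case True
  have "b = 0"
  proof (rule ccontr)
    assume "b \<noteq> 0"
    \<comment> \<open>With \<open>c = 0\<close> this choice of \<open>t\<close> gives the expression
      the value -1.\<close>
    then show False using assms(1)[of "- (a + 1) / (2 * b)"] True by (simp add: field_simps)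
  qed
  then show ?thesis using True by simp
next
  case False
  then have c: "c > 0" using assms(2) by simp
  \<comment> \<open>\<open>- b / c\<close> is the minimiser of the quadratic in
    \<open>t\<close>.\<close>
  have "0 \<le> (a + 2 * (- b / c) * b + (- b / c)\<^sup>2 * c) * c"
    using assms(1)[of "- b / c"] c by simp
  also have "\<dots> = a * c - b\<^sup>2" using c by (simp add: field_simps power2_eq_square)
  finally show ?thesis by simp
qed

locale orthosymmetric_form =
  fixes B :: "'a::banach_lattice \<Rightarrow> 'a \<Rightarrow> real"
  assumes sym: "B x y = B y x"
    and linear_right: "linear (B x)"
    and pos: "0 \<le> x \<Longrightarrow> 0 \<le> y \<Longrightarrow> 0 \<le> B x y"
    and disjoint: "inf x y = 0 \<Longrightarrow> B x y = 0"
begin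

lemma add_r: "B x (y + z) = B x y + B x z" by (simp add: linear_add[OF linear_right])
lemma diff_r: "B x (y - z) = B x y - B x z" by (simp add: linear_diff[OF linear_right])
lemma scale_r: "B x (t *\<^sub>R y) = t * B x y" by (simp add: linear_scale[OF linear_right])
lemma add_l: "B (x + y) z = B x z + B y z" by (metis add_r sym)
lemma diff_l: "B (x - y) z = B x z - B y z" by (metis diff_r sym)
lemma scale_l: "B (t *\<^sub>R x) z = t * B x z" by (metis scale_r sym)

text \<open>The cross terms between \<open>pprt z\<close> and \<open>pprt (- z)\<close> vanish by
  disjointness, so the square cannot see the sign of the negative part.\<close>

lemma modulus_square: "B (modulus z) (modulus z) = B z z"
proof -
  have 0: "B (pprt z) (pprt (- z)) = 0" "B (pprt (- z)) (pprt z) = 0"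
    using inf_pprt_neg[of z] by (auto intro: disjoint simp: inf_commute)
  have "B (modulus z) (modulus z) = B (pprt z) (pprt z) + B (pprt (- z)) (pprt (- z))"
    by (simp add: modulus_eq_pprt add_l add_r 0)
  also have "\<dots> = B (pprt z - pprt (- z)) (pprt z - pprt (- z))"
    by (simp add: diff_l diff_r 0)
  finally show ?thesis by (simp only: pprt_diff[symmetric])
qed

lemma square_nonneg: "0 \<le> B z z"
  using pos[of "modulus z" "modulus z"] by (simp only: modulus_square modulus_nonneg)

definition q :: "'a \<Rightarrow> real" where "q z = sqrt (B z z)"

lemma q_nonneg: "0 \<le> q z" by (simp add: q_def square_nonneg)

lemma q_square: "(q z)\<^sup>2 = B z z" by (simp add: q_def square_nonneg)

lemma q_modulus: "q (modulus z) = q z" by (simp only: q_def modulus_square)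

lemma square_expand: "B (x + t *\<^sub>R y) (x + t *\<^sub>R y) = B x x + 2 * t * B x y + t\<^sup>2 * B y y"
  by (simp add: add_l add_r scale_l scale_r sym[of y x] power2_eq_square algebra_simps)

lemma cauchy_schwarz: "\<bar>B x y\<bar> \<le> q x * q y"
proof -
  have "(B x y)\<^sup>2 \<le> B x x * B y y"
    by (rule quadratic_nonneg_discriminant) (metis square_expand square_nonneg, rule square_nonneg)
  then have "sqrt ((B x y)\<^sup>2) \<le> sqrt (B x x * B y y)" by (rule real_sqrt_le_mono)
  then show ?thesis by (simp add: q_def real_sqrt_mult)
qed

text \<open>Needed to turn approximation in \<open>q\<close> into approximation in the dual norm,
  for which bidual elements are continuous. On the cone, \<open>B x x\<close> is monotone and
  homogeneous of degree 2.\<close>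

lemma q_bounded: "\<exists>c\<ge>0. \<forall>z. q z \<le> c * norm z"
proof -
  have "\<exists>C\<ge>0. \<forall>x\<ge>0. B x x \<le> C * norm x ^ 2"
  proof (rule monotone_homogeneous_bounded)
    fix x y :: 'a assume xy: "0 \<le> x" "x \<le> y"
    \<comment> \<open>This sum telescopes to \<open>B y y - B x x\<close>.\<close>
    have "0 \<le> B (y - x) y + B x (y - x)" using xy by (intro add_nonneg_nonneg pos) auto
    then show "B x x \<le> B y y" by (simp add: diff_l diff_r)
  qed (auto simp: scale_l scale_r power2_eq_square)
  then obtain C where C: "C \<ge> 0" "\<And>x. 0 \<le> x \<Longrightarrow> B x x \<le> C * norm x ^ 2" by auto
  have "q z \<le> sqrt C * norm z" for z
  proof -
    have "B z z \<le> C * norm z ^ 2"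
      using C(2)[of "modulus z"] by (simp only: modulus_square modulus_nonneg norm_modulus)
    then have "q z \<le> sqrt (C * norm z ^ 2)" unfolding q_def by (rule real_sqrt_le_mono)
    then show ?thesis by (simp add: real_sqrt_mult)
  qed
  then show ?thesis using C(1) by (intro exI[of _ "sqrt C"]) auto
qed

text \<open>A functional bounded with respect to the seminorm \<open>q\<close> is represented, up to \<open>\<delta>\<close>, by an
  element \<open>e\<close> almost minimising \<open>B e e - 2 \<beta> e\<close>. Passing from \<open>e\<close> to its modulus does not increase
  this quantity when \<open>\<beta>\<close> is positive.\<close>

lemma approximate_representation:
  assumes lin: "linear \<beta>" and bnd: "\<And>z. \<bar>\<beta> z\<bar> \<le> K * q z" and K: "0 \<le> K" and \<delta>: "0 < \<delta>"
  obtains e where "\<And>z. \<bar>\<beta> z - B e z\<bar> \<le> \<delta> * q z" "q e \<le> 2 * K"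
    "(\<And>z. 0 \<le> z \<Longrightarrow> 0 \<le> \<beta> z) \<Longrightarrow> 0 \<le> e"
proof -
  define J where "J e = B e e - 2 * \<beta> e" for e
  have lower: "- (K\<^sup>2) \<le> J e" for e
  proof -
    \<comment> \<open>Completing the square, with \<open>\<beta> e \<le> K * q e\<close>, bounds
      \<open>J\<close> from below.\<close>
    have "0 \<le> (q e - K)\<^sup>2" by simp
    then have "- (K\<^sup>2) \<le> (q e)\<^sup>2 - 2 * (K * q e)" by (simp add: power2_diff algebra_simps)
    also have "\<dots> \<le> J e" unfolding J_def using bnd[of e] by (simp add: q_square)
    finally show ?thesis .
  qed
  have bdd: "bdd_below (range J)" using lower by (intro bdd_belowI[of _ "- (K\<^sup>2)"]) auto
  define I where "I = Inf (range J)"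
  have I: "I \<le> J e" for e unfolding I_def by (rule cInf_lower) (use bdd in auto)
  obtain e0 where e0: "J e0 < I + \<delta>\<^sup>2"
  proof -
    have "Inf (range J) < I + \<delta>\<^sup>2" using \<delta> by (simp add: I_def)
    then show ?thesis using that cInf_lessD[of "range J" "I + \<delta>\<^sup>2"] by auto
  qed
  have J0: "J 0 = 0" using scale_l[of 0 0 0] by (simp add: J_def linear_0[OF lin])
  \<comment> \<open>Falling back on 0 when \<open>J e0 > 0\<close> keeps \<open>J\<close> almost
    minimal and secures \<open>J e1 \<le> 0\<close>, from which the bound
    \<open>q e \<le> 2 * K\<close> is read off.\<close>
  define e1 where "e1 = (if J e0 \<le> 0 then e0 else 0)"
  have e1: "J e1 \<le> 0" "J e1 < I + \<delta>\<^sup>2" using e0 J0 by (auto simp: e1_def)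
  define e where "e = (if (\<forall>z\<ge>0. 0 \<le> \<beta> z) then modulus e1 else e1)"
  have "J e \<le> J e1"
  proof (cases "\<forall>z\<ge>0. 0 \<le> \<beta> z")
    case True
    then have "\<beta> e1 \<le> \<beta> (modulus e1)" using positive_linear_mono[OF lin, of e1 "modulus e1"] by simp
    then show ?thesis using True by (simp add: J_def e_def modulus_square)
  next
    case False
    then show ?thesis by (auto simp: e_def)
  qed
  with e1 have e: "J e \<le> 0" "J e \<le> I + \<delta>\<^sup>2" by auto
  show ?thesis
  proof (rule that)
    fix z
    \<comment> \<open>Moving from \<open>e\<close> in the direction \<open>z\<close> cannot lower
      \<open>J\<close> by more than \<open>\<delta>\<^sup>2\<close>; the resulting quadratic in
      \<open>t\<close> is nonnegative and its discriminant is the claim.\<close>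
    have "(B e z - \<beta> z)\<^sup>2 \<le> \<delta>\<^sup>2 * B z z"
    proof (rule quadratic_nonneg_discriminant)
      fix t :: real
      have "J (e + t *\<^sub>R z) = J e + 2 * t * (B e z - \<beta> z) + t\<^sup>2 * B z z"
        by (simp add: J_def square_expand linear_add[OF lin] linear_scale[OF lin] algebra_simps)
      then show "0 \<le> \<delta>\<^sup>2 + 2 * t * (B e z - \<beta> z) + t\<^sup>2 * B z z"
        using I[of "e + t *\<^sub>R z"] e by linarith
    qed (rule square_nonneg)
    then have "sqrt ((B e z - \<beta> z)\<^sup>2) \<le> sqrt (\<delta>\<^sup>2 * B z z)" by (rule real_sqrt_le_mono)
    then show "\<bar>\<beta> z - B e z\<bar> \<le> \<delta> * q z" using \<delta> by (simp add: q_def real_sqrt_mult abs_minus_commute)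
  next
    have "(q e)\<^sup>2 \<le> 2 * \<beta> e" using e(1) by (simp add: J_def q_square)
    also have "\<dots> \<le> 2 * K * q e" using bnd[of e] by simp
    finally have "q e * q e \<le> 2 * K * q e" by (simp add: power2_eq_square)
    then show "q e \<le> 2 * K" using q_nonneg[of e] K
      by (cases "q e = 0") (auto simp: mult_le_cancel_right)
  next
    assume "\<And>z. 0 \<le> z \<Longrightarrow> 0 \<le> \<beta> z"
    then show "0 \<le> e" by (simp add: e_def)
  qed
qed

section \<open>Bounded functionals on the dual and the Arens extension of the form\<close>

definition A :: "'a \<Rightarrow> ('a \<Rightarrow>\<^sub>L real)" where "A x = Blinfun (B x)"

lemma bounded_linear_B: "bounded_linear (B x)"
proof -
  obtain c where c: "c \<ge> 0" "\<And>z. q z \<le> c * norm z" using q_bounded by auto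
  have "norm (B x z) \<le> norm z * (q x * c)" for z
    using cauchy_schwarz[of x z] mult_left_mono[OF c(2)[of z] q_nonneg[of x]] by (simp add: mult.assoc mult.commute mult.left_commute)
  then show ?thesis by (intro bounded_linear_intro[of _ "q x * c"]) (simp_all add: add_r scale_r)
qed

lemma A_apply [simp]: "blinfun_apply (A x) z = B x z"
  by (simp add: A_def bounded_linear_Blinfun_apply bounded_linear_B)

lemma A_add: "A (x + y) = A x + A y"
  by (rule blinfun_eqI) (simp add: blinfun.add_left add_l)

lemma A_scale: "A (t *\<^sub>R x) = t *\<^sub>R A x"
  by (rule blinfun_eqI) (simp add: blinfun.scaleR_left scale_l)

lemma norm_le_q:
  assumes "\<And>z. q z \<le> c * norm z" "\<And>z. \<bar>blinfun_apply \<phi> z\<bar> \<le> d * q z" "0 \<le> c" "0 \<le> d"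
  shows "norm \<phi> \<le> d * c"
proof (rule norm_blinfun_bound)
  fix z
  have "\<bar>blinfun_apply \<phi> z\<bar> \<le> d * (c * norm z)"
    using assms(2)[of z] mult_left_mono[OF assms(1)[of z] assms(4)] by linarith
  then show "norm (blinfun_apply \<phi> z) \<le> d * c * norm z" by simp
qed (use assms in simp)

text \<open>For \<open>u\<close>, \<open>v\<close> in the bidual, \<open>v (ext u)\<close> is the value at \<open>(u, v)\<close> of one of the two Arens extensions of \<open>B\<close>.\<close>

definition ext :: "(('a \<Rightarrow>\<^sub>L real) \<Rightarrow> real) \<Rightarrow> ('a \<Rightarrow>\<^sub>L real)" where
  "ext u = Blinfun (\<lambda>x. u (A x))"

context
  fixes u :: "('a \<Rightarrow>\<^sub>L real) \<Rightarrow> real" assumes u: "bounded_linear u"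
begin

interpretation u: bounded_linear u by (rule u)

text \<open>By Cauchy-Schwarz the dual norm of \<open>A x\<close> is at most \<open>c * q x\<close>.
  So an arbitrary bounded \<open>u\<close> on the dual induces a \<open>q\<close>-bounded
  functional, to which \<open>approximate_representation\<close> applies.\<close>

lemma ext_bound:
  assumes "\<And>z. q z \<le> c * norm z" "0 \<le> c"
  shows "\<bar>u (A x)\<bar> \<le> onorm u * c * q x"
proof -
  have "norm (A x) \<le> q x * c"
    by (rule norm_le_q[OF assms(1)]) (use assms cauchy_schwarz q_nonneg in auto)
  then have "norm (u (A x)) \<le> onorm u * (q x * c)"
    using onorm[OF u, of "A x"] mult_left_mono[OF _ onorm_pos_le[OF u]] by (meson order_trans)
  then show ?thesis by (simp add: mult.commute mult.left_commute)
qed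

lemma linear_ext: "linear (\<lambda>x. u (A x))"
  by (rule linearI) (simp_all add: A_add A_scale u.add u.scaleR)

lemma ext_apply: "blinfun_apply (ext u) x = u (A x)"
proof -
  obtain c where c: "c \<ge> 0" "\<And>z. q z \<le> c * norm z" using q_bounded by auto
  have "norm (u (A x)) \<le> norm x * (onorm u * c * c)" for x
    using ext_bound[OF c(2,1), of x] mult_left_mono[OF c(2)[of x], of "onorm u * c"] onorm_pos_le[OF u] c(1)
    by (simp add: mult.assoc mult.commute mult.left_commute)
  then have "bounded_linear (\<lambda>x. u (A x))"
    using linear_ext by (intro bounded_linear_intro[of _ "onorm u * c * c"])
      (auto simp: linear_add[OF linear_ext] linear_scale[OF linear_ext])
  then show ?thesis by (simp add: ext_def bounded_linear_Blinfun_apply)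
qed

end

text \<open>With \<open>ext u\<close> close to \<open>A e\<close> and \<open>ext v\<close> close to
  \<open>A f\<close>, both sides are close to \<open>B e f = B f e\<close>: on the left
  \<open>v (ext u)\<close> is near \<open>v (A e)\<close>, which is near \<open>B f e\<close>, and
  the right side is treated alike.\<close>

lemma ext_symmetric:
  assumes u: "bounded_linear u" and v: "bounded_linear v"
  shows "v (ext u) = u (ext v)"
proof -
  interpret u: bounded_linear u by (rule u)
  interpret v: bounded_linear v by (rule v)
  obtain c where c: "c \<ge> 0" "\<And>z. q z \<le> c * norm z" using q_bounded by auto
  define U V where "U = onorm u * c" and "V = onorm v * c"
  have UV: "0 \<le> U" "0 \<le> V" using c(1) onorm_pos_le[OF u] onorm_pos_le[OF v] by (auto simp: U_def V_def)
  have main: "\<bar>v (ext u) - u (ext v)\<bar> \<le> 4 * (U + V) * \<delta>" if \<delta>: "\<delta> > 0" for \<delta>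
  proof -
    obtain e where e: "\<And>z. \<bar>u (A z) - B e z\<bar> \<le> \<delta> * q z" "q e \<le> 2 * U"
      using approximate_representation[OF linear_ext[OF u] ext_bound[OF u c(2,1)] UV(1)[unfolded U_def] \<delta>]
      by (metis U_def)
    obtain f where f: "\<And>z. \<bar>v (A z) - B f z\<bar> \<le> \<delta> * q z" "q f \<le> 2 * V"
      using approximate_representation[OF linear_ext[OF v] ext_bound[OF v c(2,1)] UV(2)[unfolded V_def] \<delta>]
      by (metis V_def)
    have est: "\<bar>w \<phi> - w (A g)\<bar> \<le> onorm w * c * \<delta>"
      if w: "bounded_linear w" and g: "\<And>z. \<bar>blinfun_apply \<phi> z - B g z\<bar> \<le> \<delta> * q z" for w \<phi> g
    proof -
      have "norm (\<phi> - A g) \<le> \<delta> * c"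
        by (rule norm_le_q[OF c(2)]) (use c \<delta> g in \<open>auto simp: blinfun.diff_left\<close>)
      then have "norm (w (\<phi> - A g)) \<le> onorm w * (\<delta> * c)"
        using onorm[OF w, of "\<phi> - A g"] mult_left_mono[OF _ onorm_pos_le[OF w]] by (meson order_trans)
      then show ?thesis by (simp add: linear_diff[OF bounded_linear.linear[OF w]] mult.commute mult.left_commute)
    qed
    have "\<bar>v (ext u) - v (A e)\<bar> \<le> V * \<delta>" unfolding V_def
      by (rule est[OF v]) (simp add: ext_apply[OF u] e)
    moreover have "\<bar>u (ext v) - u (A f)\<bar> \<le> U * \<delta>" unfolding U_def
      by (rule est[OF u]) (simp add: ext_apply[OF v] f)
    moreover have "\<delta> * q e \<le> 2 * U * \<delta>" "\<delta> * q f \<le> 2 * V * \<delta>"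
      using e(2) f(2) \<delta> by (simp_all add: mult.commute[of _ \<delta>])
    moreover note f(1)[of e] e(1)[of f]
    moreover have "B e f = B f e" by (rule sym)
    \<comment> \<open>The two replacements cost \<open>(U + V) * \<delta>\<close>; the evaluations
      at \<open>e\<close> and \<open>f\<close> cost \<open>2 * (U + V) * \<delta>\<close>.\<close>
    ultimately have "\<bar>v (ext u) - u (ext v)\<bar> \<le> 3 * U * \<delta> + 3 * V * \<delta>" by linarith
    also have "\<dots> \<le> 4 * (U + V) * \<delta>" using UV \<delta> by (simp add: algebra_simps)
    finally show ?thesis .
  qed
  show ?thesis
  proof (rule ccontr)
    assume "v (ext u) \<noteq> u (ext v)"
    then have d: "0 < \<bar>v (ext u) - u (ext v)\<bar>" (is "0 < ?d") by simp
    \<comment> \<open>The summand 1 keeps the denominator positive when \<open>U = V = 0\<close>;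
      the halving makes the estimate contradict itself.\<close>
    define \<delta> where "\<delta> = ?d / (4 * (U + V) + 1) / 2"
    have \<delta>: "\<delta> > 0" using d UV by (simp add: \<delta>_def)
    have "?d \<le> 4 * (U + V) * \<delta>" by (rule main[OF \<delta>])
    also have "\<dots> \<le> (4 * (U + V) + 1) * \<delta>" using \<delta> by (simp add: algebra_simps)
    also have "\<dots> = ?d / 2" using UV by (simp add: \<delta>_def field_simps)
    finally show False using d by simp
  qed
qed

text \<open>The part \<open>\<beta>\<close> of \<open>ext u\<close> killed by \<open>u\<close> is close to some \<open>A e\<close> with \<open>e \<ge> 0\<close>, and then
  \<open>0 = u \<beta> \<approx> ext u e \<ge> \<beta> e \<approx> q e\<^sup>2\<close>, so that \<open>\<beta> = 0\<close>.\<close>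

lemma ext_disjoint:
  assumes u: "bounded_linear u" and upos: "\<And>\<phi>. (\<And>x. 0 \<le> x \<Longrightarrow> 0 \<le> blinfun_apply \<phi> x) \<Longrightarrow> 0 \<le> u \<phi>"
    and split: "\<And>\<psi>. (\<And>x. 0 \<le> x \<Longrightarrow> 0 \<le> blinfun_apply \<psi> x) \<Longrightarrow>
      \<exists>\<beta>. (\<forall>x\<ge>0. 0 \<le> blinfun_apply \<beta> x \<and> blinfun_apply \<beta> x \<le> blinfun_apply \<psi> x) \<and> u \<beta> = 0 \<and> v \<beta> = v \<psi>"
    and v0: "v 0 = 0"
  shows "v (ext u) = 0"
proof -
  interpret u: bounded_linear u by (rule u)
  obtain c where c: "c \<ge> 0" "\<And>z. q z \<le> c * norm z" using q_bounded by auto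
  define U where "U = onorm u * c"
  have U: "0 \<le> U" using c(1) onorm_pos_le[OF u] by (auto simp: U_def)
  have "0 \<le> blinfun_apply (ext u) x" if "0 \<le> x" for x
    using that by (auto simp: ext_apply[OF u] pos intro: upos)
  then obtain \<beta> where \<beta>: "\<And>x. 0 \<le> x \<Longrightarrow> 0 \<le> blinfun_apply \<beta> x"
      "\<And>x. 0 \<le> x \<Longrightarrow> blinfun_apply \<beta> x \<le> u (A x)" "u \<beta> = 0" "v \<beta> = v (ext u)"
    using split[of "ext u"] by (auto simp: ext_apply[OF u])
  have lin: "linear (blinfun_apply \<beta>)"
    by (simp add: blinfun.bounded_linear_right bounded_linear.linear)
  \<comment> \<open>Being dominated by \<open>ext u\<close>, the positive functional
    \<open>\<beta>\<close> inherits its \<open>q\<close>-bound.\<close>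
  have bnd: "\<bar>blinfun_apply \<beta> z\<bar> \<le> U * q z" for z
    using positive_linear_abs_le[OF lin \<beta>(1), of z] \<beta>(2)[of "modulus z"]
      ext_bound[OF u c(2,1), of "modulus z"] by (simp add: U_def q_modulus)
  have est: "\<bar>blinfun_apply \<beta> z\<bar> \<le> (\<delta> + sqrt (3 * U * \<delta>)) * q z" if \<delta>: "\<delta> > 0" for \<delta> z
  proof -
    obtain e where e: "\<And>z. \<bar>blinfun_apply \<beta> z - B e z\<bar> \<le> \<delta> * q z" "q e \<le> 2 * U" "0 \<le> e"
      using approximate_representation[OF lin bnd U \<delta>] \<beta>(1) by metis
    have "norm (\<beta> - A e) \<le> \<delta> * c"
      by (rule norm_le_q[OF c(2)]) (use c \<delta> e in \<open>auto simp: blinfun.diff_left\<close>)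
    then have "norm (u (\<beta> - A e)) \<le> onorm u * (\<delta> * c)"
      using onorm[OF u, of "\<beta> - A e"] mult_left_mono[OF _ onorm_pos_le[OF u]] by (meson order_trans)
    then have "u (A e) \<le> U * \<delta>" by (simp add: u.diff \<beta>(3) U_def mult.commute mult.left_commute)
    moreover have "blinfun_apply \<beta> e \<le> u (A e)" by (rule \<beta>(2)[OF e(3)])
    moreover have "(q e)\<^sup>2 \<le> blinfun_apply \<beta> e + \<delta> * q e" using e(1)[of e] by (simp add: q_square)
    moreover have "\<delta> * q e \<le> 2 * U * \<delta>" using mult_left_mono[OF e(2), of \<delta>] \<delta> by (simp add: mult.commute)
    \<comment> \<open>One \<open>U * \<delta>\<close> is the distance of \<open>u (A e)\<close> from
      \<open>u \<beta> = 0\<close>; the other two come from comparing \<open>B e e\<close> with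
      \<open>\<beta> e\<close>.\<close>
    ultimately have "(q e)\<^sup>2 \<le> 3 * U * \<delta>" by linarith
    then have "q e \<le> sqrt (3 * U * \<delta>)" using real_le_rsqrt by blast
    then have "q e * q z \<le> sqrt (3 * U * \<delta>) * q z" by (intro mult_right_mono q_nonneg)
    moreover have "\<bar>blinfun_apply \<beta> z\<bar> \<le> \<delta> * q z + q e * q z"
      using e(1)[of z] cauchy_schwarz[of e z] by linarith
    ultimately show ?thesis by (simp add: algebra_simps)
  qed
  have "blinfun_apply \<beta> z = 0" for z
  proof -
    have "(\<lambda>n. (inverse (real (Suc n)) + sqrt (3 * U * inverse (real (Suc n)))) * q z) \<longlonglongrightarrow> (0 + sqrt (3 * U * 0)) * q z"
      by (intro tendsto_intros LIMSEQ_inverse_real_of_nat)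
    moreover have "\<bar>blinfun_apply \<beta> z\<bar> \<le> (inverse (real (Suc n)) + sqrt (3 * U * inverse (real (Suc n)))) * q z" for n
      by (rule est) simp
    ultimately have "\<bar>blinfun_apply \<beta> z\<bar> \<le> (0 + sqrt (3 * U * 0)) * q z"
      by (intro LIMSEQ_le_const) auto
    then show ?thesis by simp
  qed
  then have "\<beta> = 0" by (intro blinfun_eqI) simp
  then show ?thesis using \<beta>(4) v0 by simp
qed

end

section \<open>Symmetric multilinear forms\<close>

text \<open>Adjacent swaps generate all permutations: the head of one list is moved to the front of
  the other, and the induction continues with that head built into \<open>f\<close>, which is why
  \<open>f\<close> stays arbitrary.\<close>

lemma swap_invariant_mset:
  assumes swap: "\<And>as a b bs. f (as @ a # b # bs) = f (as @ b # a # bs)"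
  shows "mset xs = mset ys \<Longrightarrow> f xs = f ys"
  using swap
proof (induction xs arbitrary: ys f)
  case (Cons x xs)
  have move: "f (as @ x # bs) = f (x # as @ bs)" for as bs
  proof (induction as arbitrary: bs rule: rev_induct)
    case (snoc a as)
    from snoc.IH[of "a # bs"] show ?case using Cons.prems(2)[of as a x bs] by simp
  qed simp
  obtain as bs where ys: "ys = as @ x # bs"
    using Cons.prems(1) by (metis list.set_intros(1) mset_eq_setD split_list)
  have "f (x # xs) = f (x # as @ bs)"
  proof (rule Cons.IH[where f = "\<lambda>zs. f (x # zs)"])
    show "mset xs = mset (as @ bs)" using Cons.prems(1) by (simp add: ys)
    show "f (x # as' @ a # b # bs') = f (x # as' @ b # a # bs')" for as' a b bs'
      using Cons.prems(2)[of "x # as'"] by simp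
  qed
  then show ?case by (simp add: ys move)
qed simp

text \<open>Forms are normalised to vanish on lists of the wrong length, so that equality of forms is
  equality of functions.\<close>

definition sym_form :: "nat \<Rightarrow> ('a::real_vector list \<Rightarrow> real) \<Rightarrow> bool" where
  "sym_form n M \<longleftrightarrow> (\<forall>xs. length xs \<noteq> n \<longrightarrow> M xs = 0)
     \<and> (\<forall>xs ys. mset xs = mset ys \<longrightarrow> M xs = M ys) \<and> (\<forall>xs. linear (\<lambda>x. M (x # xs)))"

text \<open>Symmetry carries the vanishing condition to any two positions, and
  \<open>orth_cone_vanish\<close> later frees it from the sign conditions.\<close>

definition orth_cone :: "nat \<Rightarrow> ('a::banach_lattice list \<Rightarrow> real) set" where
  "orth_cone n = {M. sym_form n M \<and> (\<forall>xs. nonneg_list xs \<longrightarrow> 0 \<le> M xs)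
     \<and> (\<forall>x y xs. inf x y = 0 \<and> nonneg_list xs \<longrightarrow> M (x # y # xs) = 0)}"

text \<open>Fixing an argument of arbitrary sign, or exchanging at a point of arbitrary sign, leads
  out of the cone but not out of its linear span.\<close>

definition orth_span :: "nat \<Rightarrow> ('a::banach_lattice list \<Rightarrow> real) set" where
  "orth_span n = {M. \<exists>M1\<in>orth_cone n. \<exists>M2\<in>orth_cone n. M = (\<lambda>xs. M1 xs - M2 xs)}"

lemma sym_formI:
  assumes "\<And>xs. length xs \<noteq> n \<Longrightarrow> M xs = 0" "\<And>xs ys. mset xs = mset ys \<Longrightarrow> M xs = M ys"
    "\<And>xs. linear (\<lambda>x. M (x # xs))"
  shows "sym_form n M"
  using assms unfolding sym_form_def by blast

lemma sym_formD:
  assumes "sym_form n M"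
  shows "length xs \<noteq> n \<Longrightarrow> M xs = 0" "mset xs = mset ys \<Longrightarrow> M xs = M ys" "linear (\<lambda>x. M (x # xs))"
  using assms unfolding sym_form_def by blast+

lemma sym_form_swap: "sym_form n M \<Longrightarrow> M (x # y # xs) = M (y # x # xs)"
  by (rule sym_formD) auto

lemma sym_form_comb:
  assumes "sym_form n M" "sym_form n N"
  shows "sym_form n (\<lambda>xs. a * M xs + b * N xs)"
proof -
  have "linear (\<lambda>x. a * M (x # xs) + b * N (x # xs))" for xs
    using linear_compose_add[OF linear_compose_scale_right[OF sym_formD(3)[OF assms(1), of xs], of a]
      linear_compose_scale_right[OF sym_formD(3)[OF assms(2), of xs], of b]] by simp
  moreover have "a * M xs + b * N xs = a * M ys + b * N ys" if "mset xs = mset ys" for xs ys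
    using sym_formD(2)[OF assms(1) that] sym_formD(2)[OF assms(2) that] by simp
  moreover have "a * M xs + b * N xs = 0" if "length xs \<noteq> n" for xs
    using sym_formD(1)[OF assms(1) that] sym_formD(1)[OF assms(2) that] by simp
  ultimately show ?thesis by (intro sym_formI)
qed

text \<open>Truncated subtraction is harmless: a form of degree 0 vanishes on nonempty lists, so
  plugging into it gives the zero form, again of degree 0.\<close>

lemma sym_form_plug:
  assumes "sym_form n M"
  shows "sym_form (n - 1) (\<lambda>xs. M (x # xs))"
proof -
  have "linear (\<lambda>z. M (x # z # xs))" for xs
    using sym_formD(3)[OF assms, of "x # xs"] by (simp add: sym_form_swap[OF assms, of x])
  moreover have "M (x # xs) = 0" if "length xs \<noteq> n - 1" for xs
    using that by (intro sym_formD(1)[OF assms]) auto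
  moreover have "M (x # xs) = M (x # ys)" if "mset xs = mset ys" for xs ys
    using that by (intro sym_formD(2)[OF assms]) auto
  ultimately show ?thesis by (intro sym_formI)
qed

lemma orth_coneI:
  assumes "sym_form n M" "\<And>xs. nonneg_list xs \<Longrightarrow> 0 \<le> M xs"
    "\<And>x y xs. inf x y = 0 \<Longrightarrow> nonneg_list xs \<Longrightarrow> M (x # y # xs) = 0"
  shows "M \<in> orth_cone n"
  using assms unfolding orth_cone_def by blast

lemma orth_coneD:
  assumes "M \<in> orth_cone n"
  shows "sym_form n M" "nonneg_list xs \<Longrightarrow> 0 \<le> M xs"
    "inf x y = 0 \<Longrightarrow> nonneg_list xs \<Longrightarrow> M (x # y # xs) = 0"
  using assms unfolding orth_cone_def by blast+

lemma orth_cone_comb: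
  assumes "M \<in> orth_cone n" "N \<in> orth_cone n" "0 \<le> a" "0 \<le> b"
  shows "(\<lambda>xs. a * M xs + b * N xs) \<in> orth_cone n"
  using assms by (intro orth_coneI sym_form_comb) (auto simp: orth_coneD)

lemma zero_orth_cone: "(\<lambda>xs. 0) \<in> orth_cone n"
  by (intro orth_coneI sym_formI) (auto simp: linear_iff)

lemma orth_cone_plug:
  assumes M: "M \<in> orth_cone n" and x: "0 \<le> x"
  shows "(\<lambda>xs. M (x # xs)) \<in> orth_cone (n - 1)"
proof -
  have "M (x # y # z # xs) = 0" if "inf y z = 0" "nonneg_list xs" for y z xs
  proof -
    have "M (x # y # z # xs) = M (y # z # x # xs)"
      by (rule sym_formD(2)[OF orth_coneD(1)[OF M]]) simp
    then show ?thesis using orth_coneD(3)[OF M, of y z "x # xs"] that x by simp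
  qed
  moreover have "0 \<le> M (x # xs)" if "nonneg_list xs" for xs
    using orth_coneD(2)[OF M, of "x # xs"] x that by simp
  ultimately show ?thesis by (intro orth_coneI sym_form_plug[OF orth_coneD(1)[OF M]])
qed

lemma orth_spanI: "M1 \<in> orth_cone n \<Longrightarrow> M2 \<in> orth_cone n \<Longrightarrow> (\<lambda>xs. M1 xs - M2 xs) \<in> orth_span n"
  by (auto simp: orth_span_def)

lemma orth_spanE:
  assumes "M \<in> orth_span n"
  obtains M1 M2 where "M1 \<in> orth_cone n" "M2 \<in> orth_cone n" "M = (\<lambda>xs. M1 xs - M2 xs)"
  using assms by (auto simp: orth_span_def)

lemma orth_cone_span: "M \<in> orth_cone n \<Longrightarrow> M \<in> orth_span n"
  using orth_spanI[OF _ zero_orth_cone] by simp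

lemma orth_span_sym_form: "M \<in> orth_span n \<Longrightarrow> sym_form n M"
  using sym_form_comb[of n _ _ 1 "- 1"] by (auto elim!: orth_spanE dest!: orth_coneD(1))

lemma orth_span_add:
  assumes "M \<in> orth_span n" "N \<in> orth_span n"
  shows "(\<lambda>xs. M xs + N xs) \<in> orth_span n"
proof -
  obtain M1 M2 where M: "M1 \<in> orth_cone n" "M2 \<in> orth_cone n" "M = (\<lambda>xs. M1 xs - M2 xs)"
    using assms(1) by (rule orth_spanE)
  obtain N1 N2 where N: "N1 \<in> orth_cone n" "N2 \<in> orth_cone n" "N = (\<lambda>xs. N1 xs - N2 xs)"
    using assms(2) by (rule orth_spanE)
  have "(\<lambda>xs. (M1 xs + N1 xs) - (M2 xs + N2 xs)) \<in> orth_span n"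
    using orth_cone_comb[OF M(1) N(1), of 1 1] orth_cone_comb[OF M(2) N(2), of 1 1]
    by (intro orth_spanI) auto
  then show ?thesis by (simp add: M N algebra_simps)
qed

lemma orth_span_scale:
  assumes "M \<in> orth_span n"
  shows "(\<lambda>xs. a * M xs) \<in> orth_span n"
proof -
  obtain M1 M2 where M: "M1 \<in> orth_cone n" "M2 \<in> orth_cone n" "M = (\<lambda>xs. M1 xs - M2 xs)"
    using assms(1) by (rule orth_spanE)
  have scale: "(\<lambda>xs. b * N xs) \<in> orth_cone n" if "0 \<le> b" "N \<in> orth_cone n" for b N
    using orth_cone_comb[OF that(2,2), of b 0] that by simp
  show ?thesis
  proof (cases "0 \<le> a")
    case True
    then show ?thesis using orth_spanI[OF scale[OF _ M(1)] scale[OF _ M(2)], of a a]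
      by (simp add: M algebra_simps)
  next
    case False
    then show ?thesis using orth_spanI[OF scale[OF _ M(2)] scale[OF _ M(1)], of "- a" "- a"]
      by (simp add: M algebra_simps)
  qed
qed

lemma orth_span_comb:
  assumes "M \<in> orth_span n" "N \<in> orth_span n"
  shows "(\<lambda>xs. a * M xs + b * N xs) \<in> orth_span n"
  by (intro orth_span_add orth_span_scale assms)

lemma orth_span_plug:
  assumes "M \<in> orth_span n"
  shows "(\<lambda>xs. M (x # xs)) \<in> orth_span (n - 1)"
proof -
  obtain M1 M2 where M: "M1 \<in> orth_cone n" "M2 \<in> orth_cone n" "M = (\<lambda>xs. M1 xs - M2 xs)"
    using assms(1) by (rule orth_spanE)
  have *: "M (x # xs) = M (pprt x # xs) - M (pprt (- x) # xs)" for xs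
    using linear_diff[OF sym_formD(3)[OF orth_span_sym_form[OF assms], of xs], of "pprt x" "pprt (- x)"]
    by (simp only: pprt_diff[symmetric])
  have "(\<lambda>xs. M (z # xs)) \<in> orth_span (n - 1)" if "0 \<le> z" for z
    unfolding M(3) by (intro orth_spanI orth_cone_plug M that)
  from orth_span_comb[OF this this, of "pprt x" "pprt (- x)" 1 "- 1"] show ?thesis
    by (simp add: *)
qed

lemma orth_span_plugs:
  assumes "M \<in> orth_span n"
  shows "(\<lambda>zs. M (xs @ zs)) \<in> orth_span (n - length xs)"
  using assms
proof (induction xs arbitrary: M n)
  case (Cons x xs)
  from Cons.IH[OF orth_span_plug[OF Cons.prems, of x]] show ?case by simp
qed simp

text \<open>With all arguments but one plugged in, a difference of two positive functionals remains,
  and these are automatically continuous. This is what makes \<open>head_fun\<close> an honest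
  element of the dual.\<close>

lemma orth_span_bounded:
  assumes "M \<in> orth_span n"
  shows "bounded_linear (\<lambda>x. M (x # xs))"
proof -
  obtain M1 M2 where M: "M1 \<in> orth_cone (n - length xs)" "M2 \<in> orth_cone (n - length xs)"
    "(\<lambda>zs. M (xs @ zs)) = (\<lambda>zs. M1 zs - M2 zs)"
    using orth_span_plugs[OF assms, of xs] by (rule orth_spanE)
  have bl: "bounded_linear (\<lambda>x. N [x])" if "N \<in> orth_cone k" for N :: "'a list \<Rightarrow> real" and k
    by (rule positive_linear_bounded) (use orth_coneD[OF that] sym_formD(3)[of k N "[]"] in auto)
  have "M (x # xs) = M1 [x] - M2 [x]" for x
  proof -
    have "M (x # xs) = M (xs @ [x])" by (rule sym_formD(2)[OF orth_span_sym_form[OF assms]]) simp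
    then show ?thesis using fun_cong[OF M(3), of "[x]"] by simp
  qed
  then show ?thesis using bounded_linear_sub[OF bl[OF M(1)] bl[OF M(2)]] by simp
qed

section \<open>Transfer of forms along an isomorphism of the duals\<close>

definition head_fun :: "('a::real_normed_vector list \<Rightarrow> real) \<Rightarrow> 'a list \<Rightarrow> ('a \<Rightarrow>\<^sub>L real)" where
  "head_fun M xs = Blinfun (\<lambda>x. M (x # xs))"

lemma head_fun_apply:
  "M \<in> orth_span n \<Longrightarrow> blinfun_apply (head_fun M xs) x = M (x # xs)"
  by (simp add: head_fun_def bounded_linear_Blinfun_apply orth_span_bounded)

text \<open>The first argument is replaced by the bidual element
  \<open>\<phi> \<mapsto> s \<phi> y\<close>; a form in the remaining variables on E is
  left.\<close>

definition exchange ::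
  "(('e::real_normed_vector \<Rightarrow>\<^sub>L real) \<Rightarrow> ('f::real_normed_vector \<Rightarrow>\<^sub>L real)) \<Rightarrow> 'f \<Rightarrow> ('e list \<Rightarrow> real) \<Rightarrow> 'e list \<Rightarrow> real"
  where "exchange s y M = (\<lambda>xs. blinfun_apply (s (head_fun M xs)) y)"

text \<open>Each exchange lowers the degree by one, so after as many exchanges as the degree only
  the value at \<open>[]\<close> carries information; for other lengths the result is 0.\<close>

definition transfer_form ::
  "(('e::real_normed_vector \<Rightarrow>\<^sub>L real) \<Rightarrow> ('f::real_normed_vector \<Rightarrow>\<^sub>L real)) \<Rightarrow> ('e list \<Rightarrow> real) \<Rightarrow> 'f list \<Rightarrow> real"
  where "transfer_form s M ys = fold (exchange s) ys M []"

definition pos_functional :: "('a::banach_lattice \<Rightarrow>\<^sub>L real) \<Rightarrow> bool" where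
  "pos_functional \<phi> \<longleftrightarrow> (\<forall>x\<ge>0. 0 \<le> blinfun_apply \<phi> x)"

text \<open>The lattice structure enters through positivity in both directions. The assumptions are
  symmetric in \<open>s\<close> and \<open>r\<close>, so every result on \<open>s\<close> can be
  read for \<open>r\<close>.\<close>

locale dual_iso =
  fixes s :: "('e::banach_lattice \<Rightarrow>\<^sub>L real) \<Rightarrow> ('f::banach_lattice \<Rightarrow>\<^sub>L real)"
    and r :: "('f \<Rightarrow>\<^sub>L real) \<Rightarrow> ('e \<Rightarrow>\<^sub>L real)"
  assumes bls: "bounded_linear s" and blr: "bounded_linear r"
    and sr: "s (r \<psi>) = \<psi>" and rs: "r (s \<phi>) = \<phi>"
    and pos_s: "pos_functional \<phi> \<Longrightarrow> pos_functional (s \<phi>)"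
    and pos_r: "pos_functional \<psi> \<Longrightarrow> pos_functional (r \<psi>)"
begin

lemma dual_iso_inverse: "dual_iso r s"
  by (rule dual_iso.intro) (use bls blr sr rs pos_s pos_r in auto)

lemma linear_s: "linear s" using bls by (rule bounded_linear.linear)

lemma exchange_comb:
  assumes "M \<in> orth_span n" "N \<in> orth_span n"
  shows "exchange s y (\<lambda>xs. a * M xs + b * N xs) = (\<lambda>xs. a * exchange s y M xs + b * exchange s y N xs)"
proof
  fix xs
  have "head_fun (\<lambda>xs. a * M xs + b * N xs) xs = a *\<^sub>R head_fun M xs + b *\<^sub>R head_fun N xs"
    using head_fun_apply[OF orth_span_comb[OF assms, of a b], of xs]
      head_fun_apply[OF assms(1), of xs] head_fun_apply[OF assms(2), of xs]
    by (intro blinfun_eqI) (simp add: blinfun.add_left blinfun.scaleR_left)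
  then show "exchange s y (\<lambda>xs. a * M xs + b * N xs) xs = a * exchange s y M xs + b * exchange s y N xs"
    by (simp add: exchange_def linear_add[OF linear_s] linear_scale[OF linear_s]
        blinfun.add_left blinfun.scaleR_left)
qed

text \<open>The two operations touch different arguments, and symmetry of the form lets the head and
  \<open>x\<close> trade places.\<close>

lemma exchange_plug:
  assumes "M \<in> orth_span n"
  shows "exchange s y (\<lambda>xs. M (x # xs)) = (\<lambda>xs. exchange s y M (x # xs))"
  by (simp add: exchange_def head_fun_def sym_form_swap[OF orth_span_sym_form[OF assms], of x])

lemma exchange_plugs:
  assumes "M \<in> orth_span n"
  shows "exchange s y (\<lambda>zs. M (xs @ zs)) = (\<lambda>zs. exchange s y M (xs @ zs))"
  using assms
proof (induction xs arbitrary: M n)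
  case (Cons x xs)
  from Cons.IH[OF orth_span_plug[OF Cons.prems, of x]] show ?case
    by (simp add: exchange_plug[OF Cons.prems])
qed simp

lemma exchange_zero: "exchange s y (\<lambda>xs. 0) = (\<lambda>xs. 0)"
  using exchange_comb[OF orth_cone_span[OF zero_orth_cone] orth_cone_span[OF zero_orth_cone], of y 0 0] by simp

text \<open>Disjointness is claimed here only for arguments that stay in E: it makes the whole head
  functional vanish, and \<open>s\<close> preserves 0. Disjoint points of F are the hard case,
  settled in \<open>transfer_orth_cone\<close>.\<close>

lemma exchange_orth_cone:
  assumes M: "M \<in> orth_cone n" and y: "0 \<le> y"
  shows "exchange s y M \<in> orth_cone (n - 1)"
proof -
  note sf = orth_coneD(1)[OF M]
  note h = head_fun_apply[OF orth_cone_span[OF M]]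
  have zero: "exchange s y M xs = 0" if "\<And>x. M (x # xs) = 0" for xs
  proof -
    have "head_fun M xs = 0" by (rule blinfun_eqI) (simp add: h that)
    then show ?thesis by (simp add: exchange_def linear_0[OF linear_s])
  qed
  have "exchange s y M xs = 0" if "length xs \<noteq> n - 1" for xs
    using that by (intro zero sym_formD(1)[OF sf]) auto
  moreover have "exchange s y M xs = exchange s y M zs" if "mset xs = mset zs" for xs zs
  proof -
    have "M (x # xs) = M (x # zs)" for x by (rule sym_formD(2)[OF sf]) (simp add: that)
    then show ?thesis by (simp add: exchange_def head_fun_def)
  qed
  moreover have "linear (\<lambda>x. exchange s y M (x # xs))" for xs
  proof (rule linearI)
    fix a b
    have "head_fun M ((a + b) # xs) = head_fun M (a # xs) + head_fun M (b # xs)"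
      by (rule blinfun_eqI) (simp add: h blinfun.add_left sym_form_swap[OF sf, of _ "a + b"] sym_form_swap[OF sf, of _ a] sym_form_swap[OF sf, of _ b] linear_add[OF sym_formD(3)[OF sf]])
    then show "exchange s y M ((a + b) # xs) = exchange s y M (a # xs) + exchange s y M (b # xs)"
      by (simp add: exchange_def linear_add[OF linear_s] blinfun.add_left)
  next
    fix t a
    have "head_fun M ((t *\<^sub>R a) # xs) = t *\<^sub>R head_fun M (a # xs)"
      by (rule blinfun_eqI) (simp add: h blinfun.scaleR_left sym_form_swap[OF sf, of _ "t *\<^sub>R a"] sym_form_swap[OF sf, of _ a] linear_scale[OF sym_formD(3)[OF sf]])
    then show "exchange s y M ((t *\<^sub>R a) # xs) = t *\<^sub>R exchange s y M (a # xs)"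
      by (simp add: exchange_def linear_scale[OF linear_s] blinfun.scaleR_left)
  qed
  moreover have "0 \<le> exchange s y M xs" if "nonneg_list xs" for xs
  proof -
    have "pos_functional (head_fun M xs)"
      using that orth_coneD(2)[OF M, of "_ # xs"] by (auto simp: pos_functional_def h)
    then show ?thesis using pos_s y by (auto simp: pos_functional_def exchange_def)
  qed
  moreover have "exchange s y M (a # b # xs) = 0" if "inf a b = 0" "nonneg_list xs" for a b xs
  proof (rule zero)
    fix x
    have *: "M (z # a # b # xs) = 0" if "0 \<le> z" for z
    proof -
      have "M (z # a # b # xs) = M (a # b # z # xs)" by (rule sym_formD(2)[OF sf]) simp
      then show ?thesis using orth_coneD(3)[OF M \<open>inf a b = 0\<close>, of "z # xs"] that \<open>nonneg_list xs\<close> by simp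
    qed
    show "M (x # a # b # xs) = 0"
      using linear_diff[OF sym_formD(3)[OF sf, of "a # b # xs"], of "pprt x" "pprt (- x)"]
      by (simp only: pprt_diff[symmetric] * zero_le_pprt)
  qed
  ultimately show ?thesis by (intro orth_coneI sym_formI)
qed

lemma exchange_orth_span:
  assumes "M \<in> orth_span n"
  shows "exchange s y M \<in> orth_span (n - 1)"
proof -
  obtain M1 M2 where M: "M1 \<in> orth_cone n" "M2 \<in> orth_cone n" "M = (\<lambda>xs. M1 xs - M2 xs)"
    using assms(1) by (rule orth_spanE)
  have y: "exchange s y N = (\<lambda>xs. 1 * exchange s (pprt y) N xs + (- 1) * exchange s (pprt (- y)) N xs)" for N
  proof
    fix xs
    show "exchange s y N xs = 1 * exchange s (pprt y) N xs + (- 1) * exchange s (pprt (- y)) N xs"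
      using blinfun.diff_right[of "s (head_fun N xs)" "pprt y" "pprt (- y)"]
      unfolding exchange_def pprt_diff[symmetric] by simp
  qed
  have N: "exchange s y N \<in> orth_span (n - 1)" if "N \<in> orth_cone n" for N
    by (subst y) (intro orth_span_comb orth_cone_span exchange_orth_cone that zero_le_pprt)
  have "exchange s y M = (\<lambda>xs. 1 * exchange s y M1 xs + (- 1) * exchange s y M2 xs)"
    using exchange_comb[OF M(1,2)[THEN orth_cone_span], of y 1 "- 1"] by (simp add: M(3))
  then show ?thesis by (simp only:) (intro orth_span_comb N M)
qed

lemma orthosymmetric_form_of:
  assumes M: "M \<in> orth_cone 2"
  shows "orthosymmetric_form (\<lambda>a b. M [a, b])"
proof (rule orthosymmetric_form.intro)
  note sf = orth_coneD(1)[OF M]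
  show "M [a, b] = M [b, a]" for a b by (rule sym_form_swap[OF sf])
  then show "linear (\<lambda>b. M [a, b])" for a using sym_formD(3)[OF sf, of "[a]"] by simp
qed (use orth_coneD[OF M] in auto)

lemma bounded_eval: "bounded_linear (\<lambda>\<phi>. blinfun_apply (s \<phi>) y)"
  using bounded_linear_compose[OF blinfun.bounded_linear_left bls] .

text \<open>The bridge to the bilinear theory: the head functional of \<open>M\<close> at
  \<open>[x]\<close> is \<open>A x\<close>, so the first exchange produces \<open>ext\<close> of
  evaluation at \<open>y1\<close> and the second evaluates it at \<open>y2\<close>.\<close>

lemma exchange_twice:
  assumes M: "M \<in> orth_cone 2"
  shows "exchange s y2 (exchange s y1 M) [] =
    blinfun_apply (s (orthosymmetric_form.ext (\<lambda>a b. M [a, b]) (\<lambda>\<phi>. blinfun_apply (s \<phi>) y1))) y2"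
proof -
  interpret orthosymmetric_form "\<lambda>a b. M [a, b]" by (rule orthosymmetric_form_of[OF M])
  have "head_fun M [x] = A x" for x
    unfolding head_fun_def A_def by (simp add: sym[of x])
  then show ?thesis by (simp add: exchange_def head_fun_def ext_def)
qed

lemma exchange_commute_cone:
  assumes M: "M \<in> orth_cone 2"
  shows "exchange s y2 (exchange s y1 M) [] = exchange s y1 (exchange s y2 M) []"
proof -
  interpret orthosymmetric_form "\<lambda>a b. M [a, b]" by (rule orthosymmetric_form_of[OF M])
  show ?thesis unfolding exchange_twice[OF M] by (rule ext_symmetric[OF bounded_eval bounded_eval])
qed

text \<open>The arguments \<open>xs\<close> not taking part are plugged in first, which leaves a
  difference of two bilinear forms covered by \<open>exchange_commute_cone\<close>.\<close>

lemma exchange_commute: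
  assumes M: "M \<in> orth_span n"
  shows "exchange s y2 (exchange s y1 M) = exchange s y1 (exchange s y2 M)"
proof
  fix xs
  have e2: "exchange s a (exchange s b M) \<in> orth_span (n - 2)" for a b
    using exchange_orth_span[OF exchange_orth_span[OF M, of b], of a] by (simp add: numeral_2_eq_2)
  have plug: "exchange s a (exchange s b M) xs = exchange s a (exchange s b (\<lambda>zs. M (xs @ zs))) []" for a b
    by (simp add: exchange_plugs[OF M] exchange_plugs[OF exchange_orth_span[OF M]])
  show "exchange s y2 (exchange s y1 M) xs = exchange s y1 (exchange s y2 M) xs"
  proof (cases "n = length xs + 2")
    case True
    then have "(\<lambda>zs. M (xs @ zs)) \<in> orth_span 2" using orth_span_plugs[OF M, of xs] by simp
    then obtain M1 M2 where N: "M1 \<in> orth_cone 2" "M2 \<in> orth_cone 2"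
      "(\<lambda>zs. M (xs @ zs)) = (\<lambda>zs. 1 * M1 zs + (- 1) * M2 zs)"
      by (auto elim!: orth_spanE)
    note c = N(1,2)[THEN orth_cone_span]
    note c' = c[THEN exchange_orth_span]
    show ?thesis unfolding plug N(3) exchange_comb[OF c] exchange_comb[OF c']
      using exchange_commute_cone N(1,2) by simp
  next
    case False
    then have z: "n < 2 \<or> length xs \<noteq> n - 2" by auto
    \<comment> \<open>In all other degrees both sides vanish; for \<open>n < 2\<close> because the
      second exchange meets a form of degree 0, whose head functional is 0.\<close>
    have "exchange s a (exchange s b M) xs = 0" for a b
    proof (cases "n < 2")
      case True
      have "exchange s b M \<in> orth_span 0" using exchange_orth_span[OF M, of b] True
        by (metis One_nat_def diff_is_0_eq' less_2_cases_iff order_refl zero_le)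
      then have "(\<lambda>x. exchange s b M (x # xs)) = (\<lambda>x. 0)"
        using sym_formD(1)[OF orth_span_sym_form] by fastforce
      then have "head_fun (exchange s b M) xs = 0"
        by (simp add: head_fun_def zero_blinfun.abs_eq)
      then show ?thesis by (subst exchange_def) (simp add: linear_0[OF linear_s])
    next
      case False
      then show ?thesis using z sym_formD(1)[OF orth_span_sym_form[OF e2]] by auto
    qed
    then show ?thesis by simp
  qed
qed

lemma fold_orth_span:
  "M \<in> orth_span n \<Longrightarrow> fold (exchange s) ys M \<in> orth_span (n - length ys)"
proof (induction ys arbitrary: M n)
  case (Cons y ys)
  from Cons.IH[OF exchange_orth_span[OF Cons.prems, of y]] show ?case by simp
qed simp

lemma fold_orth_cone:
  "M \<in> orth_cone n \<Longrightarrow> nonneg_list ys \<Longrightarrow> fold (exchange s) ys M \<in> orth_cone (n - length ys)"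
proof (induction ys arbitrary: M n)
  case (Cons y ys)
  from Cons.IH[OF exchange_orth_cone[OF Cons.prems(1), of y]] Cons.prems(2) show ?case by simp
qed simp

lemma fold_comb:
  assumes "M \<in> orth_span n" "N \<in> orth_span n"
  shows "fold (exchange s) ys (\<lambda>xs. a * M xs + b * N xs) =
    (\<lambda>xs. a * fold (exchange s) ys M xs + b * fold (exchange s) ys N xs)"
  using assms
proof (induction ys arbitrary: M N n)
  case (Cons y ys)
  from Cons.IH[OF Cons.prems[THEN exchange_orth_span]] show ?case
    by (simp add: exchange_comb[OF Cons.prems])
qed simp

lemma fold_plug:
  assumes "M \<in> orth_span n"
  shows "fold (exchange s) ys (\<lambda>xs. M (x # xs)) = (\<lambda>xs. fold (exchange s) ys M (x # xs))"
  using assms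
proof (induction ys arbitrary: M n)
  case (Cons y ys)
  from Cons.IH[OF exchange_orth_span[OF Cons.prems]] show ?case
    by (simp add: exchange_plug[OF Cons.prems])
qed simp

lemma fold_zero: "fold (exchange s) ys (\<lambda>xs. 0) = (\<lambda>xs. 0)"
  by (induction ys) (simp_all add: exchange_zero)

lemma fold_too_long:
  "M \<in> orth_span n \<Longrightarrow> n < length ys \<Longrightarrow> fold (exchange s) ys M = (\<lambda>xs. 0)"
proof (induction ys arbitrary: M n)
  case (Cons y ys)
  show ?case
  proof (cases n)
    case 0
    then have "M (x # xs) = 0" for x xs
      using sym_formD(1)[OF orth_span_sym_form[OF Cons.prems(1)], of "x # xs"] by simp
    then have "head_fun M xs = 0" for xs
      by (simp add: head_fun_def zero_blinfun.abs_eq)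
    then have "exchange s y M = (\<lambda>xs. 0)" by (simp add: exchange_def linear_0[OF linear_s])
    then show ?thesis by (simp add: fold_zero)
  next
    case (Suc k)
    then show ?thesis using Cons.IH[OF exchange_orth_span[OF Cons.prems(1), of y]] Cons.prems(2) by simp
  qed
qed simp

lemma fold_mset:
  assumes M: "M \<in> orth_span n" and "mset ys = mset zs"
  shows "fold (exchange s) ys M = fold (exchange s) zs M"
proof (rule swap_invariant_mset[where f = "\<lambda>ys. fold (exchange s) ys M", OF _ assms(2)])
  fix as a b bs
  show "fold (exchange s) (as @ a # b # bs) M = fold (exchange s) (as @ b # a # bs) M"
    using exchange_commute[OF fold_orth_span[OF M, of as], of b a] by simp
qed

text \<open>Since exchanges may be reordered, any chosen points can be exchanged last. One point
  last shows linearity, because the value is then a functional evaluated at it; two disjoint points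
  last leave a bilinear form for \<open>ext_disjoint\<close>.\<close>

lemma transfer_orth_cone:
  assumes M: "M \<in> orth_cone n"
  shows "transfer_form s M \<in> orth_cone n"
proof -
  note span = orth_cone_span[OF M]
  have head: "transfer_form s M (y # ys) = exchange s y (fold (exchange s) ys M) []" for y ys
    using fold_mset[OF span, of "y # ys" "ys @ [y]"] by (simp add: transfer_form_def)
  have "transfer_form s M ys = 0" if "length ys \<noteq> n" for ys
  proof (cases "length ys < n")
    case True
    then show ?thesis using sym_formD(1)[OF orth_span_sym_form[OF fold_orth_span[OF span]], of "[]" ys]
      by (simp add: transfer_form_def)
  next
    case False
    then show ?thesis using that fold_too_long[OF span, of ys] by (simp add: transfer_form_def)
  qed
  moreover have "transfer_form s M ys = transfer_form s M zs" if "mset ys = mset zs" for ys zs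
    using fold_mset[OF span that] by (simp add: transfer_form_def)
  moreover have "linear (\<lambda>y. transfer_form s M (y # ys))" for ys
    unfolding head by (simp add: exchange_def bounded_linear.linear blinfun.bounded_linear_right)
  moreover have "0 \<le> transfer_form s M ys" if "nonneg_list ys" for ys
    using orth_coneD(2)[OF fold_orth_cone[OF M that], of "[]"] by (simp add: transfer_form_def)
  moreover have "transfer_form s M (y # z # ys) = 0" if yz: "inf y z = 0" and ys: "nonneg_list ys" for y z ys
  proof (cases "n = length ys + 2")
    case True
    define N where "N = fold (exchange s) ys M"
    have N: "N \<in> orth_cone 2" using fold_orth_cone[OF M ys] True by (simp add: N_def)
    interpret orthosymmetric_form "\<lambda>a b. N [a, b]" by (rule orthosymmetric_form_of[OF N])
    have nn: "0 \<le> y" "0 \<le> z" using yz by (metis inf.cobounded1, metis inf.cobounded2)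
    have "transfer_form s M (y # z # ys) = exchange s z (exchange s y N) []"
      using fold_mset[OF span, of "y # z # ys" "ys @ [y, z]"] by (simp add: transfer_form_def N_def)
    also have "\<dots> = 0" unfolding exchange_twice[OF N]
    proof (rule ext_disjoint[OF bounded_eval])
      show "0 \<le> blinfun_apply (s \<phi>) y" if "\<And>x. 0 \<le> x \<Longrightarrow> 0 \<le> blinfun_apply \<phi> x" for \<phi>
        using pos_s[of \<phi>] that nn by (auto simp: pos_functional_def)
      show "\<exists>\<beta>. (\<forall>x\<ge>0. 0 \<le> blinfun_apply \<beta> x \<and> blinfun_apply \<beta> x \<le> blinfun_apply \<psi> x) \<and>
          blinfun_apply (s \<beta>) y = 0 \<and> blinfun_apply (s \<beta>) z = blinfun_apply (s \<psi>) z"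
        if psi: "\<And>x. 0 \<le> x \<Longrightarrow> 0 \<le> blinfun_apply \<psi> x" for \<psi>
      proof -
        have "\<And>x. 0 \<le> x \<Longrightarrow> 0 \<le> blinfun_apply (s \<psi>) x"
          using pos_s[of \<psi>] psi by (auto simp: pos_functional_def)
        \<comment> \<open>\<open>y\<close> and \<open>z\<close> are disjoint in F, so the splitting
          is made for \<open>s \<psi>\<close> in the dual of F and carried back by
          \<open>r\<close>.\<close>
        then obtain \<gamma> where \<gamma>: "\<And>x. 0 \<le> x \<Longrightarrow> 0 \<le> blinfun_apply \<gamma> x"
          "\<And>x. 0 \<le> x \<Longrightarrow> blinfun_apply \<gamma> x \<le> blinfun_apply (s \<psi>) x"
          "blinfun_apply \<gamma> y = 0" "blinfun_apply \<gamma> z = blinfun_apply (s \<psi>) z"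
          using functional_split[of "s \<psi>", OF _ yz] by metis
        have "pos_functional \<gamma>" "pos_functional (s \<psi> - \<gamma>)"
          using \<gamma>(1,2) by (auto simp: pos_functional_def blinfun.diff_left)
        then have "pos_functional (r \<gamma>)" "pos_functional (r (s \<psi> - \<gamma>))"
          by (auto intro: pos_r)
        then show ?thesis using \<gamma>(3,4)
          by (intro exI[of _ "r \<gamma>"])
            (auto simp: pos_functional_def sr rs linear_diff[OF bounded_linear.linear[OF blr]] blinfun.diff_left)
      qed
    qed (simp add: linear_0[OF linear_s])
    finally show ?thesis .
  next
    case False
    then show ?thesis using calculation(1)[of "y # z # ys"] by simp
  qed
  ultimately show ?thesis by (intro orth_coneI sym_formI)
qed

lemma transfer_comb:
  assumes "M \<in> orth_span n" "N \<in> orth_span n"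
  shows "transfer_form s (\<lambda>xs. a * M xs + b * N xs) = (\<lambda>ys. a * transfer_form s M ys + b * transfer_form s N ys)"
  by (rule ext) (simp add: transfer_form_def fold_comb[OF assms])

text \<open>The head functional of the transferred form is \<open>s\<close> applied to a head
  functional over E, so the first backward exchange cancels \<open>s\<close> and amounts to plugging
  \<open>x\<close> into \<open>M\<close>. Induction on the list does the rest.\<close>

lemma transfer_inverse:
  assumes "M \<in> orth_span n"
  shows "transfer_form r (transfer_form s M) = M"
proof
  interpret inv: dual_iso r s by (rule dual_iso_inverse)
  fix xs
  show "transfer_form r (transfer_form s M) xs = M xs"
    using assms
  proof (induction xs arbitrary: M n)
    case Nil
    then show ?case by (simp add: transfer_form_def)
  next
    case (Cons x xs)
    have "exchange r x (transfer_form s M) = transfer_form s (\<lambda>xs. M (x # xs))"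
    proof
      fix ys
      have "transfer_form s M (y # ys) = blinfun_apply (s (head_fun (fold (exchange s) ys M) [])) y" for y
        using fold_mset[OF Cons.prems, of "y # ys" "ys @ [y]"] by (simp add: transfer_form_def exchange_def)
      then have "head_fun (transfer_form s M) ys = s (head_fun (fold (exchange s) ys M) [])"
        by (simp add: head_fun_def[of "transfer_form s M"] blinfun_apply_inverse)
      then have "exchange r x (transfer_form s M) ys = fold (exchange s) ys M [x]"
        by (simp add: exchange_def rs head_fun_apply[OF fold_orth_span[OF Cons.prems]])
      then show "exchange r x (transfer_form s M) ys = transfer_form s (\<lambda>xs. M (x # xs)) ys"
        by (simp add: transfer_form_def fold_plug[OF Cons.prems])
    qed
    moreover have "transfer_form r (transfer_form s M) (x # xs) = fold (exchange r) xs (exchange r x (transfer_form s M)) []"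
      by (simp only: transfer_form_def[of r] fold_Cons o_apply)
    ultimately show ?case using Cons.IH[OF orth_span_plug[OF Cons.prems, of x]]
      by (simp only: transfer_form_def[of r])
  qed
qed

text \<open>Each exchange multiplies the bound by \<open>S * norm y\<close>, the norm of the head
  functional being the old bound with one factor removed.\<close>

lemma transfer_bound:
  assumes "M \<in> orth_span n" "\<And>xs. \<bar>M xs\<bar> \<le> c * prod_list (map norm xs)" "0 \<le> c"
    and S: "\<And>\<phi>. norm (s \<phi>) \<le> S * norm \<phi>" "0 \<le> S"
  shows "\<bar>transfer_form s M ys\<bar> \<le> c * S ^ length ys * prod_list (map norm ys)"
  using assms(1-3)
proof (induction ys arbitrary: M n c)
  case Nil
  then show ?case using Nil(2)[of "[]"] by (simp add: transfer_form_def)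
next
  case (Cons y ys)
  have nn: "0 \<le> prod_list (map norm xs)" for xs :: "'e list" by (induction xs) auto
  have "\<bar>exchange s y M xs\<bar> \<le> (c * S * norm y) * prod_list (map norm xs)" for xs
  proof -
    have "norm (head_fun M xs) \<le> c * prod_list (map norm xs)"
    proof (rule norm_blinfun_bound)
      fix x show "norm (blinfun_apply (head_fun M xs) x) \<le> c * prod_list (map norm xs) * norm x"
        using Cons.prems(2)[of "x # xs"] by (simp add: head_fun_apply[OF Cons.prems(1)] mult.commute mult.left_commute)
    qed (use Cons.prems(3) nn in simp)
    then have "norm (s (head_fun M xs)) \<le> S * (c * prod_list (map norm xs))"
      using S(1)[of "head_fun M xs"] mult_left_mono[OF _ S(2)] by (meson order_trans)
    then have "norm (s (head_fun M xs)) * norm y \<le> S * (c * prod_list (map norm xs)) * norm y"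
      by (intro mult_right_mono) auto
    moreover have "\<bar>exchange s y M xs\<bar> \<le> norm (s (head_fun M xs)) * norm y"
      using norm_blinfun[of "s (head_fun M xs)" y] by (simp add: exchange_def)
    ultimately show ?thesis by (simp add: mult.commute mult.left_commute)
  qed
  from Cons.IH[OF exchange_orth_span[OF Cons.prems(1)] this] Cons.prems(3) S(2)
  show ?case by (simp add: transfer_form_def mult.commute mult.left_commute)
qed

end

section \<open>Positive symmetric forms and polynomials\<close>

definition pos_form :: "nat \<Rightarrow> ('a::banach_lattice list \<Rightarrow> real) \<Rightarrow> bool" where
  "pos_form n M \<longleftrightarrow> sym_form n M \<and> (\<forall>xs. nonneg_list xs \<longrightarrow> 0 \<le> M xs)"

lemma pos_formD:
  assumes "pos_form n M"
  shows "sym_form n M" "nonneg_list xs \<Longrightarrow> 0 \<le> M xs"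
  using assms unfolding pos_form_def by blast+

lemma pos_form_plug: "pos_form n M \<Longrightarrow> 0 \<le> x \<Longrightarrow> pos_form (n - 1) (\<lambda>xs. M (x # xs))"
  using sym_form_plug[of n M x] by (simp add: pos_form_def)

lemma list_all2_replicateI: "P a b \<Longrightarrow> list_all2 P (replicate k a) (replicate k b)"
  by (induction k) auto

lemma pos_form_mono:
  assumes "pos_form n M" "nonneg_list xs" "list_all2 (\<le>) xs ys"
  shows "M xs \<le> M ys"
  using assms(3,1,2)
proof (induction arbitrary: M n rule: list_all2_induct)
  case (Cons x xs y ys)
  note sf = pos_formD(1)[OF Cons.prems(1)]
  have y: "0 \<le> y" using Cons by auto
  have "M (x # xs) \<le> M (y # xs)"
    using linear_diff[OF sym_formD(3)[OF sf, of xs], of y x] pos_formD(2)[OF Cons.prems(1), of "(y - x) # xs"]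
      Cons.prems(2) Cons.hyps(1) by simp
  also have "\<dots> \<le> M (y # ys)"
    using Cons.IH[OF pos_form_plug[OF Cons.prems(1) y]] Cons.prems(2) by simp
  finally show ?case .
qed simp

lemma pos_form_abs_le:
  assumes "pos_form n M"
  shows "\<bar>M xs\<bar> \<le> M (map modulus xs)"
  using assms
proof (induction xs arbitrary: M n)
  case Nil
  then show ?case using pos_formD(2)[OF Nil, of "[]"] by simp
next
  case (Cons x xs)
  note lin = sym_formD(3)[OF pos_formD(1)[OF Cons.prems]]
  have "M (x # xs) = M (pprt x # xs) - M (pprt (- x) # xs)"
    using linear_diff[OF lin[of xs], of "pprt x" "pprt (- x)"] by (simp only: pprt_diff[symmetric])
  moreover have "\<bar>M (pprt x # xs)\<bar> \<le> M (pprt x # map modulus xs)"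
    using Cons.IH[OF pos_form_plug[OF Cons.prems zero_le_pprt]] by simp
  moreover have "\<bar>M (pprt (- x) # xs)\<bar> \<le> M (pprt (- x) # map modulus xs)"
    using Cons.IH[OF pos_form_plug[OF Cons.prems zero_le_pprt]] by simp
  moreover have "M (modulus x # map modulus xs) = M (pprt x # map modulus xs) + M (pprt (- x) # map modulus xs)"
    unfolding modulus_eq_pprt[of x] by (rule linear_add[OF lin])
  ultimately show ?case by simp
qed

lemma orth_cone_pos_form: "M \<in> orth_cone n \<Longrightarrow> pos_form n M"
  by (simp add: pos_form_def orth_coneD)

text \<open>Only the two lowest coefficients matter; that of \<open>t\<close> is the directional
  derivative, with one of \<open>k\<close> entries \<open>x\<close> turned into \<open>y\<close>.
  \<open>R\<close> collects entries set aside during the induction. For \<open>k = 0\<close> the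
  factor \<open>real k\<close> hides the truncated \<open>k - 1\<close>.\<close>

lemma sym_form_power_poly:
  assumes sf: "sym_form n M"
  shows "\<exists>p. (\<forall>t. M (replicate k (x + t *\<^sub>R y) @ R) = poly p t) \<and> coeff p 0 = M (replicate k x @ R)
    \<and> coeff p 1 = real k * M (y # replicate (k - 1) x @ R)"
proof (induction k arbitrary: R)
  case 0
  show ?case by (rule exI[of _ "[:M R:]"]) simp
next
  case (Suc k)
  obtain p1 where p1: "\<And>t. M (replicate k (x + t *\<^sub>R y) @ x # R) = poly p1 t"
    "coeff p1 0 = M (replicate k x @ x # R)"
    "coeff p1 1 = real k * M (y # replicate (k - 1) x @ x # R)" using Suc[of "x # R"] by blast
  obtain p2 where p2: "\<And>t. M (replicate k (x + t *\<^sub>R y) @ y # R) = poly p2 t"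
    "coeff p2 0 = M (replicate k x @ y # R)" using Suc[of "y # R"] by blast
  have "M (replicate (Suc k) (x + t *\<^sub>R y) @ R) = poly (p1 + pCons 0 p2) t" for t
  proof -
    let ?L = "replicate k (x + t *\<^sub>R y)"
    have "M (replicate (Suc k) (x + t *\<^sub>R y) @ R) = M (x # ?L @ R) + t * M (y # ?L @ R)"
      by (simp add: linear_add[OF sym_formD(3)[OF sf]] linear_scale[OF sym_formD(3)[OF sf]])
    also have "M (x # ?L @ R) = M (?L @ x # R)" by (rule sym_formD(2)[OF sf]) simp
    also have "M (y # ?L @ R) = M (?L @ y # R)" by (rule sym_formD(2)[OF sf]) simp
    finally show ?thesis by (simp add: p1(1) p2(1))
  qed
  moreover have "coeff (p1 + pCons 0 p2) 0 = M (replicate (Suc k) x @ R)"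
    using sym_formD(2)[OF sf, of "replicate k x @ x # R" "x # replicate k x @ R"] by (simp add: p1(2))
  moreover have "coeff (p1 + pCons 0 p2) 1 = real (Suc k) * M (y # replicate (Suc k - 1) x @ R)"
  proof -
    have "real k * M (y # replicate (k - 1) x @ x # R) = real k * M (y # replicate k x @ R)"
    proof (cases k)
      case (Suc m)
      have "M (y # replicate m x @ x # R) = M (y # replicate (Suc m) x @ R)"
        by (rule sym_formD(2)[OF sf]) simp
      then show ?thesis using Suc by simp
    qed simp
    moreover have "M (replicate k x @ y # R) = M (y # replicate k x @ R)"
      by (rule sym_formD(2)[OF sf]) simp
    ultimately show ?thesis using p1(3) p2(2) by (simp add: algebra_simps)
  qed
  ultimately show ?case by blast
qed

text \<open>Diagonal entries are replaced by arbitrary vectors one at a time: along each line the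
  values form a polynomial in \<open>t\<close> that vanishes identically, hence so does its linear
  coefficient.\<close>

lemma sym_form_polarization:
  assumes sf: "sym_form n M" and diag: "\<And>x. M (replicate n x) = 0"
  shows "M xs = 0"
proof -
  have "M (replicate (n - j) x @ R) = 0" if "j \<le> n" "length R = j" for j x R
    using that
  proof (induction j arbitrary: x R)
    case 0
    then show ?case using diag by simp
  next
    case (Suc j)
    obtain y R' where R: "R = y # R'" using Suc.prems by (cases R) auto
    obtain p where p: "\<And>t. M (replicate (n - j) (x + t *\<^sub>R y) @ R') = poly p t"
      "coeff p 1 = real (n - j) * M (y # replicate (n - j - 1) x @ R')"
      using sym_form_power_poly[OF sf, of "n - j" x y R'] by blast
    have "poly p t = 0" for t using Suc.IH[of R' "x + t *\<^sub>R y"] Suc.prems R by (simp flip: p(1))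
    then have "p = 0" using poly_all_0_iff_0 by blast
    \<comment> \<open>The factor \<open>real (n - j)\<close> is nonzero because
      \<open>Suc j \<le> n\<close>.\<close>
    then have "M (y # replicate (n - j - 1) x @ R') = 0" using p(2) Suc.prems by simp
    moreover have "M (y # replicate (n - j - 1) x @ R') = M (replicate (n - Suc j) x @ R)"
      by (rule sym_formD(2)[OF sf]) (simp add: R)
    ultimately show ?case by simp
  qed
  from this[of n xs] show ?thesis using sym_formD(1)[OF sf, of xs] by (cases "length xs = n") auto
qed

section \<open>From orthogonal additivity to orthosymmetry\<close>

context
  fixes n :: nat and M :: "'a::banach_lattice list \<Rightarrow> real"
  assumes pf: "pos_form n M"
begin

private lemma perm: "mset xs = mset ys \<Longrightarrow> M xs = M ys"
  by (rule sym_formD(2)[OF pos_formD(1)[OF pf]])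

private lemma lin: "linear (\<lambda>x. M (x # xs))"
  by (rule sym_formD(3)[OF pos_formD(1)[OF pf]])

text \<open>The \<open>i\<close> copies of \<open>x\<close> are lowered to \<open>u\<close> one at a
  time. Each step costs at most the form with \<open>v\<close> in one slot, the other slots being
  kept at \<open>x\<close> by monotonicity.\<close>

lemma telescope:
  assumes "0 \<le> u" "u \<le> x" "x - u \<le> v" "nonneg_list Q"
  shows "M (replicate i x @ Q) \<le> M (replicate i u @ Q) + real i * M (v # replicate (i - 1) x @ Q)"
  using assms(4)
proof (induction i arbitrary: Q)
  case (Suc i)
  have x: "0 \<le> x" and v: "0 \<le> v" and xu: "0 \<le> x - u"
    using assms order_trans[of 0 u x] order_trans[of 0 "x - u" v] by auto
  have "M (replicate (Suc i) x @ Q) = M (u # replicate i x @ Q) + M ((x - u) # replicate i x @ Q)"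
    using linear_add[OF lin[of "replicate i x @ Q"], of u "x - u"] by simp
  also have "M ((x - u) # replicate i x @ Q) \<le> M (v # replicate i x @ Q)"
    by (rule pos_form_mono[OF pf]) (use assms xu x Suc.prems in \<open>auto intro: list_all2_refl\<close>)
  also have "M (u # replicate i x @ Q) = M (replicate i x @ u # Q)" by (rule perm) simp
  also have "\<dots> \<le> M (replicate i u @ u # Q) + real i * M (v # replicate (i - 1) x @ u # Q)"
    by (rule Suc.IH) (use assms Suc.prems in auto)
  also have "M (replicate i u @ u # Q) = M (replicate (Suc i) u @ Q)" by (rule perm) simp
  also have "real i * M (v # replicate (i - 1) x @ u # Q) \<le> real i * M (v # replicate i x @ Q)"
  proof (cases i)
    case (Suc m)
    have "M (v # replicate m x @ u # Q) \<le> M (v # replicate m x @ x # Q)"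
      by (rule pos_form_mono[OF pf]) (use assms v x Suc.prems in \<open>auto intro!: list_all2_refl list_all2_appendI\<close>)
    also have "\<dots> = M (v # replicate (Suc m) x @ Q)" by (rule perm) simp
    finally show ?thesis using Suc by (intro mult_left_mono) auto
  qed simp
  finally show ?case by (simp add: algebra_simps)
qed simp

text \<open>Orthogonal additivity first gives the vanishing of \<open>M (x, \<dots>, x, y, \<dots>, y)\<close>. Further
  arguments \<open>z\<close> are admitted one at a time, splitting \<open>z = inf z (x / \<epsilon>) + w\<close>; here \<open>w\<close> is disjoint
  from \<open>u = (x - \<epsilon> z)\<^sup>+\<close>, an approximation of \<open>x\<close>.\<close>

lemma orth_additive_vanish:
  assumes oa: "\<And>x y. inf x y = 0 \<Longrightarrow> M (replicate n (x + y)) = M (replicate n x) + M (replicate n y)"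
    and "inf x y = 0" "nonneg_list Z" "i \<ge> 1" "j \<ge> 1" "i + j + length Z = n"
  shows "M (replicate i x @ replicate j y @ Z) = 0"
  using assms(2-)
proof (induction Z arbitrary: i j x y)
  case Nil
  have nn: "0 \<le> x" "0 \<le> y" using Nil(1) by (metis inf.cobounded1, metis inf.cobounded2)
  obtain i' where i: "i = Suc i'" using Nil by (cases i) auto
  obtain j' where j: "j = Suc j'" using Nil by (cases j) auto
  have n: "n = Suc (i' + Suc j')" using Nil i j by simp
  let ?s = "x + y" and ?m = "i' + Suc j'"
  have le: "x \<le> ?s" "y \<le> ?s" using nn by auto
  \<comment> \<open>Of the expansion of the form at \<open>?s\<close>, only the two pure terms and
    one mixed term are kept, positivity disposing of the rest. Orthogonal additivity says that the
    pure terms are everything, so the mixed term is at most 0.\<close>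
  have "M (replicate n ?s) = M (x # replicate ?m ?s) + M (y # replicate ?m ?s)"
    unfolding n replicate_Suc by (rule linear_add[OF lin])
  moreover have "M (y # replicate ?m y) \<le> M (y # replicate ?m ?s)"
    by (rule pos_form_mono[OF pf]) (use nn le in \<open>auto intro!: list_all2_appendI list_all2_replicateI\<close>)
  moreover have "M (x # replicate ?m ?s) = M (?s # x # replicate (i' + j') ?s)"
    by (rule perm) simp
  moreover have "\<dots> = M (x # x # replicate (i' + j') ?s) + M (y # x # replicate (i' + j') ?s)"
    by (rule linear_add[OF lin])
  moreover have "M (x # x # replicate (i' + j') x) \<le> M (x # x # replicate (i' + j') ?s)"
    by (rule pos_form_mono[OF pf]) (use nn le in \<open>auto intro!: list_all2_appendI list_all2_replicateI\<close>)
  moreover have "M (y # x # replicate i' x @ replicate j' y) \<le> M (y # x # replicate (i' + j') ?s)"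
    unfolding replicate_add
    by (rule pos_form_mono[OF pf])
       (use nn le in \<open>auto intro!: list_all2_appendI list_all2_replicateI\<close>)
  moreover have "M (y # x # replicate i' x @ replicate j' y) = M (replicate i x @ replicate j y @ [])"
    by (rule perm) (simp add: i j)
  moreover have "M (replicate n ?s) = M (replicate n x) + M (replicate n y)" using oa Nil by simp
  moreover have "M (replicate n x) = M (x # x # replicate (i' + j') x)" "M (replicate n y) = M (y # replicate ?m y)"
    by (rule perm, simp add: n)+
  ultimately have "M (replicate i x @ replicate j y @ []) \<le> 0" by linarith
  moreover have "0 \<le> M (replicate i x @ replicate j y @ [])"
    by (rule pos_formD(2)[OF pf]) (use nn in auto)
  ultimately show ?case by simp
next
  case (Cons z Z)
  have nn: "0 \<le> x" "0 \<le> y" "0 \<le> z" "nonneg_list Z"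
    using Cons.prems by (metis inf.cobounded1, metis inf.cobounded2, auto)
  have est: "M (replicate i x @ replicate j y @ z # Z) \<le>
      \<epsilon> * (real i * M (z # replicate (i - 1) x @ replicate j y @ z # Z))" if \<epsilon>: "\<epsilon> > 0" for \<epsilon>
  proof -
    define u where "u = pprt (x - \<epsilon> *\<^sub>R z)"
    define a where "a = inf z ((1 / \<epsilon>) *\<^sub>R x)"
    define w where "w = pprt (z - (1 / \<epsilon>) *\<^sub>R x)"
    have zaw: "z = a + w" unfolding a_def w_def by (rule inf_diff_eq_pprt)
    have "w = (1 / \<epsilon>) *\<^sub>R pprt (\<epsilon> *\<^sub>R z - x)"
      using \<epsilon> pprt_scaleR[of "1 / \<epsilon>" "\<epsilon> *\<^sub>R z - x"] by (simp add: w_def scaleR_diff_right)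
    then have uw: "inf u w = 0"
      using disjoint_scale[OF disjoint_pprt_diff[of x "\<epsilon> *\<^sub>R z"], of "1 / \<epsilon>"] \<epsilon> by (simp add: u_def)
    have ez: "0 \<le> \<epsilon> *\<^sub>R z" using nn \<epsilon> by (simp add: scaleR_nonneg_nonneg)
    have u: "0 \<le> u" "u \<le> x"
      using pprt_mono[of "x - \<epsilon> *\<^sub>R z" x] ez nn by (simp_all add: u_def)
    have uy: "inf u y = 0" by (rule disjoint_mono[OF Cons.prems(1)]) (use u nn in auto)
    have a: "0 \<le> a" "a \<le> (1 / \<epsilon>) *\<^sub>R x" and w: "0 \<le> w"
      using nn \<epsilon> by (auto simp: a_def w_def scaleR_nonneg_nonneg)
    let ?L = "replicate i u @ replicate j y"
    have "M (?L @ z # Z) = M (z # ?L @ Z)" by (rule perm) simp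
    also have "\<dots> = M (a # ?L @ Z) + M (w # ?L @ Z)" unfolding zaw by (rule linear_add[OF lin])
    also have "M (a # ?L @ Z) \<le> 0"
    proof -
      \<comment> \<open>Up to a factor, \<open>a\<close> is dominated by one more copy of
        \<open>x\<close>, so the induction hypothesis applies with \<open>Suc i\<close>.\<close>
      have "M (a # ?L @ Z) \<le> M (((1 / \<epsilon>) *\<^sub>R x) # replicate i x @ replicate j y @ Z)"
        unfolding append_assoc
        by (rule pos_form_mono[OF pf])
           (use a u nn in \<open>auto simp: list_all2_refl intro!: list_all2_appendI list_all2_replicateI\<close>)
      also have "\<dots> = (1 / \<epsilon>) * M (x # replicate i x @ replicate j y @ Z)"
        by (simp add: linear_scale[OF lin])
      also have "M (x # replicate i x @ replicate j y @ Z) = 0"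
        using Cons.IH[OF Cons.prems(1) nn(4), of "Suc i" j] Cons.prems by simp
      finally show ?thesis by simp
    qed
    also have "M (w # ?L @ Z) \<le> 0"
    proof -
      \<comment> \<open>\<open>y\<close> and \<open>w\<close> are both raised to
        \<open>y + w\<close>, which is still disjoint from \<open>u\<close>; the induction
        hypothesis then applies with \<open>Suc j\<close>.\<close>
      have "M (w # ?L @ Z) = M (replicate i u @ (w # replicate j y) @ Z)" by (rule perm) simp
      also have "\<dots> \<le> M (replicate i u @ replicate (Suc j) (y + w) @ Z)"
        by (rule pos_form_mono[OF pf])
           (use u w nn in \<open>auto simp: list_all2_refl add_increasing intro!: list_all2_appendI list_all2_replicateI\<close>)
      also have "\<dots> = 0"
        using Cons.IH[OF disjoint_add[OF uy uw] nn(4), of i "Suc j"] Cons.prems by simp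
      finally show ?thesis .
    qed
    finally have "M (replicate i u @ replicate j y @ z # Z) \<le> 0" by simp
    moreover have "x - u \<le> \<epsilon> *\<^sub>R z" using inf_diff_eq_pprt[of x "\<epsilon> *\<^sub>R z"]
      by (metis add_diff_cancel_right' inf.cobounded2 u_def)
    then have "M (replicate i x @ replicate j y @ z # Z) \<le> M (replicate i u @ replicate j y @ z # Z)
       + real i * M ((\<epsilon> *\<^sub>R z) # replicate (i - 1) x @ replicate j y @ z # Z)"
      by (intro telescope) (use u nn in auto)
    ultimately show ?thesis by (simp add: linear_scale[OF lin] mult.left_commute)
  qed
  define C where "C = real i * M (z # replicate (i - 1) x @ replicate j y @ z # Z)"
  have C: "0 \<le> C" unfolding C_def by (intro mult_nonneg_nonneg pos_formD(2)[OF pf]) (use nn in auto)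
  have "M (replicate i x @ replicate j y @ z # Z) \<le> 0"
  proof (rule field_le_epsilon)
    fix e :: real assume e: "e > 0"
    \<comment> \<open>\<open>C\<close> may be 0, hence the division by \<open>C + 1\<close>.\<close>
    have "M (replicate i x @ replicate j y @ z # Z) \<le> e / (C + 1) * C"
      unfolding C_def[symmetric] using est[of "e / (C + 1)"] e C by (simp add: C_def)
    also have "\<dots> \<le> e" using e C by (simp add: field_simps)
    finally show "M (replicate i x @ replicate j y @ z # Z) \<le> 0 + e" by simp
  qed
  moreover have "0 \<le> M (replicate i x @ replicate j y @ z # Z)"
    by (rule pos_formD(2)[OF pf]) (use nn in auto)
  ultimately show ?case by simp
qed

lemma orth_additive_orth_cone:
  assumes oa: "\<And>x y. inf x y = 0 \<Longrightarrow> M (replicate n (x + y)) = M (replicate n x) + M (replicate n y)"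
  shows "M \<in> orth_cone n"
proof (rule orth_coneI[OF pos_formD(1)[OF pf] pos_formD(2)[OF pf]])
  fix x y :: "'a" and xs :: "'a list" assume xy: "inf x y = 0" "nonneg_list xs"
  show "M (x # y # xs) = 0"
  proof (cases "length xs + 2 = n")
    case True
    then show ?thesis using orth_additive_vanish[OF oa xy(1) xy(2), of 1 1] by simp
  next
    case False
    then show ?thesis by (intro sym_formD(1)[OF pos_formD(1)[OF pf]]) auto
  qed
qed

end

lemma orth_cone_vanish:
  assumes M: "M \<in> orth_cone n" and xy: "inf (modulus x) (modulus y) = 0"
  shows "M (x # y # xs) = 0"
proof -
  have "\<bar>M (x # y # xs)\<bar> \<le> M (map modulus (x # y # xs))"
    by (rule pos_form_abs_le[OF orth_cone_pos_form[OF M]])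
  also have "\<dots> = 0" using orth_coneD(3)[OF M xy, of "map modulus xs"] by simp
  finally show ?thesis by simp
qed

text \<open>In the presence of one \<open>x\<close> every \<open>y\<close> contributes 0, so the
  sums shrink to \<open>x\<close> one at a time.\<close>

lemma orth_cone_power_add:
  assumes M: "M \<in> orth_cone n" and xy: "inf (modulus x) (modulus y) = 0"
  shows "M (x # replicate k (x + y) @ R) = M (x # replicate k x @ R)"
proof (induction k arbitrary: R)
  case (Suc k)
  note sf = orth_coneD(1)[OF M]
  let ?L = "replicate k (x + y) @ R"
  have "M (x # replicate (Suc k) (x + y) @ R) = M ((x + y) # x # ?L)"
    by (rule sym_formD(2)[OF sf]) simp
  also have "\<dots> = M (x # x # ?L) + M (y # x # ?L)" by (rule linear_add[OF sym_formD(3)[OF sf]])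
  also have "M (y # x # ?L) = 0" by (rule orth_cone_vanish[OF M]) (use xy in \<open>simp add: inf_commute\<close>)
  also have "M (x # x # ?L) = M (x # replicate k (x + y) @ x # R)" by (rule sym_formD(2)[OF sf]) simp
  also have "\<dots> = M (x # replicate k x @ x # R)" by (rule Suc)
  also have "\<dots> = M (x # replicate (Suc k) x @ R)" by (rule sym_formD(2)[OF sf]) simp
  finally show ?case by simp
qed simp

text \<open>Splitting one argument produces the two halves treated by
  \<open>orth_cone_power_add\<close>. This needs an argument to split, hence
  \<open>n \<ge> 1\<close>: a nonzero constant is not additive.\<close>

lemma orth_cone_orth_additive:
  assumes M: "M \<in> orth_cone n" and xy: "inf (modulus x) (modulus y) = 0" and n: "n \<ge> 1"
  shows "M (replicate n (x + y)) = M (replicate n x) + M (replicate n y)"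
proof -
  obtain m where m: "n = Suc m" using n by (cases n) auto
  have "M (replicate n (x + y)) = M (x # replicate m (x + y)) + M (y # replicate m (x + y))"
    unfolding m replicate_Suc by (rule linear_add[OF sym_formD(3)[OF orth_coneD(1)[OF M]]])
  then show ?thesis
    using orth_cone_power_add[OF M xy, of m "[]"] orth_cone_power_add[OF M, of y x m "[]"] xy
    by (simp add: m inf_commute add.commute)
qed

section \<open>Vector-valued forms\<close>

text \<open>Testing against every \<open>g\<close> reduces values in the dual of G to scalar forms,
  and their vanishing on lists of wrong length makes a form unique for its polynomial.\<close>

definition vform :: "nat \<Rightarrow> ('a::real_vector list \<Rightarrow> ('g::real_normed_vector \<Rightarrow>\<^sub>L real)) \<Rightarrow> bool" where
  "vform n T \<longleftrightarrow> (\<forall>g. sym_form n (\<lambda>xs. blinfun_apply (T xs) g))"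

definition pos_vform ::
  "nat \<Rightarrow> ('a::banach_lattice list \<Rightarrow> ('g::banach_lattice \<Rightarrow>\<^sub>L real)) \<Rightarrow> bool" where
  "pos_vform n T \<longleftrightarrow> (\<forall>g\<ge>0. pos_form n (\<lambda>xs. blinfun_apply (T xs) g))"

definition orth_vform ::
  "nat \<Rightarrow> ('a::banach_lattice list \<Rightarrow> ('g::banach_lattice \<Rightarrow>\<^sub>L real)) \<Rightarrow> bool" where
  "orth_vform n T \<longleftrightarrow> (\<forall>g\<ge>0. (\<lambda>xs. blinfun_apply (T xs) g) \<in> orth_cone n)"

lemma blinfun_apply_split:
  "blinfun_apply (\<phi> :: 'g::banach_lattice \<Rightarrow>\<^sub>L real) g = blinfun_apply \<phi> (pprt g) - blinfun_apply \<phi> (pprt (- g))"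
  using blinfun.diff_right[of \<phi> "pprt g" "pprt (- g)"] by (simp only: pprt_diff[symmetric])

lemma pos_vformD:
  assumes "pos_vform n T"
  shows "vform n T"
  unfolding vform_def
proof
  fix g
  have "sym_form n (\<lambda>xs. blinfun_apply (T xs) h)" if "0 \<le> h" for h
    using assms that by (simp add: pos_vform_def pos_form_def)
  from sym_form_comb[OF this[OF zero_le_pprt, of g] this[OF zero_le_pprt, of "- g"], of 1 "- 1"]
  show "sym_form n (\<lambda>xs. blinfun_apply (T xs) g)" by (simp add: blinfun_apply_split[of _ g])
qed

lemma orth_vform_pos: "orth_vform n T \<Longrightarrow> pos_vform n T"
  by (simp add: orth_vform_def pos_vform_def orth_cone_pos_form)

lemma vform_multilinear:
  assumes "vform n T"
  shows "multilinear n T" "symmetric_ml n T"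
proof -
  have sf: "sym_form n (\<lambda>xs. blinfun_apply (T xs) g)" for g using assms by (simp add: vform_def)
  show "symmetric_ml n T" unfolding symmetric_ml_def
    using sym_formD(2)[OF sf] by (auto intro!: blinfun_eqI)
  show "multilinear n T" unfolding multilinear_def
  proof (intro allI impI)
    fix xs :: "'a list" and i u v and a b :: real
    assume i: "length xs = n \<and> i < n"
    define R where "R = take i xs @ drop (Suc i) xs"
    have T: "T (xs[i := z]) = T (z # R)" for z
    proof (rule blinfun_eqI)
      fix g
      have "mset (xs[i := z]) = mset (z # R)" using i by (simp add: upd_conv_take_nth_drop R_def)
      then show "blinfun_apply (T (xs[i := z])) g = blinfun_apply (T (z # R)) g"
        by (rule sym_formD(2)[OF sf])
    qed
    show "T (xs[i := a *\<^sub>R u + b *\<^sub>R v]) = a *\<^sub>R T (xs[i := u]) + b *\<^sub>R T (xs[i := v])"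
      unfolding T
      by (rule blinfun_eqI)
         (simp add: blinfun.add_left blinfun.scaleR_left linear_add[OF sym_formD(3)[OF sf]] linear_scale[OF sym_formD(3)[OF sf]])
  qed
qed

lemma multilinear_vform:
  assumes ml: "multilinear n T" and sy: "symmetric_ml n T"
  shows "vform n (\<lambda>xs. if length xs = n then T xs else 0)"
  unfolding vform_def
proof (intro allI sym_formI)
  fix g xs
  show "linear (\<lambda>x. blinfun_apply (if length (x # xs) = n then T (x # xs) else 0) g)"
  proof (cases "length xs + 1 = n")
    case True
    have *: "T ((a *\<^sub>R u + b *\<^sub>R v) # xs) = a *\<^sub>R T (u # xs) + b *\<^sub>R T (v # xs)" for a b u v
      using ml[unfolded multilinear_def, rule_format, of "u # xs" 0 a u b v] True by simp
    show ?thesis using True *[of 1 _ 1] *[of _ _ 0]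
      by (intro linearI) (simp_all add: blinfun.add_left blinfun.scaleR_left)
  next
    case False
    then show ?thesis by (auto simp: linear_iff)
  qed
next
  fix g and xs ys :: "'a list" assume "mset xs = mset ys"
  then show "blinfun_apply (if length xs = n then T xs else 0) g = blinfun_apply (if length ys = n then T ys else 0) g"
    using sy unfolding symmetric_ml_def by (metis size_mset)
qed simp

lemma positive_poly_iff:
  assumes n: "n \<ge> 1"
  shows "positive_poly n P \<longleftrightarrow> (\<exists>T. pos_vform n T \<and> P = poly_of n T)"
proof
  assume "positive_poly n P"
  then obtain T where T: "multilinear n T" "symmetric_ml n T" "positive_ml n T" "P = poly_of n T"
    by (auto simp: positive_poly_def)
  define T' where "T' = (\<lambda>xs. if length xs = n then T xs else 0)"
  have "vform n T'" unfolding T'_def by (rule multilinear_vform[OF T(1,2)])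
  then have "pos_vform n T'"
    using T(3) by (auto simp: pos_vform_def pos_form_def vform_def T'_def positive_ml_def dual_le_def)
  moreover have "P = poly_of n T'" by (simp add: T poly_of_def T'_def)
  ultimately show "\<exists>T. pos_vform n T \<and> P = poly_of n T" by blast
next
  assume "\<exists>T. pos_vform n T \<and> P = poly_of n T"
  then obtain T where T: "pos_vform n T" "P = poly_of n T" by blast
  then show "positive_poly n P"
    using vform_multilinear[OF pos_vformD[OF T(1)]]
    by (auto simp: positive_poly_def positive_ml_def dual_le_def pos_vform_def pos_form_def)
qed

lemma vform_comb:
  assumes "vform n T" "vform n U"
  shows "vform n (\<lambda>xs. a *\<^sub>R T xs + b *\<^sub>R U xs)"
  using assms by (auto simp: vform_def blinfun.add_left blinfun.scaleR_left intro: sym_form_comb)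

lemma pos_vform_comb:
  assumes "pos_vform n T" "pos_vform n U" "0 \<le> a" "0 \<le> b"
  shows "pos_vform n (\<lambda>xs. a *\<^sub>R T xs + b *\<^sub>R U xs)"
  using assms by (auto simp: pos_vform_def pos_form_def blinfun.add_left blinfun.scaleR_left intro: sym_form_comb)

lemma orth_vform_comb:
  assumes "orth_vform n T" "orth_vform n U" "0 \<le> a" "0 \<le> b"
  shows "orth_vform n (\<lambda>xs. a *\<^sub>R T xs + b *\<^sub>R U xs)"
  using assms by (auto simp: orth_vform_def blinfun.add_left blinfun.scaleR_left intro: orth_cone_comb)

text \<open>Polarization after evaluation at each \<open>g\<close>. It allows order relations
  between polynomials to be read off from their forms.\<close>

lemma poly_of_inject:
  assumes "vform n T" "vform n U" "poly_of n T = poly_of n U"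
  shows "T = U"
proof
  fix xs
  show "T xs = U xs"
  proof (rule blinfun_eqI)
    fix g
    let ?M = "\<lambda>xs. 1 * blinfun_apply (T xs) g + (- 1) * blinfun_apply (U xs) g"
    have "?M xs = 0"
    proof (rule sym_form_polarization)
      show "sym_form n ?M" using assms by (intro sym_form_comb) (auto simp: vform_def)
      show "?M (replicate n x) = 0" for x using fun_cong[OF assms(3), of x] by (simp add: poly_of_def)
    qed
    then show "blinfun_apply (T xs) g = blinfun_apply (U xs) g" by simp
  qed
qed

lemma orth_additive_iff:
  assumes T: "pos_vform n T" and n: "n \<ge> 1"
  shows "orth_additive (poly_of n T) \<longleftrightarrow> orth_vform n T"
proof
  assume oa: "orth_additive (poly_of n T)"
  show "orth_vform n T" unfolding orth_vform_def
  proof (intro allI impI)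
    fix g :: 'b assume g: "0 \<le> g"
    have "pos_form n (\<lambda>xs. blinfun_apply (T xs) g)" using T g by (simp add: pos_vform_def)
    then show "(\<lambda>xs. blinfun_apply (T xs) g) \<in> orth_cone n"
    proof (rule orth_additive_orth_cone)
      fix x y :: 'a assume xy: "inf x y = 0"
      have "0 \<le> x" "0 \<le> y" using xy by (metis inf.cobounded1, metis inf.cobounded2)
      then have "poly_of n T (x + y) = poly_of n T x + poly_of n T y"
        using oa xy unfolding orth_additive_def by (simp only: modulus_of_nonneg)
      then show "blinfun_apply (T (replicate n (x + y))) g =
          blinfun_apply (T (replicate n x)) g + blinfun_apply (T (replicate n y)) g"
        by (simp add: poly_of_def blinfun.add_left)
    qed
  qed
next
  assume oc: "orth_vform n T"
  show "orth_additive (poly_of n T)" unfolding orth_additive_def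
  proof (intro allI impI blinfun_eqI)
    fix x y :: 'a and g :: 'b assume xy: "inf (modulus x) (modulus y) = 0"
    have "blinfun_apply (T (replicate n (x + y))) h =
        blinfun_apply (T (replicate n x)) h + blinfun_apply (T (replicate n y)) h" if "0 \<le> h" for h
      using orth_cone_orth_additive[where M = "\<lambda>xs. blinfun_apply (T xs) h", OF _ xy n] oc that by (simp add: orth_vform_def)
    from this[of "pprt g"] this[of "pprt (- g)"]
    show "blinfun_apply (poly_of n T (x + y)) g = blinfun_apply (poly_of n T x + poly_of n T y) g"
      by (simp add: poly_of_def blinfun.add_left blinfun_apply_split[of _ g])
  qed
qed

section \<open>The modulus of a regular form\<close>

definition cone_additive :: "('a::banach_lattice \<Rightarrow> real) \<Rightarrow> bool" where
  "cone_additive f \<longleftrightarrow> (\<forall>x\<ge>0. \<forall>y\<ge>0. f (x + y) = f x + f y)"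

definition cone_subadditive :: "('a::banach_lattice \<Rightarrow> real) \<Rightarrow> bool" where
  "cone_subadditive f \<longleftrightarrow> (\<forall>x\<ge>0. \<forall>y\<ge>0. f (x + y) \<le> f x + f y)"

text \<open>The Riesz-Kantorovich formula: for a subadditive \<open>V\<close> with an additive
  majorant on the cone this is the least such majorant.\<close>

definition rk_sup :: "('a::banach_lattice \<Rightarrow> real) \<Rightarrow> 'a \<Rightarrow> real" where
  "rk_sup V x = Sup {sum_list (map V as) | as. nonneg_list as \<and> sum_list as = x}"

lemma sum_list_nonneg_lattice: "nonneg_list as \<Longrightarrow> 0 \<le> sum_list as"
  by (induction as) auto

lemma cone_additive_sum_list:
  assumes "cone_additive f" "nonneg_list as"
  shows "f (sum_list as) = sum_list (map f as)"
  using assms(2)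
proof (induction as)
  case Nil
  then show ?case using assms(1) unfolding cone_additive_def by (metis add.right_neutral add_cancel_right_left list.simps(8) order_refl sum_list.Nil)
next
  case (Cons a as)
  then show ?case using assms(1) by (simp add: cone_additive_def sum_list_nonneg_lattice)
qed

text \<open>By the Riesz decomposition property a partition of \<open>x + y\<close> refines to partitions of \<open>x\<close>
  and of \<open>y\<close>.\<close>

lemma partition_split:
  assumes V: "cone_subadditive V" and "nonneg_list cs" "sum_list cs = x + y" "0 \<le> x" "0 \<le> y"
  shows "\<exists>as bs. nonneg_list as \<and> nonneg_list bs \<and> sum_list as = x \<and> sum_list bs = y
    \<and> sum_list (map V cs) \<le> sum_list (map V as) + sum_list (map V bs)"
  using assms(2-)
proof (induction cs arbitrary: x y)
  case Nil
  then have "x = 0" "y = 0" by (simp_all add: add_nonneg_eq_0_iff)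
  then show ?case by (intro exI[of _ "[]"]) simp
next
  case (Cons c cs)
  \<comment> \<open>\<open>a\<close> is the largest part of \<open>c\<close> that fits below
    \<open>x\<close>; as \<open>c \<le> x + y\<close>, the excess \<open>b\<close> fits below
    \<open>y\<close>.\<close>
  define a where "a = inf c x"
  define b where "b = pprt (c - x)"
  have c: "c = a + b" unfolding a_def b_def by (rule inf_diff_eq_pprt)
  have a: "0 \<le> a" "a \<le> x" and b: "0 \<le> b" using Cons.prems by (auto simp: a_def b_def)
  have cs: "0 \<le> sum_list cs" using Cons.prems by (intro sum_list_nonneg_lattice) auto
  have "c - x \<le> y"
    using Cons.prems(2) cs by (metis add.commute add_increasing2 diff_le_eq order_refl sum_list.Cons)
  then have "b \<le> y" using pprt_mono[of "c - x" y] Cons.prems(4) by (simp add: b_def)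
  moreover have "sum_list cs = (x - a) + (y - b)" using Cons.prems(2) c by (simp add: algebra_simps)
  ultimately obtain as bs where asbs: "nonneg_list as" "nonneg_list bs" "sum_list as = x - a" "sum_list bs = y - b"
    "sum_list (map V cs) \<le> sum_list (map V as) + sum_list (map V bs)"
    using Cons.IH[of "x - a" "y - b"] Cons.prems a by auto
  moreover have "V c \<le> V a + V b" using V a b unfolding c cone_subadditive_def by blast
  ultimately show ?case using a b
    by (intro exI[of _ "a # as"] exI[of _ "b # bs"]) auto
qed

context
  fixes V W :: "'a::banach_lattice \<Rightarrow> real"
  assumes W: "cone_additive W" and VW: "\<And>x. 0 \<le> x \<Longrightarrow> V x \<le> W x"
begin

lemma rk_upper:
  assumes "nonneg_list as" "sum_list as = x"
  shows "sum_list (map V as) \<le> rk_sup V x"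
  unfolding rk_sup_def
proof (rule cSup_upper)
  show "bdd_above {sum_list (map V as) | as. nonneg_list as \<and> sum_list as = x}"
  proof (rule bdd_aboveI)
    fix s assume "s \<in> {sum_list (map V as) | as. nonneg_list as \<and> sum_list as = x}"
    then obtain as where as: "s = sum_list (map V as)" "nonneg_list as" "sum_list as = x" by auto
    have "s \<le> sum_list (map W as)" unfolding as(1) by (rule sum_list_mono) (use as VW in auto)
    then show "s \<le> W x" using cone_additive_sum_list[OF W as(2)] as(3) by simp
  qed
qed (use assms in auto)

lemma rk_least:
  assumes "0 \<le> x" "\<And>as. nonneg_list as \<Longrightarrow> sum_list as = x \<Longrightarrow> sum_list (map V as) \<le> c"
  shows "rk_sup V x \<le> c"
  unfolding rk_sup_def
proof (rule cSup_least)
  have "V x \<in> {sum_list (map V as) | as. nonneg_list as \<and> sum_list as = x}"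
    using assms(1) by (auto intro!: exI[of _ "[x]"])
  then show "{sum_list (map V as) | as. nonneg_list as \<and> sum_list as = x} \<noteq> {}" by auto
qed (use assms(2) in auto)

lemma rk_ge: "0 \<le> x \<Longrightarrow> V x \<le> rk_sup V x"
  using rk_upper[of "[x]" x] by simp

lemma rk_le: "0 \<le> x \<Longrightarrow> rk_sup V x \<le> W x"
  by (rule rk_least, assumption)
     (use VW in \<open>force simp: cone_additive_sum_list[OF W] intro!: sum_list_mono\<close>)

lemma rk_add:
  assumes V: "cone_subadditive V"
  shows "cone_additive (rk_sup V)"
  unfolding cone_additive_def
proof (intro allI impI antisym)
  fix x y :: 'a assume xy: "0 \<le> x" "0 \<le> y"
  show "rk_sup V (x + y) \<le> rk_sup V x + rk_sup V y"
  proof (rule rk_least)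
    fix cs assume "nonneg_list cs" "sum_list cs = x + y"
    from partition_split[OF V this xy] obtain as bs where
      "nonneg_list as" "nonneg_list bs" "sum_list as = x" "sum_list bs = y"
      "sum_list (map V cs) \<le> sum_list (map V as) + sum_list (map V bs)" by blast
    then show "sum_list (map V cs) \<le> rk_sup V x + rk_sup V y"
      using rk_upper[of as x] rk_upper[of bs y] by linarith
  qed (use xy in simp)
  have "rk_sup V x \<le> rk_sup V (x + y) - rk_sup V y"
  proof (rule rk_least[OF xy(1)])
    fix as assume as: "nonneg_list as" "sum_list as = x"
    have "rk_sup V y \<le> rk_sup V (x + y) - sum_list (map V as)"
    proof (rule rk_least[OF xy(2)])
      fix bs assume "nonneg_list bs" "sum_list bs = y"
      then show "sum_list (map V bs) \<le> rk_sup V (x + y) - sum_list (map V as)"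
        using rk_upper[of "as @ bs" "x + y"] as by (simp add: ball_Un)
    qed
    then show "sum_list (map V as) \<le> rk_sup V (x + y) - rk_sup V y" by simp
  qed
  then show "rk_sup V x + rk_sup V y \<le> rk_sup V (x + y)" by simp
qed

end

lemma cone_additive_sum: "cone_additive f \<Longrightarrow> cone_additive g \<Longrightarrow> cone_additive (\<lambda>x. f x + g x)"
  by (simp add: cone_additive_def)

text \<open>One partition serves both suprema for the upper bound. For the lower bound,
  subadditivity of \<open>V1\<close> lets a partition chosen for \<open>V2\<close> refine one chosen
  for \<open>V1\<close>: the pointwise estimate \<open>pt\<close> is summed over a partition, using
  additivity of the suprema of \<open>V2\<close> and \<open>V3\<close>.\<close>

lemma rk_param:
  assumes W: "cone_additive W1" "cone_additive W2"
    and VW: "\<And>x. 0 \<le> x \<Longrightarrow> V1 x \<le> W1 x" "\<And>x. 0 \<le> x \<Longrightarrow> V2 x \<le> W2 x"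
    and V: "cone_subadditive V1" "cone_subadditive V2"
    and V3: "\<And>x. 0 \<le> x \<Longrightarrow> V3 x = V1 x + V2 x" and x: "0 \<le> x"
  shows "rk_sup V3 x = rk_sup V1 x + rk_sup V2 x"
proof (rule antisym)
  let ?W = "\<lambda>x. W1 x + W2 x"
  have W3: "cone_additive ?W" by (rule cone_additive_sum[OF W])
  have VW3: "\<And>x. 0 \<le> x \<Longrightarrow> V3 x \<le> ?W x" using VW V3 by (simp add: add_mono)
  have sub3: "cone_subadditive V3"
    unfolding cone_subadditive_def
  proof (intro allI impI)
    fix a b :: 'a assume "0 \<le> a" "0 \<le> b"
    moreover from this have "V1 (a + b) \<le> V1 a + V1 b" "V2 (a + b) \<le> V2 a + V2 b"
      using V by (auto simp: cone_subadditive_def)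
    ultimately show "V3 (a + b) \<le> V3 a + V3 b" using V3 by simp
  qed
  have sum3: "sum_list (map V3 as) = sum_list (map V1 as) + sum_list (map V2 as)" if "nonneg_list as" for as
    using that by (induction as) (auto simp: V3)
  show "rk_sup V3 x \<le> rk_sup V1 x + rk_sup V2 x"
    by (rule rk_least[OF W3 VW3 x]) (simp_all add: sum3 add_mono rk_upper[OF W(1) VW(1)] rk_upper[OF W(2) VW(2)])
  have pt: "V1 a + rk_sup V2 a \<le> rk_sup V3 a" if a: "0 \<le> a" for a
  proof -
    have "rk_sup V2 a \<le> rk_sup V3 a - V1 a"
    proof (rule rk_least[OF W(2) VW(2) a])
      fix bs assume bs: "nonneg_list bs" "sum_list bs = a"
      have "V1 (sum_list bs) \<le> sum_list (map V1 bs)"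
        if "bs \<noteq> []" using that bs(1)
      proof (induction bs rule: list_nonempty_induct)
        case (cons b bs)
        then have "V1 (b + sum_list bs) \<le> V1 b + V1 (sum_list bs)"
          using V(1) by (simp add: cone_subadditive_def sum_list_nonneg_lattice)
        then show ?case using cons by simp
      qed simp
      \<comment> \<open>The empty partition occurs only for \<open>a = 0\<close>, where the additive
        majorant \<open>W1\<close> is 0.\<close>
      moreover have "V1 a \<le> 0" if "bs = []"
      proof -
        have "W1 0 = 0" using W(1) unfolding cone_additive_def by (metis add.right_neutral add_cancel_right_left order_refl)
        then show ?thesis using VW(1)[of 0] that bs(2) by simp
      qed
      ultimately have "V1 a \<le> sum_list (map V1 bs)" using bs(2) by (cases "bs = []") auto
      then show "sum_list (map V2 bs) \<le> rk_sup V3 a - V1 a"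
        using rk_upper[OF W3 VW3 bs] sum3[OF bs(1)] by simp
    qed
    then show ?thesis by simp
  qed
  have "rk_sup V1 x \<le> rk_sup V3 x - rk_sup V2 x"
  proof (rule rk_least[OF W(1) VW(1) x])
    fix as assume as: "nonneg_list as" "sum_list as = x"
    have "sum_list (map V1 as) + sum_list (map (rk_sup V2) as) \<le> sum_list (map (rk_sup V3) as)"
      using as(1)
    proof (induction as)
      case (Cons a as)
      then show ?case using pt[of a] by simp
    qed simp
    then show "sum_list (map V1 as) \<le> rk_sup V3 x - rk_sup V2 x"
      using cone_additive_sum_list[OF rk_add[OF W(2) VW(2) V(2)] as(1)]
        cone_additive_sum_list[OF rk_add[OF W3 VW3 sub3] as(1)] as(2) by simp
  qed
  then show "rk_sup V1 x + rk_sup V2 x \<le> rk_sup V3 x" by simp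
qed

section \<open>Least separately additive majorants\<close>

fun sep_additive :: "nat \<Rightarrow> ('a::banach_lattice list \<Rightarrow> 'g::banach_lattice \<Rightarrow> real) \<Rightarrow> bool" where
  "sep_additive 0 U \<longleftrightarrow> cone_additive (U [])"
| "sep_additive (Suc n) U \<longleftrightarrow> (\<forall>x\<ge>0. sep_additive n (\<lambda>xs. U (x # xs)))
     \<and> (\<forall>xs g. length xs = n \<and> nonneg_list xs \<and> 0 \<le> g \<longrightarrow> cone_additive (\<lambda>x. U (x # xs) g))"

fun sep_subadditive :: "nat \<Rightarrow> ('a::banach_lattice list \<Rightarrow> 'g::banach_lattice \<Rightarrow> real) \<Rightarrow> bool" where
  "sep_subadditive 0 U \<longleftrightarrow> cone_subadditive (U [])"
| "sep_subadditive (Suc n) U \<longleftrightarrow> (\<forall>x\<ge>0. sep_subadditive n (\<lambda>xs. U (x # xs)))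
     \<and> (\<forall>xs g. length xs = n \<and> nonneg_list xs \<and> 0 \<le> g \<longrightarrow> cone_subadditive (\<lambda>x. U (x # xs) g))"

definition cone_le :: "nat \<Rightarrow> ('a::banach_lattice list \<Rightarrow> 'g::banach_lattice \<Rightarrow> real) \<Rightarrow>
    ('a list \<Rightarrow> 'g \<Rightarrow> real) \<Rightarrow> bool" where
  "cone_le n U W \<longleftrightarrow> (\<forall>xs g. length xs = n \<and> nonneg_list xs \<and> 0 \<le> g \<longrightarrow> U xs g \<le> W xs g)"

lemma cone_leD: "cone_le n U W \<Longrightarrow> length xs = n \<Longrightarrow> nonneg_list xs \<Longrightarrow> 0 \<le> g \<Longrightarrow> U xs g \<le> W xs g"
  by (simp add: cone_le_def)

lemma cone_le_plug: "cone_le (Suc n) U W \<Longrightarrow> 0 \<le> x \<Longrightarrow> cone_le n (\<lambda>xs. U (x # xs)) (\<lambda>xs. W (x # xs))"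
  by (simp add: cone_le_def)

lemma sep_additive_add:
  "sep_additive n U \<Longrightarrow> sep_additive n W \<Longrightarrow> sep_additive n (\<lambda>xs g. U xs g + W xs g)"
proof (induction n arbitrary: U W)
  case 0
  then show ?case by (simp add: cone_additive_sum)
next
  case (Suc n)
  from Suc.prems show ?case by (auto intro!: Suc.IH cone_additive_sum)
qed

lemma sep_additive_param:
  "sep_additive n U \<Longrightarrow> length xs = n \<Longrightarrow> nonneg_list xs \<Longrightarrow> cone_additive (U xs)"
proof (induction n arbitrary: U xs)
  case (Suc n)
  then obtain y ys where xs: "xs = y # ys" by (cases xs) auto
  show ?case using Suc.IH[of "\<lambda>xs. U (y # xs)" ys] Suc.prems by (simp add: xs)
qed simp

text \<open>Taking the supremum in the variable \<open>a\<close> must not destroy additivity in the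
  others; \<open>rk_param\<close> guarantees this. The additive majorants \<open>w\<close> keep the
  suprema finite.\<close>

lemma sep_additive_rk:
  assumes "\<And>a. 0 \<le> a \<Longrightarrow> sep_additive n (u a)"
    and "\<And>xs g. length xs = n \<Longrightarrow> nonneg_list xs \<Longrightarrow> 0 \<le> g \<Longrightarrow> cone_subadditive (\<lambda>a. u a xs g)"
    and "\<And>xs g. length xs = n \<Longrightarrow> nonneg_list xs \<Longrightarrow> 0 \<le> g \<Longrightarrow> cone_additive (\<lambda>a. w a xs g)"
    and "\<And>a. 0 \<le> a \<Longrightarrow> cone_le n (u a) (w a)"
    and x: "0 \<le> x"
  shows "sep_additive n (\<lambda>xs g. rk_sup (\<lambda>a. u a xs g) x)"
  using assms(1-4)
proof (induction n arbitrary: u w)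
  case 0
  show ?case unfolding sep_additive.simps cone_additive_def
  proof (intro allI impI)
    fix g h :: 'c assume gh: "0 \<le> g" "0 \<le> h"
    show "rk_sup (\<lambda>a. u a [] (g + h)) x =
        rk_sup (\<lambda>a. u a [] g) x + rk_sup (\<lambda>a. u a [] h) x"
      by (rule rk_param[where ?W1.0 = "\<lambda>a. w a [] g" and ?W2.0 = "\<lambda>a. w a [] h"])
         (use 0 gh x in \<open>auto simp: cone_additive_def cone_le_def\<close>)
  qed
next
  case (Suc n)
  show ?case unfolding sep_additive.simps
  proof (intro conjI allI impI)
    fix z :: 'b assume z: "0 \<le> z"
    show "sep_additive n (\<lambda>xs g. rk_sup (\<lambda>a. u a (z # xs) g) x)"
      by (rule Suc.IH[of "\<lambda>a xs. u a (z # xs)" "\<lambda>a xs. w a (z # xs)"])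
         (use Suc.prems z in \<open>auto intro: cone_le_plug\<close>)
  next
    fix xs :: "'b list" and g :: 'c assume xs: "length xs = n \<and> nonneg_list xs \<and> 0 \<le> g"
    show "cone_additive (\<lambda>z. rk_sup (\<lambda>a. u a (z # xs) g) x)"
      unfolding cone_additive_def
    proof (intro allI impI)
      fix y z :: 'b assume yz: "0 \<le> y" "0 \<le> z"
      have "u a ((y + z) # xs) g = u a (y # xs) g + u a (z # xs) g" if "0 \<le> a" for a
        using Suc.prems(1)[OF that] xs yz by (simp add: cone_additive_def)
      then show "rk_sup (\<lambda>a. u a ((y + z) # xs) g) x =
          rk_sup (\<lambda>a. u a (y # xs) g) x + rk_sup (\<lambda>a. u a (z # xs) g) x"
        by (intro rk_param[where ?W1.0 = "\<lambda>a. w a (y # xs) g" and ?W2.0 = "\<lambda>a. w a (z # xs) g"])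
           (use Suc.prems(2-4) xs yz x in \<open>auto simp: cone_le_def\<close>)
    qed
  qed
qed

text \<open>A Riesz-Kantorovich formula one variable at a time: for fixed first argument
  \<open>a\<close> the induction gives a least majorant \<open>u a\<close>, and
  \<open>rk_sup\<close> then makes the dependence on \<open>a\<close> additive. In degree 0 only the
  variable of G is left.\<close>

lemma minimal_majorant:
  fixes V W :: "'a::banach_lattice list \<Rightarrow> 'g::banach_lattice \<Rightarrow> real"
  assumes "sep_subadditive n V" "sep_additive n W" "cone_le n V W"
  shows "\<exists>U. sep_additive n U \<and> cone_le n V U \<and> (\<forall>W. sep_additive n W \<and> cone_le n V W \<longrightarrow> cone_le n U W)"
  using assms
proof (induction n arbitrary: V W)
  case 0
  define U where "U xs g = rk_sup (V []) g" for xs :: "'a list" and g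
  have "cone_le 0 U W'" if "sep_additive 0 W'" "cone_le 0 V W'" for W'
    using rk_le[of "W' []" "V []"] that by (auto simp: U_def cone_le_def)
  moreover have "sep_additive 0 U" "cone_le 0 V U"
    using rk_add[of "W []" "V []"] rk_ge[of "W []" "V []"] 0 by (auto simp: U_def[abs_def] cone_le_def)
  ultimately show ?case by blast
next
  case (Suc n)
  have ex: "\<exists>U. sep_additive n U \<and> cone_le n (\<lambda>xs. V (a # xs)) U
      \<and> (\<forall>W. sep_additive n W \<and> cone_le n (\<lambda>xs. V (a # xs)) W \<longrightarrow> cone_le n U W)" if "0 \<le> a" for a
    using Suc.IH[of "\<lambda>xs. V (a # xs)" "\<lambda>xs. W (a # xs)"] Suc.prems that cone_le_plug[OF Suc.prems(3) that] by auto
  then obtain u where u: "\<And>a. 0 \<le> a \<Longrightarrow> sep_additive n (u a)"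
      "\<And>a. 0 \<le> a \<Longrightarrow> cone_le n (\<lambda>xs. V (a # xs)) (u a)"
      "\<And>a W. 0 \<le> a \<Longrightarrow> sep_additive n W \<Longrightarrow> cone_le n (\<lambda>xs. V (a # xs)) W \<Longrightarrow> cone_le n (u a) W"
    by metis
  have sub: "cone_subadditive (\<lambda>a. u a xs g)" if xs: "length xs = n" "nonneg_list xs" "0 \<le> g" for xs g
    unfolding cone_subadditive_def
  proof (intro allI impI)
    fix a b :: 'a assume ab: "0 \<le> a" "0 \<le> b"
    \<comment> \<open>The sum of \<open>u a\<close> and \<open>u b\<close> majorises
      \<open>V\<close> at \<open>a + b\<close>, so minimality of \<open>u (a + b)\<close> is what
      gives subadditivity in the first argument.\<close>
    have "cone_le n (u (a + b)) (\<lambda>xs g. u a xs g + u b xs g)"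
    proof (rule u(3))
      show "sep_additive n (\<lambda>xs g. u a xs g + u b xs g)" by (intro sep_additive_add u ab)
      show "cone_le n (\<lambda>xs. V ((a + b) # xs)) (\<lambda>xs g. u a xs g + u b xs g)"
        unfolding cone_le_def
      proof (intro allI impI)
        fix xs :: "'a list" and g :: 'g assume xs: "length xs = n \<and> nonneg_list xs \<and> 0 \<le> g"
        have "V ((a + b) # xs) g \<le> V (a # xs) g + V (b # xs) g"
          using Suc.prems(1) xs ab by (simp add: cone_subadditive_def)
        moreover have "V (a # xs) g \<le> u a xs g" "V (b # xs) g \<le> u b xs g"
          using u(2) ab xs by (auto dest: cone_leD)
        ultimately show "V ((a + b) # xs) g \<le> u a xs g + u b xs g" by simp
      qed
    qed (use ab in simp)
    then show "u (a + b) xs g \<le> u a xs g + u b xs g" using xs by (rule cone_leD)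
  qed
  have le: "cone_le n (u a) (\<lambda>xs. W' (a # xs))" if "sep_additive (Suc n) W'" "cone_le (Suc n) V W'" "0 \<le> a" for W' a
    using that by (intro u(3) cone_le_plug) auto
  define U where "U xs g = rk_sup (\<lambda>a. u a (tl xs) g) (hd xs)" for xs g
  have add: "cone_additive (\<lambda>a. W' (a # xs) g)"
    if "sep_additive (Suc n) W'" "length xs = n" "nonneg_list xs" "0 \<le> g" for W' :: "'a list \<Rightarrow> 'g \<Rightarrow> real" and xs g
    using that by simp
  have "sep_additive (Suc n) U" unfolding sep_additive.simps
  proof (intro conjI allI impI)
    fix x :: 'a assume x: "0 \<le> x"
    have "sep_additive n (\<lambda>xs g. rk_sup (\<lambda>a. u a xs g) x)"
      by (rule sep_additive_rk[where w = "\<lambda>a xs. W (a # xs)"])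
         (use u(1) sub add[OF Suc.prems(2)] le[OF Suc.prems(2,3)] x in auto)
    then show "sep_additive n (\<lambda>xs. U (x # xs))" by (simp add: U_def[abs_def])
  next
    fix xs :: "'a list" and g :: 'g assume xs: "length xs = n \<and> nonneg_list xs \<and> 0 \<le> g"
    have "cone_additive (rk_sup (\<lambda>a. u a xs g))"
      by (rule rk_add[OF add[OF Suc.prems(2)], of xs g])
         (use xs sub le[OF Suc.prems(2,3)] in \<open>auto dest: cone_leD\<close>)
    then show "cone_additive (\<lambda>x. U (x # xs) g)" by (simp add: U_def)
  qed
  moreover have "cone_le (Suc n) V U" unfolding cone_le_def
  proof (intro allI impI)
    fix zs :: "'a list" and g :: 'g assume zs: "length zs = Suc n \<and> nonneg_list zs \<and> 0 \<le> g"
    then obtain x xs where z: "zs = x # xs" by (cases zs) auto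
    have "V zs g \<le> u x xs g" using u(2)[of x] zs by (auto simp: z dest: cone_leD)
    also have "\<dots> \<le> rk_sup (\<lambda>a. u a xs g) x"
      by (rule rk_ge[OF add[OF Suc.prems(2)], of xs g])
         (use z zs le[OF Suc.prems(2,3)] in \<open>auto dest: cone_leD\<close>)
    finally show "V zs g \<le> U zs g" by (simp add: U_def z)
  qed
  moreover have "cone_le (Suc n) U W'" if W': "sep_additive (Suc n) W'" "cone_le (Suc n) V W'" for W'
    unfolding cone_le_def
  proof (intro allI impI)
    fix zs :: "'a list" and g :: 'g assume zs: "length zs = Suc n \<and> nonneg_list zs \<and> 0 \<le> g"
    then obtain x xs where z: "zs = x # xs" by (cases zs) auto
    have "rk_sup (\<lambda>a. u a xs g) x \<le> W' (x # xs) g"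
      by (rule rk_le[OF add[OF W'(1)], of xs g])
         (use z zs le[OF W'] in \<open>auto dest: cone_leD\<close>)
    then show "U zs g \<le> W' zs g" by (simp add: U_def z)
  qed
  ultimately show ?case by blast
qed

section \<open>Adjacent swaps and extension from the cone\<close>

fun swap_at :: "nat \<Rightarrow> 'a list \<Rightarrow> 'a list" where
  "swap_at 0 (a # b # xs) = b # a # xs"
| "swap_at (Suc k) (a # xs) = a # swap_at k xs"
| "swap_at _ xs = xs"

lemma swap_at_swap_at [simp]: "swap_at k (swap_at k xs) = xs"
  by (induction k xs rule: swap_at.induct) auto

lemma mset_swap_at [simp]: "mset (swap_at k xs) = mset xs"
  by (induction k xs rule: swap_at.induct) auto

lemma set_swap_at [simp]: "set (swap_at k xs) = set xs"
  by (metis mset_swap_at set_mset_mset)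

lemma length_swap_at [simp]: "length (swap_at k xs) = length xs"
  by (metis mset_swap_at size_mset)

lemma swap_at_append: "swap_at (length as) (as @ a # b # bs) = as @ b # a # bs"
  by (induction as) auto

lemma sep_additive_swap:
  "sep_additive n U \<Longrightarrow> sep_additive n (\<lambda>xs. U (swap_at k xs))"
proof (induction k arbitrary: n U)
  case 0
  show ?case
  proof (cases n)
    case 0
    then show ?thesis using \<open>sep_additive n U\<close> by simp
  next
    case (Suc m)
    show ?thesis
    proof (cases m)
      case 0
      then show ?thesis using \<open>sep_additive n U\<close> Suc by simp
    next
      case (Suc l)
      show ?thesis using \<open>sep_additive n U\<close>
        unfolding \<open>n = Suc m\<close> \<open>m = Suc l\<close> by (auto simp: length_Suc_conv)
    qed
  qed
next
  case (Suc k)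
  then show ?case by (cases n) (auto intro!: Suc.IH)
qed

text \<open>The extension forced by multilinearity, each argument being split into positive and
  negative part. The target is any vector space, since both scalar maps and maps into a dual are
  extended.\<close>

fun cone_ext :: "('a::banach_lattice list \<Rightarrow> 'v::real_vector) \<Rightarrow> 'a list \<Rightarrow> 'v" where
  "cone_ext U [] = U []"
| "cone_ext U (x # xs) = cone_ext (\<lambda>zs. U (pprt x # zs)) xs - cone_ext (\<lambda>zs. U (pprt (- x) # zs)) xs"

lemma cone_ext_cong:
  "(\<And>zs. length zs = length xs \<Longrightarrow> nonneg_list zs \<Longrightarrow> U zs = W zs) \<Longrightarrow> cone_ext U xs = cone_ext W xs"
proof (induction xs arbitrary: U W)
  case (Cons x xs)
  have "cone_ext (\<lambda>zs. U (z # zs)) xs = cone_ext (\<lambda>zs. W (z # zs)) xs" if "0 \<le> z" for z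
    by (rule Cons.IH) (use Cons.prems that in auto)
  then show ?case by simp
qed simp

lemma cone_ext_comb:
  "cone_ext (\<lambda>zs. a *\<^sub>R U zs + b *\<^sub>R W zs) xs = a *\<^sub>R cone_ext U xs + b *\<^sub>R cone_ext W xs"
  by (induction xs arbitrary: U W) (auto simp: algebra_simps)

lemma cone_ext_add: "cone_ext (\<lambda>zs. U zs + W zs) xs = cone_ext U xs + cone_ext W xs"
  using cone_ext_comb[of 1 U 1 W xs] by simp

lemma cone_ext_zero: "cone_ext (\<lambda>zs. 0) xs = 0"
  using cone_ext_comb[of 0 "\<lambda>_. 0" 0 "\<lambda>_. 0" xs] by simp

lemma cone_ext_apply: "blinfun_apply (cone_ext U xs) g = cone_ext (\<lambda>zs. blinfun_apply (U zs) g) xs"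
  by (induction xs arbitrary: U) (auto simp: blinfun.diff_left)

lemma cone_ext_swap:
  assumes "\<And>xs ys. nonneg_list xs \<Longrightarrow> mset xs = mset ys \<Longrightarrow> U xs = U ys"
  shows "cone_ext U (as @ a # b # bs) = cone_ext U (as @ b # a # bs)"
  using assms
proof (induction as arbitrary: U)
  case Nil
  have "cone_ext (\<lambda>zs. U (p # q # zs)) bs = cone_ext (\<lambda>zs. U (q # p # zs)) bs" if "0 \<le> p" "0 \<le> q" for p q
    by (rule cone_ext_cong) (use that in \<open>auto intro!: Nil\<close>)
  then show ?case by simp
next
  case (Cons x as)
  have "cone_ext (\<lambda>zs. U (z # zs)) (as @ a # b # bs) = cone_ext (\<lambda>zs. U (z # zs)) (as @ b # a # bs)" if "0 \<le> z" for z
    by (rule Cons.IH) (use that in \<open>auto intro!: Cons.prems\<close>)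
  then show ?case by simp
qed

text \<open>For nonnegative arguments the negative parts are 0, and additivity makes the terms
  containing a zero argument vanish.\<close>

lemma cone_ext_eq:
  fixes U :: "'a::banach_lattice list \<Rightarrow> real"
  assumes "\<And>xs ys. nonneg_list xs \<Longrightarrow> mset xs = mset ys \<Longrightarrow> U xs = U ys"
    and "\<And>xs. nonneg_list xs \<Longrightarrow> cone_additive (\<lambda>x. U (x # xs))" and "nonneg_list xs"
  shows "cone_ext U xs = U xs"
  using assms
proof (induction xs arbitrary: U)
  case Nil
  show ?case by simp
next
  case (Cons x xs)
  have x: "0 \<le> x" using Cons.prems(3) by simp
  have zero: "U (0 # zs) = 0" if "nonneg_list zs" for zs
    using Cons.prems(2)[OF that] unfolding cone_additive_def
    by (metis add.right_neutral add_cancel_right_left order_refl)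
  have "cone_ext (\<lambda>zs. U (0 # zs)) xs = 0"
    using cone_ext_cong[of xs "\<lambda>zs. U (0 # zs)" "\<lambda>_. 0"] zero by (simp add: cone_ext_zero)
  moreover have "cone_ext (\<lambda>zs. U (x # zs)) xs = U (x # xs)"
  proof (rule Cons.IH)
    fix zs :: "'a list" assume zs: "nonneg_list zs"
    have "U (x # y # zs) = U (y # x # zs)" if "0 \<le> y" for y
      by (rule Cons.prems(1)) (use x zs that in auto)
    then show "cone_additive (\<lambda>y. U (x # y # zs))"
      using Cons.prems(2)[of "x # zs"] x zs by (simp add: cone_additive_def)
  qed (use Cons.prems(3) x in \<open>auto intro!: Cons.prems(1)\<close>)
  ultimately show ?case using x by simp
qed

lemma vform_plug: "vform n T \<Longrightarrow> vform (n - 1) (\<lambda>xs. T (x # xs))"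
  using sym_form_plug[of n "\<lambda>xs. blinfun_apply (T xs) g" x for g] by (simp add: vform_def)

lemma vform_sep_additive:
  "vform n T \<Longrightarrow> sep_additive n (\<lambda>xs. blinfun_apply (T xs))"
proof (induction n arbitrary: T)
  case 0
  show ?case by (simp add: cone_additive_def blinfun.add_right)
next
  case (Suc n)
  have lin: "linear (\<lambda>x. blinfun_apply (T (x # xs)) g)" for xs g
    using sym_formD(3)[of "Suc n" "\<lambda>xs. blinfun_apply (T xs) g" xs] Suc.prems by (simp add: vform_def)
  have "blinfun_apply (T ((x + y) # xs)) g = blinfun_apply (T (x # xs)) g + blinfun_apply (T (y # xs)) g" for x y xs g
    by (rule linear_add[OF lin])
  then show ?case using Suc.IH[OF vform_plug[OF Suc.prems, simplified]]
    by (simp add: cone_additive_def)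
qed

lemma vform_sep_subadditive:
  "vform n T \<Longrightarrow> sep_subadditive n (\<lambda>xs g. \<bar>blinfun_apply (T xs) g\<bar>)"
proof (induction n arbitrary: T)
  case 0
  show ?case by (simp add: cone_subadditive_def blinfun.add_right abs_triangle_ineq)
next
  case (Suc n)
  have lin: "linear (\<lambda>x. blinfun_apply (T (x # xs)) g)" for xs g
    using sym_formD(3)[of "Suc n" "\<lambda>xs. blinfun_apply (T xs) g" xs] Suc.prems by (simp add: vform_def)
  have "blinfun_apply (T ((x + y) # xs)) g = blinfun_apply (T (x # xs)) g + blinfun_apply (T (y # xs)) g" for x y xs g
    by (rule linear_add[OF lin])
  then show ?case using Suc.IH[OF vform_plug[OF Suc.prems, simplified]]
    by (simp add: cone_subadditive_def abs_triangle_ineq)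
qed

lemma cone_ext_sym_form:
  fixes U :: "'a::banach_lattice list \<Rightarrow> real"
  assumes perm: "\<And>xs ys. nonneg_list xs \<Longrightarrow> mset xs = mset ys \<Longrightarrow> U xs = U ys"
    and len: "\<And>xs. length xs \<noteq> n \<Longrightarrow> U xs = 0"
    and pos: "\<And>xs. nonneg_list xs \<Longrightarrow> 0 \<le> U xs"
    and add: "\<And>xs. nonneg_list xs \<Longrightarrow> cone_additive (\<lambda>x. U (x # xs))"
  shows "sym_form n (cone_ext U)"
proof -
  show ?thesis
  proof (rule sym_formI)
    show "cone_ext U xs = 0" if "length xs \<noteq> n" for xs
      using cone_ext_cong[of xs U "\<lambda>_. 0"] len that by (simp add: cone_ext_zero)
    show "cone_ext U xs = cone_ext U ys" if "mset xs = mset ys" for xs ys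
      by (rule swap_invariant_mset[of "cone_ext U", OF _ that]) (rule cone_ext_swap, rule perm)
    show "linear (\<lambda>x. cone_ext U (x # xs))" for xs
      unfolding cone_ext.simps
    proof (rule cone_additive_extension)
      fix x y :: 'a assume xy: "0 \<le> x" "0 \<le> y"
      show "cone_ext (\<lambda>zs. U ((x + y) # zs)) xs = cone_ext (\<lambda>zs. U (x # zs)) xs + cone_ext (\<lambda>zs. U (y # zs)) xs"
        unfolding cone_ext_add[symmetric]
        by (rule cone_ext_cong) (use add xy in \<open>auto simp: cone_additive_def\<close>)
    next
      fix t :: real and x :: 'a assume tx: "0 \<le> t" "0 \<le> x"
      \<comment> \<open>The zero summand only gives the expression the shape required by
        \<open>cone_ext_comb\<close>.\<close>
      have "cone_ext (\<lambda>zs. U ((t *\<^sub>R x) # zs)) xs = cone_ext (\<lambda>zs. t *\<^sub>R U (x # zs) + 0 *\<^sub>R U (x # zs)) xs"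
      proof (rule cone_ext_cong)
        fix zs :: "'a list" assume zs: "nonneg_list zs"
        show "U ((t *\<^sub>R x) # zs) = t *\<^sub>R U (x # zs) + 0 *\<^sub>R U (x # zs)"
          using cone_additive_homogeneous[of "\<lambda>x. U (x # zs)" x t] add[OF zs] pos[of "_ # zs"] zs tx
          by (simp add: cone_additive_def)
      qed
      then show "cone_ext (\<lambda>zs. U ((t *\<^sub>R x) # zs)) xs = t * cone_ext (\<lambda>zs. U (x # zs)) xs"
        unfolding cone_ext_comb by simp
    qed
  qed
qed

text \<open>The least separately additive majorant of the absolute values is symmetric by
  minimality: after a swap of two arguments it is still a majorant. It is then extended from the
  cone in every variable, that of G included.\<close>

lemma modulus_form_exists:
  fixes T T1 T2 :: "'a::banach_lattice list \<Rightarrow> ('g::banach_lattice \<Rightarrow>\<^sub>L real)"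
  assumes T1: "pos_vform n T1" and T2: "pos_vform n T2" and T: "T = (\<lambda>xs. T1 xs - T2 xs)"
  obtains U where "pos_vform n U"
    "\<And>xs g. nonneg_list xs \<Longrightarrow> 0 \<le> g \<Longrightarrow> \<bar>blinfun_apply (T xs) g\<bar> \<le> blinfun_apply (U xs) g"
    "\<And>W xs g. pos_vform n W \<Longrightarrow>
      (\<And>xs g. nonneg_list xs \<Longrightarrow> 0 \<le> g \<Longrightarrow> \<bar>blinfun_apply (T xs) g\<bar> \<le> blinfun_apply (W xs) g) \<Longrightarrow>
      nonneg_list xs \<Longrightarrow> 0 \<le> g \<Longrightarrow> blinfun_apply (U xs) g \<le> blinfun_apply (W xs) g"
proof -
  have vT: "vform n T"
    using vform_comb[OF pos_vformD[OF T1] pos_vformD[OF T2], of 1 "- 1"] by (simp add: T)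
  define V where "V xs g = \<bar>blinfun_apply (T xs) g\<bar>" for xs g
  have VT: "sep_subadditive n V" unfolding V_def[abs_def] by (rule vform_sep_subadditive[OF vT])
  have add: "sep_additive n (\<lambda>xs. blinfun_apply (W xs))" if "pos_vform n W" for W :: "'a list \<Rightarrow> ('g \<Rightarrow>\<^sub>L real)"
    by (rule vform_sep_additive[OF pos_vformD[OF that]])
  have nn: "0 \<le> blinfun_apply (W xs) g" if "pos_vform n W" "nonneg_list xs" "0 \<le> g" for W xs g
    using that pos_formD(2) by (force simp: pos_vform_def)
  have "cone_le n V (\<lambda>xs g. blinfun_apply (T1 xs) g + blinfun_apply (T2 xs) g)"
    unfolding cone_le_def V_def T using nn[OF T1] nn[OF T2] by (fastforce simp: blinfun.diff_left)
  then obtain U where U: "sep_additive n U" "cone_le n V U"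
      "\<And>W. sep_additive n W \<Longrightarrow> cone_le n V W \<Longrightarrow> cone_le n U W"
    using minimal_majorant[OF VT sep_additive_add[OF add[OF T1] add[OF T2]]] by blast
  have Upos: "0 \<le> U xs g" if "length xs = n" "nonneg_list xs" "0 \<le> g" for xs g
    using cone_leD[OF U(2) that] by (simp add: V_def)
  have Uswap: "U xs g = U (swap_at k xs) g" if xs: "length xs = n" "nonneg_list xs" "0 \<le> g" for xs g k
  proof -
    have "cone_le n V (\<lambda>xs. U (swap_at k xs))" unfolding cone_le_def
    proof (intro allI impI)
      fix xs :: "'a list" and g :: 'g assume xs: "length xs = n \<and> nonneg_list xs \<and> 0 \<le> g"
      have "T xs = T (swap_at k xs)"
        using vform_multilinear(2)[OF vT, unfolded symmetric_ml_def, rule_format, of xs "swap_at k xs"] xs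
        by simp
      then have "V xs g = V (swap_at k xs) g" by (simp add: V_def)
      also have "\<dots> \<le> U (swap_at k xs) g" by (rule cone_leD[OF U(2)]) (use xs in auto)
      finally show "V xs g \<le> U (swap_at k xs) g" .
    qed
    then have le: "cone_le n U (\<lambda>xs. U (swap_at k xs))" by (intro U(3) sep_additive_swap U(1))
    show ?thesis using cone_leD[OF le xs] cone_leD[OF le, of "swap_at k xs" g] xs by simp
  qed
  \<comment> \<open>Setting the value to 0 outside nonnegative lists of length \<open>n\<close>
    makes invariance under permutations hold for all lists.\<close>
  define u where "u xs g = (if length xs = n \<and> nonneg_list xs then U xs g else 0)" for xs g
  have uperm: "u xs g = u ys g" if "mset xs = mset ys" "0 \<le> g" for xs ys g
  proof (rule swap_invariant_mset[of "\<lambda>xs. u xs g", OF _ that(1)])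
    fix as a b bs
    show "u (as @ a # b # bs) g = u (as @ b # a # bs) g"
      using Uswap[of "as @ a # b # bs" g "length as"] that(2) by (auto simp: u_def swap_at_append)
  qed
  have uadd: "cone_additive (\<lambda>x. u (x # xs) g)" if xs: "nonneg_list xs" "0 \<le> g" for xs g
  proof (cases n)
    case 0
    then show ?thesis by (simp add: u_def cone_additive_def)
  next
    case (Suc m)
    then show ?thesis using U(1) xs by (auto simp: u_def cone_additive_def)
  qed
  have "\<exists>\<phi>::'g \<Rightarrow>\<^sub>L real. \<forall>g\<ge>0. blinfun_apply \<phi> g = u xs g" for xs
  proof (cases "length xs = n \<and> nonneg_list xs")
    case True
    then show ?thesis using positive_extension[of "U xs"] sep_additive_param[OF U(1), of xs] Upos[of xs]
      by (metis cone_additive_def u_def)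
  next
    case False
    then show ?thesis by (intro exI[of _ 0]) (auto simp: u_def)
  qed
  then obtain B :: "'a list \<Rightarrow> ('g \<Rightarrow>\<^sub>L real)" where B: "\<And>xs g. 0 \<le> g \<Longrightarrow> blinfun_apply (B xs) g = u xs g" by metis
  define R where "R = cone_ext B"
  have Rg: "(\<lambda>xs. blinfun_apply (R xs) g) = cone_ext (\<lambda>zs. u zs g)" if "0 \<le> g" for g
    unfolding R_def cone_ext_apply B[OF that] ..
  have upos: "0 \<le> u xs g" if "0 \<le> g" for xs g using Upos that by (simp add: u_def)
  have sf: "sym_form n (cone_ext (\<lambda>zs. u zs g))" if "0 \<le> g" for g
    by (rule cone_ext_sym_form)
       (erule uperm[OF _ that], simp add: u_def, rule upos[OF that], erule uadd[OF _ that])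
  have Req: "blinfun_apply (R xs) g = u xs g" if "nonneg_list xs" "0 \<le> g" for xs g
  proof -
    have "cone_ext (\<lambda>zs. u zs g) xs = u xs g"
      by (rule cone_ext_eq) (erule uperm[OF _ that(2)], erule uadd[OF _ that(2)], rule that(1))
    then show ?thesis using fun_cong[OF Rg[OF that(2)], of xs] by simp
  qed
  have "pos_vform n R"
    unfolding pos_vform_def pos_form_def using Rg sf Req upos by simp
  moreover have "\<bar>blinfun_apply (T xs) g\<bar> \<le> blinfun_apply (R xs) g" if "nonneg_list xs" "0 \<le> g" for xs g
  proof (cases "length xs = n")
    case True
    then show ?thesis using cone_leD[OF U(2) True that] that by (simp add: Req V_def u_def)
  next
    case False
    then show ?thesis using sym_formD(1)[of n "\<lambda>xs. blinfun_apply (T xs) g" xs] vT that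
      by (simp add: vform_def Req upos)
  qed
  moreover have "blinfun_apply (R xs) g \<le> blinfun_apply (W xs) g"
    if W: "pos_vform n W" "\<And>xs g. nonneg_list xs \<Longrightarrow> 0 \<le> g \<Longrightarrow> \<bar>blinfun_apply (T xs) g\<bar> \<le> blinfun_apply (W xs) g"
      and xs: "nonneg_list xs" "0 \<le> g" for W xs g
  proof (cases "length xs = n")
    case True
    have "cone_le n U (\<lambda>xs. blinfun_apply (W xs))"
      by (rule U(3)) (use W add in \<open>auto simp: cone_le_def V_def\<close>)
    from cone_leD[OF this True xs] show ?thesis using True xs by (simp add: Req u_def)
  next
    case False
    then show ?thesis using nn[OF W(1) xs] xs by (simp add: Req u_def)
  qed
  ultimately show ?thesis by (rule that)
qed

text \<open>A polynomial lies above both \<open>P\<close> and its negative exactly when its form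
  majorises the absolute value of the form of \<open>P\<close>, so the least majorant gives the
  supremum. Antisymmetry of \<open>poly_le\<close> makes it unique, as \<open>poly_abs\<close>
  demands.\<close>

lemma poly_abs_eq:
  fixes P :: "'a::banach_lattice \<Rightarrow> ('b::banach_lattice \<Rightarrow>\<^sub>L real)"
  assumes n: "n \<ge> 1" and T1: "pos_vform n T1" and T2: "pos_vform n T2"
    and P: "P = (\<lambda>x. poly_of n T1 x - poly_of n T2 x)"
  obtains U where "pos_vform n U" "poly_abs n P = poly_of n U"
    "is_sup_in (regular_polys n) (poly_le n) P (\<lambda>x. - P x) (poly_of n U)"
proof -
  define T where "T = (\<lambda>xs. T1 xs - T2 xs)"
  have vT: "vform n T"
    using vform_comb[OF pos_vformD[OF T1] pos_vformD[OF T2], of 1 "- 1"] by (simp add: T_def)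
  have PT: "P = poly_of n T" by (simp add: P T_def poly_of_def)
  obtain U where U: "pos_vform n U"
    "\<And>xs g. nonneg_list xs \<Longrightarrow> 0 \<le> g \<Longrightarrow> \<bar>blinfun_apply (T xs) g\<bar> \<le> blinfun_apply (U xs) g"
    "\<And>W xs g. pos_vform n W \<Longrightarrow>
      (\<And>xs g. nonneg_list xs \<Longrightarrow> 0 \<le> g \<Longrightarrow> \<bar>blinfun_apply (T xs) g\<bar> \<le> blinfun_apply (W xs) g) \<Longrightarrow>
      nonneg_list xs \<Longrightarrow> 0 \<le> g \<Longrightarrow> blinfun_apply (U xs) g \<le> blinfun_apply (W xs) g"
    using modulus_form_exists[OF T1 T2 T_def] by blast
  have posI: "pos_vform n S" if "vform n S"
    "\<And>xs g. nonneg_list xs \<Longrightarrow> 0 \<le> g \<Longrightarrow> 0 \<le> blinfun_apply (S xs) g" for S :: "'a list \<Rightarrow> ('b \<Rightarrow>\<^sub>L real)"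
    using that by (simp add: pos_vform_def pos_form_def vform_def)
  have posD: "0 \<le> blinfun_apply (S xs) g" if "pos_vform n S" "nonneg_list xs" "0 \<le> g"
    for S :: "'a list \<Rightarrow> ('b \<Rightarrow>\<^sub>L real)" and xs g
    using that pos_formD(2) by (force simp: pos_vform_def)
  note vU = pos_vformD[OF U(1)]
  have sup: "is_sup_in (regular_polys n) (poly_le n) P (\<lambda>x. - P x) (poly_of n U)"
    unfolding is_sup_in_def
  proof (intro conjI ballI impI)
    have "pos_vform n (\<lambda>xs :: 'a list. 0 :: 'b \<Rightarrow>\<^sub>L real)"
      using pos_vform_comb[OF U(1,1), of 0 0] by simp
    then have "positive_poly n (\<lambda>x :: 'a. 0 :: 'b \<Rightarrow>\<^sub>L real)" using n
      by (auto simp: positive_poly_iff poly_of_def)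
    moreover have "positive_poly n (poly_of n U)" using U(1) n by (auto simp: positive_poly_iff)
    ultimately show "poly_of n U \<in> regular_polys n"
      unfolding regular_polys_def by (intro CollectI exI[of _ "poly_of n U"] exI[of _ "\<lambda>x. 0"]) simp
    have "pos_vform n (\<lambda>xs. 1 *\<^sub>R U xs + (- 1) *\<^sub>R T xs)"
      by (rule posI[OF vform_comb[OF vU vT]])
         (use U(2) in \<open>fastforce simp: blinfun.diff_left\<close>)
    then show "poly_le n P (poly_of n U)" unfolding poly_le_def positive_poly_iff[OF n]
      by (intro exI[of _ "\<lambda>xs. U xs - T xs"]) (simp add: PT poly_of_def)
    have "pos_vform n (\<lambda>xs. 1 *\<^sub>R U xs + 1 *\<^sub>R T xs)"
      by (rule posI[OF vform_comb[OF vU vT]])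
         (use U(2) in \<open>fastforce simp: blinfun.add_left\<close>)
    then show "poly_le n (\<lambda>x. - P x) (poly_of n U)" unfolding poly_le_def positive_poly_iff[OF n]
      by (intro exI[of _ "\<lambda>xs. U xs + T xs"]) (simp add: PT poly_of_def)
  next
    fix S assume S: "poly_le n P S \<and> poly_le n (\<lambda>x. - P x) S"
    then obtain A B where A: "pos_vform n A" "(\<lambda>x. S x - P x) = poly_of n A"
      and B: "pos_vform n B" "(\<lambda>x. S x - - P x) = poly_of n B"
      unfolding poly_le_def positive_poly_iff[OF n] by blast
    \<comment> \<open>\<open>A\<close> and \<open>B\<close> represent \<open>S - P\<close> and
      \<open>S + P\<close>, so their mean represents \<open>S\<close>; polarization then gives
      \<open>A = W - T\<close> and \<open>B = W + T\<close>.\<close>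
    define W where "W = (\<lambda>xs. (1/2) *\<^sub>R A xs + (1/2) *\<^sub>R B xs)"
    have W: "pos_vform n W" unfolding W_def by (rule pos_vform_comb[OF A(1) B(1)]) auto
    have SA: "poly_of n A x = S x - P x" and SB: "poly_of n B x = S x + P x" for x
      using fun_cong[OF A(2), of x] fun_cong[OF B(2), of x] by simp_all
    have SW: "S x = poly_of n W x" for x
    proof -
      have "poly_of n W x = (1/2) *\<^sub>R (poly_of n A x + poly_of n B x)"
        by (simp add: W_def poly_of_def scaleR_add_right)
      also have "\<dots> = (1/2) *\<^sub>R (2 *\<^sub>R S x)" by (simp add: SA SB scaleR_2)
      finally show ?thesis by simp
    qed
    have A': "A = (\<lambda>xs. 1 *\<^sub>R W xs + (- 1) *\<^sub>R T xs)"
      by (rule poly_of_inject[OF pos_vformD[OF A(1)] vform_comb[OF pos_vformD[OF W] vT]])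
         (use SA SW PT in \<open>auto simp: poly_of_def\<close>)
    have B': "B = (\<lambda>xs. 1 *\<^sub>R W xs + 1 *\<^sub>R T xs)"
      by (rule poly_of_inject[OF pos_vformD[OF B(1)] vform_comb[OF pos_vformD[OF W] vT]])
         (use SB SW PT in \<open>auto simp: poly_of_def\<close>)
    have "\<bar>blinfun_apply (T xs) g\<bar> \<le> blinfun_apply (W xs) g" if "nonneg_list xs" "0 \<le> g" for xs g
      using posD[OF A(1) that] posD[OF B(1) that] by (simp add: A' B' blinfun.add_left blinfun.diff_left)
    then have "pos_vform n (\<lambda>xs. 1 *\<^sub>R W xs + (- 1) *\<^sub>R U xs)"
      by (intro posI[OF vform_comb[OF pos_vformD[OF W] vU]])
         (use U(3)[OF W] in \<open>simp add: blinfun.diff_left\<close>)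
    then show "poly_le n (poly_of n U) S" unfolding poly_le_def positive_poly_iff[OF n]
      by (intro exI[of _ "\<lambda>xs. W xs - U xs"]) (simp add: SW poly_of_def)
  qed
  \<comment> \<open>Two positive forms that are negatives of each other vanish on the cone, hence
    everywhere by \<open>pos_form_abs_le\<close>.\<close>
  have antisym: "S = S'" if le: "poly_le n S S'" "poly_le n S' S" for S S' :: "'a \<Rightarrow> ('b \<Rightarrow>\<^sub>L real)"
  proof -
    obtain A B where A: "pos_vform n A" "(\<lambda>x. S' x - S x) = poly_of n A"
      and B: "pos_vform n B" "(\<lambda>x. S x - S' x) = poly_of n B"
      using le unfolding poly_le_def positive_poly_iff[OF n] by blast
    have SA: "poly_of n A x = S' x - S x" and SB: "poly_of n B x = S x - S' x" for x
      using fun_cong[OF A(2), of x] fun_cong[OF B(2), of x] by simp_all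
    have AB: "A = (\<lambda>xs. 0 *\<^sub>R A xs + (- 1) *\<^sub>R B xs)"
      by (rule poly_of_inject[OF pos_vformD[OF A(1)] vform_comb[OF pos_vformD[OF A(1)] pos_vformD[OF B(1)]]])
         (use SA SB in \<open>auto simp: poly_of_def\<close>)
    have zero: "blinfun_apply (A xs) g = 0" if "nonneg_list xs" "0 \<le> g" for xs g
      using posD[OF A(1) that] posD[OF B(1) that] arg_cong[OF fun_cong[OF AB, of xs], of "\<lambda>\<phi>. blinfun_apply \<phi> g"]
      by (simp add: blinfun.minus_left)
    have zero': "blinfun_apply (A xs) g = 0" if "0 \<le> g" for xs g
      using pos_form_abs_le[of n "\<lambda>xs. blinfun_apply (A xs) g" xs] A(1) that zero[of "map modulus xs" g]
      by (simp add: pos_vform_def)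
    have "A xs = 0" for xs
    proof (rule blinfun_eqI)
      fix g show "blinfun_apply (A xs) g = blinfun_apply 0 g"
        using blinfun_apply_split[of "A xs" g] by (simp add: zero')
    qed
    then have "S' x - S x = 0" for x using SA[of x] by (simp add: poly_of_def)
    then show ?thesis by (intro ext) (metis eq_iff_diff_eq_0)
  qed
  have "poly_abs n P = poly_of n U" unfolding poly_abs_def
  proof (rule the_equality)
    show "is_sup_in (regular_polys n) (poly_le n) P (\<lambda>x. - P x) (poly_of n U)" by (rule sup)
  next
    fix S assume S: "is_sup_in (regular_polys n) (poly_le n) P (\<lambda>x. - P x) S"
    show "S = poly_of n U" by (rule antisym) (use S sup in \<open>auto simp: is_sup_in_def\<close>)
  qed
  then show ?thesis using that U(1) sup by blast
qed

section \<open>Bounds\<close>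

lemma pos_vform_abs_le:
  assumes T: "pos_vform n T"
  shows "\<bar>blinfun_apply (T xs) g\<bar> \<le> blinfun_apply (T (map modulus xs)) (modulus g)"
proof -
  have "\<bar>blinfun_apply (T xs) h\<bar> \<le> blinfun_apply (T (map modulus xs)) h" if "0 \<le> h" for h
    using pos_form_abs_le[of n "\<lambda>xs. blinfun_apply (T xs) h" xs] T that by (simp add: pos_vform_def)
  from this[OF zero_le_pprt, of g] this[OF zero_le_pprt, of "- g"] show ?thesis
    using blinfun_apply_split[of "T xs" g] unfolding modulus_eq_pprt[of g] blinfun.add_right by linarith
qed

lemma norm_blinfun_le_modulus:
  fixes \<phi> \<psi> :: "'g::banach_lattice \<Rightarrow>\<^sub>L real"
  assumes "\<And>g. \<bar>blinfun_apply \<phi> g\<bar> \<le> blinfun_apply \<psi> (modulus g)"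
  shows "norm \<phi> \<le> norm \<psi>"
proof (rule norm_blinfun_bound)
  fix g
  have "blinfun_apply \<psi> (modulus g) \<le> norm \<psi> * norm g"
    using norm_blinfun[of \<psi> "modulus g"] by simp
  then show "norm (blinfun_apply \<phi> g) \<le> norm \<psi> * norm g" using assms[of g] by simp
qed simp

lemma norm_pos_vform_le:
  assumes "pos_vform n T"
  shows "norm (T xs) \<le> norm (T (map modulus xs))"
  by (rule norm_blinfun_le_modulus) (rule pos_vform_abs_le[OF assms])

lemma norm_pos_vform_mono:
  assumes T: "pos_vform n T" and xs: "nonneg_list xs" and le: "list_all2 (\<le>) xs ys"
  shows "norm (T xs) \<le> norm (T ys)"
proof (rule norm_blinfun_le_modulus)
  fix g
  have "\<bar>blinfun_apply (T xs) g\<bar> \<le> blinfun_apply (T (map modulus xs)) (modulus g)"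
    by (rule pos_vform_abs_le[OF T])
  also have "map modulus xs = xs" using xs by (intro map_idI) (auto intro: modulus_of_nonneg)
  also have "blinfun_apply (T xs) (modulus g) \<le> blinfun_apply (T ys) (modulus g)"
    using pos_form_mono[of n "\<lambda>xs. blinfun_apply (T xs) (modulus g)" xs ys] T xs le
    by (simp add: pos_vform_def)
  finally show "\<bar>blinfun_apply (T xs) g\<bar> \<le> blinfun_apply (T ys) (modulus g)" .
qed

lemma sym_form_scale_replicate:
  assumes "sym_form n M"
  shows "M (replicate k (t *\<^sub>R x) @ R) = t ^ k * M (replicate k x @ R)"
proof (induction k arbitrary: R)
  case (Suc k)
  have "M (replicate (Suc k) (t *\<^sub>R x) @ R) = t * M (x # replicate k (t *\<^sub>R x) @ R)"
    using linear_scale[OF sym_formD(3)[OF assms]] by simp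
  also have "M (x # replicate k (t *\<^sub>R x) @ R) = M (replicate k (t *\<^sub>R x) @ x # R)"
    by (rule sym_formD(2)[OF assms]) simp
  also have "\<dots> = t ^ k * M (replicate k x @ x # R)" by (rule Suc)
  also have "M (replicate k x @ x # R) = M (replicate (Suc k) x @ R)"
    by (rule sym_formD(2)[OF assms]) simp
  finally show ?case by simp
qed simp

lemma poly_of_scale:
  assumes "vform n T"
  shows "T (replicate n (t *\<^sub>R x)) = t ^ n *\<^sub>R T (replicate n x)"
  using sym_form_scale_replicate[of n "\<lambda>xs. blinfun_apply (T xs) g" n t x "[]" for g] assms
  by (intro blinfun_eqI) (simp add: vform_def blinfun.scaleR_left)

text \<open>Makes the supremum in \<open>poly_norm\<close> meaningful: on the cone the norm of the
  value is monotone and homogeneous of degree \<open>n\<close>, so automatic boundedness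
  applies.\<close>

lemma poly_norm_bdd:
  assumes T: "pos_vform n T" and n: "n \<ge> 1"
  shows "bdd_above ((\<lambda>x. norm (poly_of n T x)) ` {x. norm x \<le> 1})"
proof -
  obtain c where c: "c \<ge> 0" "\<And>x. 0 \<le> x \<Longrightarrow> norm (T (replicate n x)) \<le> c * norm x ^ n"
  proof -
    have "\<exists>c\<ge>0. \<forall>x\<ge>0. norm (T (replicate n x)) \<le> c * norm x ^ n"
    proof (rule monotone_homogeneous_bounded[OF _ _ n])
      show "norm (T (replicate n x)) \<le> norm (T (replicate n y))" if "0 \<le> x" "x \<le> y" for x y
        by (rule norm_pos_vform_mono[OF T]) (use that in \<open>auto intro: list_all2_replicateI\<close>)
      show "norm (T (replicate n (t *\<^sub>R x))) = t ^ n * norm (T (replicate n x))" if "0 \<le> t" for t x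
        using that by (simp add: poly_of_scale[OF pos_vformD[OF T]])
    qed
    then show ?thesis using that by blast
  qed
  show ?thesis
  proof (rule bdd_aboveI2)
    fix x :: 'a assume "x \<in> {x. norm x \<le> 1}"
    then have "norm x ^ n \<le> 1" by (simp add: power_le_one)
    have "norm (poly_of n T x) \<le> norm (T (replicate n (modulus x)))"
      using norm_pos_vform_le[OF T, of "replicate n x"] by (simp add: poly_of_def)
    also have "\<dots> \<le> c * norm x ^ n" using c(2)[of "modulus x"] by simp
    also have "\<dots> \<le> c" using c(1) \<open>norm x ^ n \<le> 1\<close> by (simp add: mult_left_le)
    finally show "norm (poly_of n T x) \<le> c" .
  qed
qed

lemma poly_norm_upper:
  assumes "pos_vform n T" "n \<ge> 1" "norm x \<le> 1"
  shows "norm (poly_of n T x) \<le> poly_norm (poly_of n T)"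
  unfolding poly_norm_def by (rule cSUP_upper[OF _ poly_norm_bdd]) (use assms in auto)

lemma poly_norm_le:
  assumes "\<And>x::'a::real_normed_vector. norm x \<le> 1 \<Longrightarrow> norm (P x) \<le> c"
  shows "poly_norm P \<le> c"
  unfolding poly_norm_def by (rule cSUP_least) (use assms in \<open>auto intro: exI[of _ 0]\<close>)

lemma poly_norm_nonneg:
  assumes "pos_vform n T" "n \<ge> 1"
  shows "0 \<le> poly_norm (poly_of n T)"
  by (rule order_trans[OF norm_ge_zero poly_norm_upper[OF assms, of 0]]) simp

lemma prod_list_norm_nonneg: "0 \<le> prod_list (map norm xs)"
  by (induction xs) auto

text \<open>Arguments are normalised one at a time; a zero argument is treated apart because it
  cannot be.\<close>

lemma sym_form_bound_unit_ball:
  assumes "sym_form n M" and "\<And>xs. length xs = n \<Longrightarrow> \<forall>x\<in>set xs. norm x \<le> 1 \<Longrightarrow> \<bar>M xs\<bar> \<le> c"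
    and "length xs = n"
  shows "\<bar>M xs\<bar> \<le> c * prod_list (map norm xs)"
  using assms
proof (induction xs arbitrary: M n)
  case (Cons x xs)
  note lin = sym_formD(3)[OF Cons.prems(1)]
  show ?case
  proof (cases "x = 0")
    case True
    then show ?thesis using linear_0[OF lin] by simp
  next
    case False
    let ?u = "inverse (norm x) *\<^sub>R x"
    have u: "norm ?u = 1" using False by simp
    have "\<bar>M (?u # xs)\<bar> \<le> c * prod_list (map norm xs)"
    proof (rule Cons.IH[OF sym_form_plug[OF Cons.prems(1)]])
      fix zs :: "'a list" assume "length zs = n - 1" "\<forall>x\<in>set zs. norm x \<le> 1"
      then show "\<bar>M (?u # zs)\<bar> \<le> c" using u Cons.prems(3) by (intro Cons.prems(2)) auto
    qed (use Cons.prems(3) in simp)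
    moreover have "M (x # xs) = norm x * M (?u # xs)"
      using linear_scale[OF lin, of "norm x" ?u xs] False by simp
    ultimately show ?thesis
      using mult_left_mono[of "\<bar>M (?u # xs)\<bar>" "c * prod_list (map norm xs)" "norm x"]
      by (simp add: abs_mult mult.left_commute)
  qed
qed simp

text \<open>\<open>n\<close> vectors of the unit ball lie, in modulus, below the sum
  \<open>w\<close> of their moduli, whose norm is at most \<open>n\<close>. Monotonicity reduces to
  the diagonal at \<open>w\<close>, and scaling by \<open>1 / n\<close> produces the constant
  \<open>real n ^ n\<close>.\<close>

lemma pos_vform_bound:
  assumes T: "pos_vform n T" and n: "n \<ge> 1"
  shows "\<bar>blinfun_apply (T xs) g\<bar> \<le> real n ^ n * poly_norm (poly_of n T) * norm g * prod_list (map norm xs)"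
proof -
  let ?C = "poly_norm (poly_of n T)"
  have vf: "vform n T" by (rule pos_vformD[OF T])
  have sf: "sym_form n (\<lambda>xs. blinfun_apply (T xs) g)" using vf by (simp add: vform_def)
  show ?thesis
  proof (cases "length xs = n")
    case True
    show ?thesis
    proof (rule sym_form_bound_unit_ball[OF sf _ True])
      fix xs :: "'a list" assume xs: "length xs = n" "\<forall>x\<in>set xs. norm x \<le> 1"
      define w where "w = sum_list (map modulus xs)"
      have le: "modulus x \<le> w" if "x \<in> set xs" for x
        using that unfolding w_def
      proof (induction xs)
        case (Cons a xs)
        have "0 \<le> sum_list (map modulus xs)" by (rule sum_list_nonneg_lattice) auto
        then show ?case using Cons by (auto simp: add_increasing add_increasing2 simp del: sup.bounded_iff le_sup_iff)
      qed simp
      have "norm w \<le> real (length xs)" using xs(2) unfolding w_def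
      proof (induction xs)
        case (Cons a xs)
        then show ?case using norm_triangle_ineq[of "modulus a" "sum_list (map modulus xs)"] by simp
      qed simp
      then have nw: "norm ((1 / real n) *\<^sub>R w) \<le> 1" using n xs(1) by simp
      have "norm (T xs) \<le> norm (T (map modulus xs))" by (rule norm_pos_vform_le[OF T])
      also have "\<dots> \<le> norm (T (replicate n w))"
        by (rule norm_pos_vform_mono[OF T])
           (use le xs(1) in \<open>auto simp: list_all2_conv_all_nth simp del: sup.bounded_iff le_sup_iff\<close>)
      also have "replicate n w = replicate n (real n *\<^sub>R ((1 / real n) *\<^sub>R w))" using n by simp
      also have "T \<dots> = real n ^ n *\<^sub>R poly_of n T ((1 / real n) *\<^sub>R w)"
        unfolding poly_of_scale[OF vf] poly_of_def ..
      also have "norm \<dots> \<le> real n ^ n * ?C"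
        using poly_norm_upper[OF T n nw] by (simp add: mult_left_mono)
      finally have "norm (T xs) * norm g \<le> real n ^ n * ?C * norm g" by (rule mult_right_mono) simp
      then show "\<bar>blinfun_apply (T xs) g\<bar> \<le> real n ^ n * ?C * norm g"
        using norm_blinfun[of "T xs" g] by simp
    qed
  next
    case False
    then have "blinfun_apply (T xs) g = 0" by (rule sym_formD(1)[OF sf])
    then show ?thesis using poly_norm_nonneg[OF T n] prod_list_norm_nonneg[of xs] by simp
  qed
qed

section \<open>Orthogonally regular polynomials\<close>

definition orth_vspan ::
  "nat \<Rightarrow> ('a::banach_lattice list \<Rightarrow> ('g::banach_lattice \<Rightarrow>\<^sub>L real)) \<Rightarrow> bool" where
  "orth_vspan n T \<longleftrightarrow>
    (\<exists>A B. orth_vform n A \<and> orth_vform n B \<and> T = (\<lambda>xs. A xs - B xs))"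

lemma orth_vspanI:
  "orth_vform n A \<Longrightarrow> orth_vform n B \<Longrightarrow> orth_vspan n (\<lambda>xs. A xs - B xs)"
  by (auto simp: orth_vspan_def)

lemma orth_vspanE:
  assumes "orth_vspan n T"
  obtains A B where "orth_vform n A" "orth_vform n B" "T = (\<lambda>xs. A xs - B xs)"
  using assms by (auto simp: orth_vspan_def)

lemma orth_vform_span: "orth_vform n T \<Longrightarrow> orth_vspan n T"
  using orth_vspanI[of n T "\<lambda>xs. 0 *\<^sub>R T xs + 0 *\<^sub>R T xs"] orth_vform_comb[of n T T 0 0] by simp

lemma orth_vspan_add:
  assumes "orth_vspan n T" "orth_vspan n U"
  shows "orth_vspan n (\<lambda>xs. T xs + U xs)"
proof -
  obtain A B where T: "orth_vform n A" "orth_vform n B" "T = (\<lambda>xs. A xs - B xs)"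
    using assms(1) by (rule orth_vspanE)
  obtain C D where U: "orth_vform n C" "orth_vform n D" "U = (\<lambda>xs. C xs - D xs)"
    using assms(2) by (rule orth_vspanE)
  have "orth_vspan n (\<lambda>xs. (A xs + C xs) - (B xs + D xs))"
    using orth_vform_comb[OF T(1) U(1), of 1 1] orth_vform_comb[OF T(2) U(2), of 1 1]
    by (intro orth_vspanI) auto
  then show ?thesis by (simp add: T U algebra_simps)
qed

lemma orth_vspan_scale:
  assumes "orth_vspan n T"
  shows "orth_vspan n (\<lambda>xs. a *\<^sub>R T xs)"
proof -
  obtain A B where T: "orth_vform n A" "orth_vform n B" "T = (\<lambda>xs. A xs - B xs)"
    using assms(1) by (rule orth_vspanE)
  have scale: "orth_vform n (\<lambda>xs. b *\<^sub>R S xs)" if "0 \<le> b" "orth_vform n S" for b S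
    using orth_vform_comb[OF that(2,2), of b 0] that by simp
  show ?thesis
  proof (cases "0 \<le> a")
    case True
    then show ?thesis using orth_vspanI[OF scale[OF _ T(1)] scale[OF _ T(2)], of a a]
      by (simp add: T scaleR_diff_right)
  next
    case False
    then show ?thesis using orth_vspanI[OF scale[OF _ T(2)] scale[OF _ T(1)], of "- a" "- a"]
      by (simp add: T scaleR_diff_right)
  qed
qed

lemma orth_vspan_comb:
  "orth_vspan n T \<Longrightarrow> orth_vspan n U \<Longrightarrow> orth_vspan n (\<lambda>xs. a *\<^sub>R T xs + b *\<^sub>R U xs)"
  by (intro orth_vspan_add orth_vspan_scale)

lemma orth_vspan_diff:
  "orth_vspan n T \<Longrightarrow> orth_vspan n U \<Longrightarrow> orth_vspan n (\<lambda>xs. T xs - U xs)"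
  using orth_vspan_comb[of n T U 1 "- 1"] by simp

lemma orth_vspan_vform: "orth_vspan n T \<Longrightarrow> vform n T"
  using vform_comb[OF orth_vform_pos[THEN pos_vformD] orth_vform_pos[THEN pos_vformD], of n _ _ 1 "- 1"]
  by (auto elim!: orth_vspanE)

text \<open>Orthosymmetric positive forms are closed under domination: where the sum of two
  nonnegative values is 0, both are 0.\<close>

lemma orth_dominated:
  assumes A: "pos_vform n A" and B: "pos_vform n B" and C: "orth_vform n C"
    and eq: "\<And>xs. A xs + B xs = C xs"
  shows "orth_vform n A"
  unfolding orth_vform_def
proof (intro allI impI)
  fix g :: 'b assume g: "0 \<le> g"
  have pA: "pos_form n (\<lambda>xs. blinfun_apply (A xs) g)" and pB: "pos_form n (\<lambda>xs. blinfun_apply (B xs) g)"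
    using A B g by (auto simp: pos_vform_def)
  show "(\<lambda>xs. blinfun_apply (A xs) g) \<in> orth_cone n"
  proof (rule orth_coneI[OF pos_formD(1)[OF pA] pos_formD(2)[OF pA]])
    fix x y :: 'a and zs :: "'a list" assume xy: "inf x y = 0" and zs: "nonneg_list zs"
    have nn: "0 \<le> x" "0 \<le> y" using xy by (metis inf.cobounded1, metis inf.cobounded2)
    have "blinfun_apply (C (x # y # zs)) g = 0"
      by (rule orth_coneD(3)[OF C[unfolded orth_vform_def, rule_format, OF g] xy zs])
    then have "blinfun_apply (A (x # y # zs)) g + blinfun_apply (B (x # y # zs)) g = 0"
      by (simp flip: eq blinfun.add_left)
    moreover have "0 \<le> blinfun_apply (A (x # y # zs)) g" "0 \<le> blinfun_apply (B (x # y # zs)) g"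
      using pos_formD(2)[OF pA, of "x # y # zs"] pos_formD(2)[OF pB, of "x # y # zs"] nn zs by auto
    ultimately show "blinfun_apply (A (x # y # zs)) g = 0" by linarith
  qed
qed

lemma poly_le_iff:
  assumes n: "n \<ge> 1" and T: "vform n T" and U: "vform n U"
  shows "poly_le n (poly_of n T) (poly_of n U) \<longleftrightarrow> pos_vform n (\<lambda>xs. U xs - T xs)"
proof
  assume "poly_le n (poly_of n T) (poly_of n U)"
  then obtain D where D: "pos_vform n D" "(\<lambda>x. poly_of n U x - poly_of n T x) = poly_of n D"
    by (auto simp: poly_le_def positive_poly_iff[OF n])
  have "D = (\<lambda>xs. 1 *\<^sub>R U xs + (- 1) *\<^sub>R T xs)"
    by (rule poly_of_inject[OF pos_vformD[OF D(1)] vform_comb[OF U T]])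
       (use D(2) in \<open>simp add: poly_of_def fun_eq_iff\<close>)
  then show "pos_vform n (\<lambda>xs. U xs - T xs)" using D(1) by simp
next
  assume "pos_vform n (\<lambda>xs. U xs - T xs)"
  then show "poly_le n (poly_of n T) (poly_of n U)"
    unfolding poly_le_def positive_poly_iff[OF n] by (intro exI[of _ "\<lambda>xs. U xs - T xs"]) (simp add: poly_of_def)
qed

text \<open>The modulus of a difference \<open>A - B\<close> lies below \<open>A + B\<close>, which
  is orthosymmetric, so \<open>orth_dominated\<close> applies to it.\<close>

lemma orth_regular_abs:
  assumes n: "n \<ge> 1" and A: "orth_vform n A" and B: "orth_vform n B"
  obtains U where "orth_vform n U" "poly_abs n (poly_of n (\<lambda>xs. A xs - B xs)) = poly_of n U"
    "is_sup_in (regular_polys n) (poly_le n) (poly_of n (\<lambda>xs. A xs - B xs))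
      (\<lambda>x. - poly_of n (\<lambda>xs. A xs - B xs) x) (poly_of n U)"
proof -
  let ?P = "poly_of n (\<lambda>xs. A xs - B xs)"
  note pA = orth_vform_pos[OF A] and pB = orth_vform_pos[OF B]
  note vA = pos_vformD[OF pA] and vB = pos_vformD[OF pB]
  obtain U where U: "pos_vform n U" "poly_abs n ?P = poly_of n U"
    "is_sup_in (regular_polys n) (poly_le n) ?P (\<lambda>x. - ?P x) (poly_of n U)"
    using poly_abs_eq[OF n pA pB, of ?P] by (auto simp: poly_of_def)
  let ?S = "\<lambda>xs. A xs + B xs"
  have AB: "orth_vform n ?S" using orth_vform_comb[OF A B, of 1 1] by simp
  have "poly_of n ?S \<in> regular_polys n"
  proof -
    have "pos_vform n (\<lambda>xs. 0 *\<^sub>R A xs + 0 *\<^sub>R A xs)" by (rule pos_vform_comb[OF pA pA]) auto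
    then have "positive_poly n (poly_of n (\<lambda>xs. 0 *\<^sub>R A xs + 0 *\<^sub>R A xs))" using positive_poly_iff[OF n] by blast
    moreover have "positive_poly n (poly_of n ?S)" using positive_poly_iff[OF n] orth_vform_pos[OF AB] by blast
    ultimately show ?thesis unfolding regular_polys_def
      by (intro CollectI exI[of _ "poly_of n ?S"] exI[of _ "poly_of n (\<lambda>xs. 0 *\<^sub>R A xs + 0 *\<^sub>R A xs)"])
         (simp add: poly_of_def)
  qed
  moreover have "poly_le n ?P (poly_of n ?S)"
    unfolding poly_le_def positive_poly_iff[OF n]
    by (rule exI[of _ "\<lambda>xs. 1 *\<^sub>R B xs + 1 *\<^sub>R B xs"])
       (use pos_vform_comb[OF pB pB, of 1 1] in \<open>auto simp: poly_of_def\<close>)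
  moreover have "poly_le n (\<lambda>x. - ?P x) (poly_of n ?S)"
    unfolding poly_le_def positive_poly_iff[OF n]
    by (rule exI[of _ "\<lambda>xs. 1 *\<^sub>R A xs + 1 *\<^sub>R A xs"])
       (use pos_vform_comb[OF pA pA, of 1 1] in \<open>auto simp: poly_of_def\<close>)
  ultimately have "poly_le n (poly_of n U) (poly_of n ?S)" using U(3) unfolding is_sup_in_def by blast
  then have "pos_vform n (\<lambda>xs. ?S xs - U xs)"
    using poly_le_iff[OF n pos_vformD[OF U(1)] pos_vformD[OF orth_vform_pos[OF AB]]] by blast
  then have "orth_vform n U" by (rule orth_dominated[OF U(1) _ AB]) simp
  then show ?thesis using that U by blast
qed

text \<open>If \<open>U\<close> is the orthosymmetric form of the modulus, the positive forms
  \<open>U + T\<close> and \<open>U - T\<close> sum to \<open>2 U\<close>, hence are orthosymmetric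
  themselves; \<open>T\<close> is half their difference. The converse is
  \<open>orth_regular_abs\<close>.\<close>

lemma orth_regular_polys_eq:
  assumes n: "n \<ge> 1"
  shows "orth_regular_polys n = poly_of n ` {T. orth_vspan n T}"
proof (intro set_eqI iffI)
  fix P :: "'a \<Rightarrow> ('b \<Rightarrow>\<^sub>L real)" assume "P \<in> orth_regular_polys n"
  then have reg: "P \<in> regular_polys n" and oa: "orth_additive (poly_abs n P)"
    by (auto simp: orth_regular_polys_def)
  obtain T1 T2 where T: "pos_vform n T1" "pos_vform n T2" "P = (\<lambda>x. poly_of n T1 x - poly_of n T2 x)"
    using reg unfolding regular_polys_def positive_poly_iff[OF n] by blast
  obtain U where U: "pos_vform n U" "poly_abs n P = poly_of n U"
    "is_sup_in (regular_polys n) (poly_le n) P (\<lambda>x. - P x) (poly_of n U)"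
    using poly_abs_eq[OF n T] by blast
  define T where "T = (\<lambda>xs. 1 *\<^sub>R T1 xs + (- 1) *\<^sub>R T2 xs)"
  have vT: "vform n T" and vT': "vform n (\<lambda>xs. - T xs)"
    using vform_comb[OF T(1,2)[THEN pos_vformD], of 1 "- 1"]
      vform_comb[OF T(1,2)[THEN pos_vformD], of "- 1" 1] by (simp_all add: T_def)
  have P: "P = poly_of n T" "(\<lambda>x. - P x) = poly_of n (\<lambda>xs. - T xs)" by (simp_all add: T T_def poly_of_def)
  have oU: "orth_vform n U" using oa U orth_additive_iff[OF U(1) n] by simp
  have "poly_le n P (poly_of n U)" "poly_le n (\<lambda>x. - P x) (poly_of n U)"
    using U(3) by (auto simp: is_sup_in_def)
  then have "poly_le n (poly_of n T) (poly_of n U)" "poly_le n (poly_of n (\<lambda>xs. - T xs)) (poly_of n U)"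
    by (simp only: P(1), simp only: P(2))
  then have pos: "pos_vform n (\<lambda>xs. U xs - T xs)" "pos_vform n (\<lambda>xs. U xs - - T xs)"
    unfolding poly_le_iff[OF n vT pos_vformD[OF U(1)]] poly_le_iff[OF n vT' pos_vformD[OF U(1)]] by auto
  have U2: "orth_vform n (\<lambda>xs. 1 *\<^sub>R U xs + 1 *\<^sub>R U xs)" by (rule orth_vform_comb[OF oU oU]) auto
  have "orth_vform n (\<lambda>xs. U xs - T xs)" "orth_vform n (\<lambda>xs. U xs - - T xs)"
    by (rule orth_dominated[OF pos U2], simp) (rule orth_dominated[OF pos(2,1) U2], simp)
  then have "orth_vspan n (\<lambda>xs. (1/2) *\<^sub>R ((U xs - - T xs) - (U xs - T xs)))"
    by (intro orth_vspan_scale orth_vspanI)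
  moreover have "(\<lambda>xs. (1/2) *\<^sub>R ((U xs - - T xs) - (U xs - T xs))) = T"
  proof
    fix xs
    have "(U xs - - T xs) - (U xs - T xs) = 2 *\<^sub>R T xs" by (simp add: scaleR_2)
    then show "(1/2) *\<^sub>R ((U xs - - T xs) - (U xs - T xs)) = T xs" by simp
  qed
  ultimately show "P \<in> poly_of n ` {T. orth_vspan n T}" using P(1) by simp
next
  fix P :: "'a \<Rightarrow> ('b \<Rightarrow>\<^sub>L real)" assume "P \<in> poly_of n ` {T. orth_vspan n T}"
  then obtain A B where AB: "orth_vform n A" "orth_vform n B" and P: "P = poly_of n (\<lambda>xs. A xs - B xs)"
    by (auto elim!: orth_vspanE)
  obtain U where U: "orth_vform n U" "poly_abs n P = poly_of n U"
    using orth_regular_abs[OF n AB] P by metis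
  have "orth_additive (poly_abs n P)"
    unfolding U(2) using orth_additive_iff[OF orth_vform_pos[OF U(1)] n] U(1) by simp
  moreover have "P \<in> regular_polys n" unfolding regular_polys_def positive_poly_iff[OF n]
    using AB[THEN orth_vform_pos] by (force simp: P poly_of_def)
  ultimately show "P \<in> orth_regular_polys n" by (simp add: orth_regular_polys_def)
qed

text \<open>A positive difference \<open>A - B\<close> is dominated by \<open>A\<close>. The order
  on the span is therefore governed by the cone, which the transfer preserves.\<close>

lemma orth_vspan_pos:
  assumes "orth_vspan n T" "pos_vform n T"
  shows "orth_vform n T"
proof -
  obtain A B where T: "orth_vform n A" "orth_vform n B" "T = (\<lambda>xs. A xs - B xs)"
    using assms(1) by (rule orth_vspanE)
  show ?thesis by (rule orth_dominated[OF assms(2) orth_vform_pos[OF T(2)] T(1)]) (simp add: T(3))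
qed

lemma orth_vspan_scalar:
  assumes "orth_vspan n T"
  shows "(\<lambda>xs. blinfun_apply (T xs) g) \<in> orth_span n"
proof -
  obtain A B where T: "orth_vform n A" "orth_vform n B" "T = (\<lambda>xs. A xs - B xs)"
    using assms(1) by (rule orth_vspanE)
  have "(\<lambda>xs. blinfun_apply (T xs) h) \<in> orth_span n" if "0 \<le> h" for h
    using orth_spanI[of "\<lambda>xs. blinfun_apply (A xs) h" n "\<lambda>xs. blinfun_apply (B xs) h"] T that
    by (simp add: orth_vform_def blinfun.diff_left)
  from orth_span_comb[OF this[OF zero_le_pprt, of g] this[OF zero_le_pprt, of "- g"], of 1 "- 1"]
  show ?thesis by (simp add: blinfun_apply_split[of _ g])
qed

section \<open>Transfer of orthogonally additive polynomials\<close>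

definition transfer_vec ::
  "(('e::real_normed_vector \<Rightarrow>\<^sub>L real) \<Rightarrow> ('f::real_normed_vector \<Rightarrow>\<^sub>L real)) \<Rightarrow>
    ('e list \<Rightarrow> ('g::real_normed_vector \<Rightarrow>\<^sub>L real)) \<Rightarrow> 'f list \<Rightarrow> ('g \<Rightarrow>\<^sub>L real)"
  where "transfer_vec s T ys = Blinfun (\<lambda>g. transfer_form s (\<lambda>xs. blinfun_apply (T xs) g) ys)"

text \<open>The description is unique by polarization, and it selects a form for every polynomial
  arising from \<open>orth_vspan\<close>.\<close>

definition form_of :: "nat \<Rightarrow> ('a::banach_lattice \<Rightarrow> ('g::banach_lattice \<Rightarrow>\<^sub>L real)) \<Rightarrow> 'a list \<Rightarrow> ('g \<Rightarrow>\<^sub>L real)"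
  where "form_of n P = (THE T. orth_vspan n T \<and> poly_of n T = P)"

lemma form_of_poly_of: "orth_vspan n T \<Longrightarrow> form_of n (poly_of n T) = T"
  unfolding form_of_def by (rule the_equality) (auto dest: orth_vspan_vform intro: poly_of_inject)

definition transfer_poly ::
  "(('e::banach_lattice \<Rightarrow>\<^sub>L real) \<Rightarrow> ('f::banach_lattice \<Rightarrow>\<^sub>L real)) \<Rightarrow> nat \<Rightarrow>
    ('e \<Rightarrow> ('g::banach_lattice \<Rightarrow>\<^sub>L real)) \<Rightarrow> 'f \<Rightarrow> ('g \<Rightarrow>\<^sub>L real)"
  where "transfer_poly s n P = poly_of n (transfer_vec s (form_of n P))"

context dual_iso
begin

lemma norm_s_le: "norm (s \<phi>) \<le> onorm s * norm \<phi>" by (rule onorm[OF bls])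

lemma transfer_scalar_bound:
  fixes T :: "'e list \<Rightarrow> ('g::banach_lattice \<Rightarrow>\<^sub>L real)"
  assumes T: "orth_vform n T" and n: "n \<ge> 1"
  shows "\<bar>transfer_form s (\<lambda>xs. blinfun_apply (T xs) g) ys\<bar> \<le>
    real n ^ n * poly_norm (poly_of n T) * norm g * onorm s ^ length ys * prod_list (map norm ys)"
  by (rule transfer_bound[OF orth_vspan_scalar[OF orth_vform_span[OF T]]
        pos_vform_bound[OF orth_vform_pos[OF T] n] _ norm_s_le onorm_pos_le[OF bls]])
     (use poly_norm_nonneg[OF orth_vform_pos[OF T] n] in simp)

text \<open>The scalar transfer is carried out for each \<open>g\<close> separately, so continuity
  in \<open>g\<close> has to be recovered; for a positive form the explicit bound is proportional to
  \<open>norm g\<close>.\<close>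

lemma transfer_vec_bounded:
  fixes T :: "'e list \<Rightarrow> ('g::banach_lattice \<Rightarrow>\<^sub>L real)"
  assumes "orth_vspan n T" and n: "n \<ge> 1"
  shows "bounded_linear (\<lambda>g. transfer_form s (\<lambda>xs. blinfun_apply (T xs) g) ys)"
proof -
  have cone: "bounded_linear (\<lambda>g. transfer_form s (\<lambda>xs. blinfun_apply (A xs) g) ys)"
    if A: "orth_vform n A" for A :: "'e list \<Rightarrow> ('g \<Rightarrow>\<^sub>L real)"
  proof -
    note sp = orth_vspan_scalar[OF orth_vform_span[OF A]]
    show ?thesis
    proof (rule bounded_linear_intro)
      fix g h
      show "transfer_form s (\<lambda>xs. blinfun_apply (A xs) (g + h)) ys =
          transfer_form s (\<lambda>xs. blinfun_apply (A xs) g) ys + transfer_form s (\<lambda>xs. blinfun_apply (A xs) h) ys"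
        using fun_cong[OF transfer_comb[OF sp sp, of 1 g 1 h], of ys] by (simp add: blinfun.add_right)
    next
      fix t g
      show "transfer_form s (\<lambda>xs. blinfun_apply (A xs) (t *\<^sub>R g)) ys =
          t *\<^sub>R transfer_form s (\<lambda>xs. blinfun_apply (A xs) g) ys"
        using fun_cong[OF transfer_comb[OF sp sp, of t g 0 g], of ys] by (simp add: blinfun.scaleR_right)
    next
      fix g
      show "norm (transfer_form s (\<lambda>xs. blinfun_apply (A xs) g) ys) \<le>
          norm g * (real n ^ n * poly_norm (poly_of n A) * onorm s ^ length ys * prod_list (map norm ys))"
        using transfer_scalar_bound[OF A n, of g ys] by (simp add: mult.commute mult.left_commute)
    qed
  qed
  obtain A B where T: "orth_vform n A" "orth_vform n B" "T = (\<lambda>xs. A xs - B xs)"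
    using assms(1) by (rule orth_vspanE)
  have "transfer_form s (\<lambda>xs. blinfun_apply (T xs) g) ys =
      transfer_form s (\<lambda>xs. blinfun_apply (A xs) g) ys - transfer_form s (\<lambda>xs. blinfun_apply (B xs) g) ys" for g
    using fun_cong[OF transfer_comb[OF T(1,2)[THEN orth_vform_span, THEN orth_vspan_scalar], of 1 g "- 1" g], of ys]
    by (simp add: T(3) blinfun.diff_left)
  then show ?thesis using bounded_linear_sub[OF cone[OF T(1)] cone[OF T(2)]] by simp
qed

lemma transfer_vec_apply:
  "orth_vspan n T \<Longrightarrow> n \<ge> 1 \<Longrightarrow>
    blinfun_apply (transfer_vec s T ys) g = transfer_form s (\<lambda>xs. blinfun_apply (T xs) g) ys"
  by (simp add: transfer_vec_def bounded_linear_Blinfun_apply transfer_vec_bounded)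

lemma transfer_vec_orth:
  assumes T: "orth_vform n T" and n: "n \<ge> 1"
  shows "orth_vform n (transfer_vec s T)"
  unfolding orth_vform_def transfer_vec_apply[OF orth_vform_span[OF T] n]
  using T transfer_orth_cone[of _ n] by (simp add: orth_vform_def)

lemma transfer_vec_comb:
  assumes "orth_vspan n T" "orth_vspan n U" "n \<ge> 1"
  shows "transfer_vec s (\<lambda>xs. a *\<^sub>R T xs + b *\<^sub>R U xs) =
    (\<lambda>ys. a *\<^sub>R transfer_vec s T ys + b *\<^sub>R transfer_vec s U ys)"
proof (intro ext blinfun_eqI)
  fix ys g
  show "blinfun_apply (transfer_vec s (\<lambda>xs. a *\<^sub>R T xs + b *\<^sub>R U xs) ys) g =
      blinfun_apply (a *\<^sub>R transfer_vec s T ys + b *\<^sub>R transfer_vec s U ys) g"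
    using fun_cong[OF transfer_comb[OF assms(1,2)[THEN orth_vspan_scalar], of a g b g], of ys]
    by (simp add: transfer_vec_apply[OF orth_vspan_comb[OF assms(1,2)] assms(3)]
        transfer_vec_apply[OF assms(1,3)] transfer_vec_apply[OF assms(2,3)] blinfun.add_left blinfun.scaleR_left)
qed

lemma transfer_vec_diff:
  assumes "orth_vspan n T" "orth_vspan n U" "n \<ge> 1"
  shows "transfer_vec s (\<lambda>xs. T xs - U xs) = (\<lambda>ys. transfer_vec s T ys - transfer_vec s U ys)"
  using transfer_vec_comb[OF assms, of 1 "- 1"] by simp

lemma transfer_vec_span:
  assumes "orth_vspan n T" and n: "n \<ge> 1"
  shows "orth_vspan n (transfer_vec s T)"
proof -
  obtain A B where T: "orth_vform n A" "orth_vform n B" "T = (\<lambda>xs. A xs - B xs)"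
    using assms(1) by (rule orth_vspanE)
  show ?thesis unfolding T(3) transfer_vec_diff[OF T(1,2)[THEN orth_vform_span] n]
    by (intro orth_vspanI transfer_vec_orth T n)
qed

lemma transfer_vec_inverse:
  assumes T: "orth_vspan n T" and n: "n \<ge> 1"
  shows "transfer_vec r (transfer_vec s T) = T"
proof (intro ext blinfun_eqI)
  interpret inv: dual_iso r s by (rule dual_iso_inverse)
  fix xs g
  have "(\<lambda>ys. blinfun_apply (transfer_vec s T ys) g) = transfer_form s (\<lambda>xs. blinfun_apply (T xs) g)"
    by (rule ext) (rule transfer_vec_apply[OF T n])
  then show "blinfun_apply (transfer_vec r (transfer_vec s T) xs) g = blinfun_apply (T xs) g"
    by (simp add: inv.transfer_vec_apply[OF transfer_vec_span[OF T n] n]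
        transfer_inverse[OF orth_vspan_scalar[OF T]])
qed

lemma transfer_poly_of:
  "orth_vspan n T \<Longrightarrow> transfer_poly s n (poly_of n T) = poly_of n (transfer_vec s T)"
  by (simp add: transfer_poly_def form_of_poly_of)

context
  fixes n :: nat assumes n: "n \<ge> 1"
begin

lemma transfer_poly_mem: "P \<in> orth_regular_polys n \<Longrightarrow> transfer_poly s n P \<in> orth_regular_polys n"
  unfolding orth_regular_polys_eq[OF n] using n by (auto simp: transfer_poly_of intro!: imageI transfer_vec_span)

lemma transfer_poly_inverse: "P \<in> orth_regular_polys n \<Longrightarrow> transfer_poly r n (transfer_poly s n P) = P"
proof -
  interpret inv: dual_iso r s by (rule dual_iso_inverse)
  assume "P \<in> orth_regular_polys n"
  then show ?thesis unfolding orth_regular_polys_eq[OF n]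
    using n by (auto simp: transfer_poly_of inv.transfer_poly_of transfer_vec_span transfer_vec_inverse)
qed

lemma transfer_poly_comb:
  assumes "P \<in> orth_regular_polys n" "Q \<in> orth_regular_polys n"
  shows "transfer_poly s n (\<lambda>x. a *\<^sub>R P x + b *\<^sub>R Q x) = (\<lambda>y. a *\<^sub>R transfer_poly s n P y + b *\<^sub>R transfer_poly s n Q y)"
proof -
  obtain T U where T: "orth_vspan n T" "P = poly_of n T" and U: "orth_vspan n U" "Q = poly_of n U"
    using assms unfolding orth_regular_polys_eq[OF n] by blast
  have "(\<lambda>x. a *\<^sub>R P x + b *\<^sub>R Q x) = poly_of n (\<lambda>xs. a *\<^sub>R T xs + b *\<^sub>R U xs)"
    by (simp add: T U poly_of_def)
  then show ?thesis
    by (simp add: transfer_poly_of[OF orth_vspan_comb[OF T(1) U(1)]] transfer_vec_comb[OF T(1) U(1) n]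
        transfer_poly_of[OF T(1)] transfer_poly_of[OF U(1)] T(2) U(2)) (simp add: poly_of_def)
qed

lemma transfer_poly_le:
  assumes "P \<in> orth_regular_polys n" "Q \<in> orth_regular_polys n" "poly_le n P Q"
  shows "poly_le n (transfer_poly s n P) (transfer_poly s n Q)"
proof -
  obtain T U where T: "orth_vspan n T" "P = poly_of n T" and U: "orth_vspan n U" "Q = poly_of n U"
    using assms unfolding orth_regular_polys_eq[OF n] by blast
  have "pos_vform n (\<lambda>xs. U xs - T xs)"
    using assms(3) poly_le_iff[OF n T(1)[THEN orth_vspan_vform] U(1)[THEN orth_vspan_vform]]
    by (simp add: T U)
  then have "orth_vform n (\<lambda>xs. U xs - T xs)"
    by (intro orth_vspan_pos orth_vspan_diff T U)
  from transfer_vec_orth[OF this n, THEN orth_vform_pos]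
  have "pos_vform n (\<lambda>ys. transfer_vec s U ys - transfer_vec s T ys)"
    by (simp add: transfer_vec_diff[OF U(1) T(1) n])
  then show ?thesis
    using poly_le_iff[OF n T(1)[THEN transfer_vec_span[OF _ n], THEN orth_vspan_vform]
        U(1)[THEN transfer_vec_span[OF _ n], THEN orth_vspan_vform]]
    by (simp add: T(2) U(2) transfer_poly_of[OF T(1)] transfer_poly_of[OF U(1)])
qed

lemma poly_norm_transfer_le:
  fixes U :: "'e list \<Rightarrow> ('g::banach_lattice \<Rightarrow>\<^sub>L real)"
  assumes U: "orth_vform n U"
  shows "poly_norm (poly_of n (transfer_vec s U)) \<le> real n ^ n * onorm s ^ n * poly_norm (poly_of n U)"
proof (rule poly_norm_le)
  fix y :: 'f assume y: "norm y \<le> 1"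
  note nn = poly_norm_nonneg[OF orth_vform_pos[OF U] n] onorm_pos_le[OF bls]
  show "norm (poly_of n (transfer_vec s U) y) \<le> real n ^ n * onorm s ^ n * poly_norm (poly_of n U)"
    unfolding poly_of_def[of n "transfer_vec s U"]
  proof (rule norm_blinfun_bound)
    fix g :: 'g
    let ?c = "real n ^ n * poly_norm (poly_of n U) * norm g * onorm s ^ n"
    have "\<bar>blinfun_apply (transfer_vec s U (replicate n y)) g\<bar> \<le> ?c * norm y ^ n"
      using transfer_scalar_bound[OF U n, of g "replicate n y"]
      by (simp add: transfer_vec_apply[OF orth_vform_span[OF U] n])
    also have "\<dots> \<le> ?c" using y nn by (intro mult_left_le power_le_one) auto
    finally show "norm (blinfun_apply (transfer_vec s U (replicate n y)) g)
        \<le> real n ^ n * onorm s ^ n * poly_norm (poly_of n U) * norm g"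
      by (simp add: mult.commute mult.left_commute)
  qed (use nn in simp)
qed

text \<open>The transfer preserves order, so the modulus of the transferred polynomial lies below
  the transfer of the modulus. The estimate for positive forms thus suffices.\<close>

lemma regular_norm_transfer_le:
  assumes "P \<in> orth_regular_polys n"
  shows "regular_norm n (transfer_poly s n P) \<le> real n ^ n * onorm s ^ n * regular_norm n P"
proof -
  obtain A B where AB: "orth_vform n A" "orth_vform n B" and P: "P = poly_of n (\<lambda>xs. A xs - B xs)"
    using assms unfolding orth_regular_polys_eq[OF n] by (auto elim!: orth_vspanE)
  obtain U where U: "orth_vform n U" "poly_abs n P = poly_of n U"
    "is_sup_in (regular_polys n) (poly_le n) P (\<lambda>x. - P x) (poly_of n U)"
    using orth_regular_abs[OF n AB] unfolding P by blast
  let ?t = "transfer_vec s" and ?Q = "transfer_poly s n P"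
  have Q: "?Q = poly_of n (\<lambda>ys. ?t A ys - ?t B ys)"
    unfolding P transfer_poly_of[OF orth_vspanI[OF AB]]
    by (simp add: transfer_vec_diff[OF AB[THEN orth_vform_span] n])
  obtain U' where U': "orth_vform n U'" "poly_abs n ?Q = poly_of n U'"
    "is_sup_in (regular_polys n) (poly_le n) ?Q (\<lambda>x. - ?Q x) (poly_of n U')"
    using orth_regular_abs[OF n transfer_vec_orth[OF AB(1) n] transfer_vec_orth[OF AB(2) n]] unfolding Q by blast
  have Umem: "poly_of n U \<in> orth_regular_polys n"
    using orth_vform_span[OF U(1)] by (auto simp: orth_regular_polys_eq[OF n])
  have neg: "(\<lambda>x. - P x) \<in> orth_regular_polys n" "transfer_poly s n (\<lambda>x. - P x) = (\<lambda>y. - ?Q y)"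
  proof -
    have "(\<lambda>x. - P x) = poly_of n (\<lambda>xs. B xs - A xs)" by (simp add: P poly_of_def)
    then show "(\<lambda>x. - P x) \<in> orth_regular_polys n"
      using orth_vspanI[OF AB(2,1)] by (auto simp: orth_regular_polys_eq[OF n])
    show "transfer_poly s n (\<lambda>x. - P x) = (\<lambda>y. - ?Q y)"
      using transfer_poly_comb[OF assms assms, of "- 1" 0] by simp
  qed
  have tU: "transfer_poly s n (poly_of n U) = poly_of n (?t U)"
    by (rule transfer_poly_of[OF orth_vform_span[OF U(1)]])
  have "poly_le n P (poly_of n U)" "poly_le n (\<lambda>x. - P x) (poly_of n U)"
    using U(3) by (auto simp: is_sup_in_def)
  from transfer_poly_le[OF assms Umem this(1)] transfer_poly_le[OF neg(1) Umem this(2)]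
  have "poly_le n ?Q (poly_of n (?t U))" "poly_le n (\<lambda>x. - ?Q x) (poly_of n (?t U))"
    by (simp_all only: tU neg(2))
  moreover have "poly_of n (?t U) \<in> regular_polys n"
    using transfer_poly_mem[OF Umem] by (simp add: tU orth_regular_polys_def)
  ultimately have "poly_le n (poly_of n U') (poly_of n (?t U))"
    using U'(3) unfolding is_sup_in_def by blast
  note tUo = transfer_vec_orth[OF U(1) n]
  have D: "pos_vform n (\<lambda>ys. ?t U ys - U' ys)"
    using poly_le_iff[OF n pos_vformD[OF orth_vform_pos[OF U'(1)]] pos_vformD[OF orth_vform_pos[OF tUo]]]
      \<open>poly_le n (poly_of n U') (poly_of n (?t U))\<close> by blast
  have "poly_norm (poly_of n U') \<le> poly_norm (poly_of n (?t U))"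
  proof (rule poly_norm_le)
    fix y :: 'f assume y: "norm y \<le> 1"
    have "norm (U' (replicate n y)) \<le> norm (?t U (replicate n (modulus y)))"
    proof (rule norm_blinfun_le_modulus)
      fix g
      have "\<bar>blinfun_apply (U' (replicate n y)) g\<bar> \<le> blinfun_apply (U' (replicate n (modulus y))) (modulus g)"
        using pos_vform_abs_le[OF orth_vform_pos[OF U'(1)], of "replicate n y"] by simp
      also have "\<dots> \<le> blinfun_apply (?t U (replicate n (modulus y))) (modulus g)"
        using D[unfolded pos_vform_def, rule_format, OF modulus_nonneg, THEN pos_formD(2), of "replicate n (modulus y)" g]
        by (simp add: blinfun.diff_left)
      finally show "\<bar>blinfun_apply (U' (replicate n y)) g\<bar> \<le> blinfun_apply (?t U (replicate n (modulus y))) (modulus g)" .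
    qed
    also have "\<dots> \<le> poly_norm (poly_of n (?t U))"
      using poly_norm_upper[OF orth_vform_pos[OF tUo] n, of "modulus y"] y by (simp add: poly_of_def)
    finally show "norm (poly_of n U' y) \<le> poly_norm (poly_of n (?t U))" by (simp add: poly_of_def)
  qed
  also have "\<dots> \<le> real n ^ n * onorm s ^ n * poly_norm (poly_of n U)" by (rule poly_norm_transfer_le[OF U(1)])
  finally show ?thesis by (simp add: regular_norm_def U(2) U'(2))
qed

end

end

section \<open>From the isomorphism of the duals to that of the polynomial lattices\<close>

lemma dual_iso_orth_polys_isomorphic:
  fixes s :: "('e::banach_lattice \<Rightarrow>\<^sub>L real) \<Rightarrow> ('f::banach_lattice \<Rightarrow>\<^sub>L real)"
  assumes "dual_iso s r" and n: "n \<ge> 1"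
  shows "orth_poly_lattice_isomorphic n
    (orth_regular_polys n :: ('e \<Rightarrow> ('g::banach_lattice \<Rightarrow>\<^sub>L real)) set)
    (orth_regular_polys n :: ('f \<Rightarrow> ('g \<Rightarrow>\<^sub>L real)) set)"
  unfolding orth_poly_lattice_isomorphic_def lattice_isomorphic_def
proof (intro exI conjI)
  interpret dual_iso s r by (rule assms(1))
  interpret inv: dual_iso r s by (rule dual_iso_inverse)
  let ?E = "orth_regular_polys n :: ('e \<Rightarrow> ('g \<Rightarrow>\<^sub>L real)) set"
  let ?F = "orth_regular_polys n :: ('f \<Rightarrow> ('g \<Rightarrow>\<^sub>L real)) set"
  let ?\<Phi> = "transfer_poly s n :: ('e \<Rightarrow> ('g \<Rightarrow>\<^sub>L real)) \<Rightarrow> 'f \<Rightarrow> ('g \<Rightarrow>\<^sub>L real)"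
  note inv1 = transfer_poly_inverse[OF n] and inv2 = inv.transfer_poly_inverse[OF n]
  show bij: "bij_betw ?\<Phi> ?E ?F"
    by (rule bij_betwI[where g = "transfer_poly r n"])
       (auto simp: inv1 inv2 transfer_poly_mem[OF n] inv.transfer_poly_mem[OF n])
  show "\<forall>P\<in>?E. \<forall>Q\<in>?E. ?\<Phi> (\<lambda>x. P x + Q x) = (\<lambda>x. ?\<Phi> P x + ?\<Phi> Q x)"
  proof (intro ballI)
    fix P Q assume PQ: "P \<in> ?E" "Q \<in> ?E"
    show "?\<Phi> (\<lambda>x. P x + Q x) = (\<lambda>x. ?\<Phi> P x + ?\<Phi> Q x)" using transfer_poly_comb[OF n PQ, of 1 1] by simp
  qed
  show "\<forall>a. \<forall>P\<in>?E. ?\<Phi> (\<lambda>x. a *\<^sub>R P x) = (\<lambda>x. a *\<^sub>R ?\<Phi> P x)"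
  proof (intro allI ballI)
    fix a P assume P: "P \<in> ?E"
    show "?\<Phi> (\<lambda>x. a *\<^sub>R P x) = (\<lambda>x. a *\<^sub>R ?\<Phi> P x)" using transfer_poly_comb[OF n P P, of a 0] by simp
  qed
  \<comment> \<open>Both transfers preserve order, so the bijection is an order isomorphism, and
    suprema within the two carriers correspond.\<close>
  have le: "poly_le n (?\<Phi> P) (?\<Phi> Q) \<longleftrightarrow> poly_le n P Q" if "P \<in> ?E" "Q \<in> ?E" for P Q
    using transfer_poly_le[OF n that]
      inv.transfer_poly_le[OF n transfer_poly_mem[OF n that(1)] transfer_poly_mem[OF n that(2)]] that
    by (auto simp: inv1)
  show "\<forall>P\<in>?E. \<forall>Q\<in>?E. \<forall>S\<in>?E. is_sup_in ?E (poly_le n) P Q S \<longleftrightarrow> is_sup_in ?F (poly_le n) (?\<Phi> P) (?\<Phi> Q) (?\<Phi> S)"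
  proof (intro ballI)
    fix P Q S assume PQS: "P \<in> ?E" "Q \<in> ?E" "S \<in> ?E"
    have F: "?F = ?\<Phi> ` ?E" using bij by (simp add: bij_betw_def)
    show "is_sup_in ?E (poly_le n) P Q S \<longleftrightarrow> is_sup_in ?F (poly_le n) (?\<Phi> P) (?\<Phi> Q) (?\<Phi> S)"
      unfolding is_sup_in_def F using PQS by (simp add: le)
  qed
  show "\<forall>P\<in>?E. regular_norm n (?\<Phi> P) \<le> (real n ^ n * onorm s ^ n) * regular_norm n P"
    using regular_norm_transfer_le[OF n] by blast
  show "\<forall>P\<in>?E. regular_norm n P \<le> (real n ^ n * onorm r ^ n) * regular_norm n (?\<Phi> P)"
  proof
    fix P assume P: "P \<in> ?E"
    show "regular_norm n P \<le> (real n ^ n * onorm r ^ n) * regular_norm n (?\<Phi> P)"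
      using inv.regular_norm_transfer_le[OF n transfer_poly_mem[OF n P]] by (simp add: inv1[OF P])
  qed
qed

lemma dual_iso_of_lattice_isomorphic:
  assumes "dual_lattice_isomorphic (UNIV :: ('e::banach_lattice \<Rightarrow>\<^sub>L real) set)
                                   (UNIV :: ('f::banach_lattice \<Rightarrow>\<^sub>L real) set)"
  obtains s :: "('e::banach_lattice \<Rightarrow>\<^sub>L real) \<Rightarrow> ('f::banach_lattice \<Rightarrow>\<^sub>L real)" and r where "dual_iso s r"
proof -
  obtain s :: "('e \<Rightarrow>\<^sub>L real) \<Rightarrow> ('f \<Rightarrow>\<^sub>L real)" and K L where s: "bij s"
    "\<And>x y. s (x + y) = s x + s y" "\<And>a x. s (a *\<^sub>R x) = a *\<^sub>R s x"
    "\<And>x y z. is_sup_in UNIV dual_le x y z \<longleftrightarrow> is_sup_in UNIV dual_le (s x) (s y) (s z)"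
    "\<And>x. norm (s x) \<le> K * norm x" "\<And>x. norm x \<le> L * norm (s x)"
    using assms unfolding dual_lattice_isomorphic_def lattice_isomorphic_def by auto
  define r where "r = inv s"
  have sr: "s (r y) = y" for y using s(1) by (simp add: r_def bij_is_surj surj_f_inv_f)
  have rs: "r (s x) = x" for x using s(1) by (simp add: r_def bij_is_inj)
  have bls: "bounded_linear s"
    by (rule bounded_linear_intro[of _ K]) (use s in \<open>auto simp: mult.commute\<close>)
  have blr: "bounded_linear r"
  proof (rule bounded_linear_intro[of _ L])
    show "r (x + y) = r x + r y" for x y by (metis sr rs s(2))
    show "r (a *\<^sub>R x) = a *\<^sub>R r x" for a x by (metis sr rs s(3))
    show "norm (r x) \<le> norm x * L" for x using s(6)[of "r x"] by (simp add: sr mult.commute)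
  qed
  \<comment> \<open>Only suprema are known to be preserved, so positivity is expressed as
    \<open>\<phi>\<close> being the supremum of 0 and itself.\<close>
  have pos_iff: "pos_functional \<phi> \<longleftrightarrow> is_sup_in UNIV dual_le 0 \<phi> \<phi>" for \<phi> :: "'x::banach_lattice \<Rightarrow>\<^sub>L real"
    by (auto simp: pos_functional_def is_sup_in_def dual_le_def)
  have s0: "s 0 = 0" using s(3)[of 0 0] by simp
  have "pos_functional (s \<phi>)" if "pos_functional \<phi>" for \<phi>
    using that s(4)[of 0 \<phi> \<phi>] by (simp add: pos_iff s0)
  moreover have "pos_functional (r \<psi>)" if "pos_functional \<psi>" for \<psi>
    using that s(4)[of 0 "r \<psi>" "r \<psi>"] by (simp add: pos_iff s0 sr)
  ultimately show ?thesis using that dual_iso.intro[OF bls blr sr rs] by blast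
qed

theorem theorem2p10:
  assumes "dual_lattice_isomorphic (UNIV :: ('e::banach_lattice \<Rightarrow>\<^sub>L real) set)
                                   (UNIV :: ('f::banach_lattice \<Rightarrow>\<^sub>L real) set)"
    and "dual_order_continuous_norm (UNIV :: ('e \<Rightarrow>\<^sub>L real) set)
         \<or> dual_order_continuous_norm (UNIV :: ('f \<Rightarrow>\<^sub>L real) set)"
    and "(n::nat) \<ge> 1"
  shows "orth_poly_lattice_isomorphic n
           (orth_regular_polys n :: ('e \<Rightarrow> ('g::banach_lattice \<Rightarrow>\<^sub>L real)) set)
           (orth_regular_polys n :: ('f \<Rightarrow> ('g \<Rightarrow>\<^sub>L real)) set)"
proof -
  obtain s :: "('e \<Rightarrow>\<^sub>L real) \<Rightarrow> ('f \<Rightarrow>\<^sub>L real)" and r where "dual_iso s r"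
    using assms(1) by (rule dual_iso_of_lattice_isomorphic)
  then show ?thesis using assms(3) by (rule dual_iso_orth_polys_isomorphic)
qed

end
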